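(* Let $V(t)$, $t\in\mathbb R$, be a centered real-valued Gaussian process with stationary increments, continuous sample paths, variance function $\sigma_V^2(t)=\operatorname{Var}(V(t))$, and $\sigma_V(0)=0$. Assume that $\sigma_V$ is regularly varying at infinity with index $H\in(0,1)$. Then $$\lim_{T\to\infty}\frac{-\ln \mathcal G_V(T)}{\gamma_V(T)}=A_{B_H},$$ where $$A_{B_H}=\begin{cases}\dfrac{\Gamma\left(H+\frac12\right)\Gamma(1-2H)}{\Gamma\left(\frac12-H\right)}\in(1/2,1), & H\in(0,1/2),\\[2mm] \dfrac12, & H\in[1/2,1).\end{cases}$$ Moreover, in the special case $V=B_H$ (standard fractional Brownian motion with Hurst parameter $H\in(0,1)$), for all $C<0$, $$\lim_{T\to\infty}\frac{-\ln p_{B_H}(T,C)}{\gamma_{B_H}(T)}=A_{B_H}.$$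
   Context: For a centered Gaussian process $V(t)$, $t\in\mathbb R$, with stationary increments, write $\sigma_V^2(t)=\operatorname{Var}(V(t))$, and define the variogram $\gamma_V(h)=\frac12\mathbb E\{(V(h)-V(0))^2\}$, the expected infimum functional $$\mathcal G_V(T)=\mathbb E\Big\{\inf_{t\in[0,T]}e^{\sqrt2V(t)-\sigma_V^2(t)}\Big\},\qquad T>0,$$ and the persistence probability $$p_V(T,C)=\mathbb P\Big\{\inf_{t\in[0,T]}(\sqrt2V(t)-\sigma_V^2(t))>C\Big\}.$$ $B_H$ denotes standard fractional Brownian motion: the centered continuous Gaussian process with stationary increments, $B_H(0)=0$ and $\operatorname{Var}(B_H(t))=|t|^{2H}$ (so $\gamma_{B_H}(t)=|t|^{2H}/2$). A function $f$ that is positive for all large arguments is regularly varying at infinity with index $\rho$ if $f(\lambda t)/f(t)\to\lambda^\rho$ as $t\to\infty$ for every $\lambda>0$. $\Gamma$ is Euler's gamma function. *)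

theory Defs
  imports "HOL-Probability.Probability"
begin

text \<open>Constants count as (degenerate) Gaussian random variables.\<close>

definition gaussian_rv :: "'a measure \<Rightarrow> ('a \<Rightarrow> real) \<Rightarrow> bool" where
  "gaussian_rv M X \<longleftrightarrow> X \<in> borel_measurable M \<and>
     ((\<exists>\<mu>. AE \<omega> in M. X \<omega> = \<mu>) \<or>
      (\<exists>\<mu> \<sigma>. 0 < \<sigma> \<and> distributed M lborel X (normal_density \<mu> \<sigma>)))"

text \<open>Joint Gaussianity of the finite-dimensional distributions: every finite linear
  combination of the values of the process is a Gaussian random variable.\<close>

definition gaussian_process :: "'a measure \<Rightarrow> (real \<Rightarrow> 'a \<Rightarrow> real) \<Rightarrow> bool" where
  "gaussian_process M V \<longleftrightarrow> prob_space M \<and>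
     (\<forall>J c. finite J \<longrightarrow> gaussian_rv M (\<lambda>\<omega>. \<Sum>t\<in>J. c t * V t \<omega>))"

definition centered_process :: "'a measure \<Rightarrow> (real \<Rightarrow> 'a \<Rightarrow> real) \<Rightarrow> bool" where
  "centered_process M V \<longleftrightarrow> (\<forall>t. prob_space.expectation M (V t) = 0)"

text \<open>Equality of laws on the product sigma-algebra, i.e. of all finite-dimensional
  distributions.\<close>

definition stationary_increments :: "'a measure \<Rightarrow> (real \<Rightarrow> 'a \<Rightarrow> real) \<Rightarrow> bool" where
  "stationary_increments M V \<longleftrightarrow>
     (\<forall>h. distr M (Pi\<^sub>M UNIV (\<lambda>_. borel)) (\<lambda>\<omega> t. V (t + h) \<omega> - V h \<omega>)
        = distr M (Pi\<^sub>M UNIV (\<lambda>_. borel)) (\<lambda>\<omega> t. V t \<omega> - V 0 \<omega>))"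

definition continuous_paths :: "'a measure \<Rightarrow> (real \<Rightarrow> 'a \<Rightarrow> real) \<Rightarrow> bool" where
  "continuous_paths M V \<longleftrightarrow> (\<forall>\<omega>\<in>space M. continuous_on UNIV (\<lambda>t. V t \<omega>))"

definition var_fun :: "'a measure \<Rightarrow> (real \<Rightarrow> 'a \<Rightarrow> real) \<Rightarrow> real \<Rightarrow> real" where
  "var_fun M V t = prob_space.variance M (V t)"

definition std_fun :: "'a measure \<Rightarrow> (real \<Rightarrow> 'a \<Rightarrow> real) \<Rightarrow> real \<Rightarrow> real" where
  "std_fun M V t = sqrt (var_fun M V t)"

definition variogram :: "'a measure \<Rightarrow> (real \<Rightarrow> 'a \<Rightarrow> real) \<Rightarrow> real \<Rightarrow> real" where
  "variogram M V h = (1/2) * prob_space.expectation M (\<lambda>\<omega>. (V h \<omega> - V 0 \<omega>)\<^sup>2)"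

definition expected_infimum :: "'a measure \<Rightarrow> (real \<Rightarrow> 'a \<Rightarrow> real) \<Rightarrow> real \<Rightarrow> real" where
  "expected_infimum M V T =
     prob_space.expectation M (\<lambda>\<omega>. INF t\<in>{0..T}. exp (sqrt 2 * V t \<omega> - var_fun M V t))"

definition persistence_prob ::
    "'a measure \<Rightarrow> (real \<Rightarrow> 'a \<Rightarrow> real) \<Rightarrow> real \<Rightarrow> real \<Rightarrow> real" where
  "persistence_prob M V T C =
     measure M {\<omega>\<in>space M. (INF t\<in>{0..T}. sqrt 2 * V t \<omega> - var_fun M V t) > C}"

definition regularly_varying :: "(real \<Rightarrow> real) \<Rightarrow> real \<Rightarrow> bool" where
  "regularly_varying f \<rho> \<longleftrightarrow> (\<forall>\<^sub>F t in at_top. 0 < f t) \<and>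
     (\<forall>l>0. ((\<lambda>t. f (l * t) / f t) \<longlongrightarrow> l powr \<rho>) at_top)"

definition standard_fbm :: "'a measure \<Rightarrow> real \<Rightarrow> (real \<Rightarrow> 'a \<Rightarrow> real) \<Rightarrow> bool" where
  "standard_fbm M H B \<longleftrightarrow>
     gaussian_process M B \<and> centered_process M B \<and> stationary_increments M B \<and>
     continuous_paths M B \<and> (AE \<omega> in M. B 0 \<omega> = 0) \<and>
     (\<forall>t. var_fun M B t = \<bar>t\<bar> powr (2 * H))"

definition A_fbm :: "real \<Rightarrow> real" where
  "A_fbm H = (if H < 1/2 then Gamma (H + 1/2) * Gamma (1 - 2 * H) / Gamma (1/2 - H) else 1/2)"

end

theory Submission
  imports Defs "HOL-Real_Asymp.Real_Asymp"
begin

text \<open>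
  Write \<open>\<alpha> = 2H\<close>. The constant \<open>A\<close> is the largest value of the energy
  \<open>\<integral>\<integral> |s - u| powr \<alpha> d\<nu> d\<nu>\<close> over probability measures \<open>\<nu>\<close> on \<open>[0,1]\<close>: for
  \<open>H \<ge> 1/2\<close> it is attained by two half atoms at the end points, for \<open>H < 1/2\<close> by the
  density proportional to \<open>(u(1 - u)) powr (-H - 1/2)\<close>, whose potential
  \<open>\<integral>|s - u| powr \<alpha> d\<nu>(u)\<close> is constant on \<open>[0,1]\<close>. Only finitely supported approximations
  of these measures enter the probabilistic part.

  Upper bounds: the infimum is at most the geometric mean with weights \<open>\<nu>\<close> (rescaled to
  \<open>[0,T]\<close>), and the expectation of that log-normal variable is
  \<open>exp (- 1/2 \<integral>\<integral> \<sigma>\<^sup>2(T(s - u)) d\<nu> d\<nu>)\<close>.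

  Lower bounds: the same \<open>\<nu>\<close> gives a Cameron--Martin shift that lifts \<open>\<surd>2 V\<close> above \<open>\<sigma>\<^sup>2\<close>, up
  to a small multiple of \<open>\<sigma>\<^sup>2(T)\<close>, at cost \<open>exp (- A \<sigma>\<^sup>2(T) / 2)\<close>; what remains is that the unshifted
  path is \<open>o(\<sigma>\<^sup>2(T))\<close> with probability at least \<open>1/2\<close>, which follows from Fernique's tail bound on unit intervals
  and regular variation. For the persistence probability of fractional Brownian motion the shift
  must in addition dominate \<open>\<sigma>\<^sup>2\<close> near the origin. This costs one more, fixed, multiple of
  \<open>V(t\<^sub>0)\<close>, because the discrete measures can be chosen with potential at most
  \<open>\<epsilon> s powr \<alpha>\<close> above its value at \<open>0\<close>.
\<close>

section \<open>The equilibrium measure\<close>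

text \<open>The two bounds meet because of one identity. Let \<xi> be the average of
  \<open>V\<close> over the rescaled \<nu>, let q be the \<nu>-average of the variance function
  \<open>s2\<close>, and let I be its energy. Then 2 cov(\<xi>, V t) - s2 t equals q minus the
  potential at t. Shifting by \<open>sqrt 2 * \<xi>\<close> therefore clears the barrier as soon as
  the potential stays below its value q at 0. The cost exponent is (2q - I)/2, which agrees with the
  exponent I/2 of the upper bound once q = I. A constant potential gives both properties; for H
  \<ge> 1/2 an inequality for the potential is enough. Atoms keep \<xi> a finite linear combination
  of values of the process, so every Gaussian fact needed concerns finite sums and follows from
  characteristic functions. The expectation tolerates errors of size \<epsilon> * s2 T at every time
  t \<le> T, which is what uniform regular variation supplies. A fixed level C does not: there the
  error must be proportional to s2 t itself, and the exact self-similarity of fractional Brownian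
  motion provides this.\<close>

text \<open>The substitution \<open>v = (u - s) / (u (1 - s))\<close> reduces the integral to a Beta integral. The result
  is symmetric in \<open>s\<close> and \<open>1 - s\<close>, so the two halves of the derivative of the potential cancel.\<close>

lemma nn_integral_equilibrium_right:
  fixes \<alpha> b s :: real
  assumes "0 < \<alpha>" "\<alpha> < 1" and b: "b = (1 + \<alpha>) / 2" and s: "0 < s" "s < 1"
  shows "(\<integral>\<^sup>+u. ennreal ((u - s) powr (\<alpha> - 1) * (u * (1 - u)) powr (- b)) * indicator {s..1} u \<partial>lborel)
       = ennreal ((s * (1 - s)) powr (b - 1) * Beta \<alpha> (1 - b))"
proof -
  define g where "g u = (u - s) / (u * (1 - s))" for u :: real
  define g' where "g' u = s / (u\<^sup>2 * (1 - s))" for u :: real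
  define f where "f v = v powr (\<alpha> - 1) * (1 - v) powr (1 - b - 1)" for v :: real
  define c where "c = (s * (1 - s)) powr (b - 1)"
  have [measurable]: "f \<in> borel_measurable borel"
    unfolding f_def by measurable
  have [measurable]: "g \<in> borel_measurable borel" "g' \<in> borel_measurable borel"
    unfolding g_def[abs_def] g'_def[abs_def] by measurable
  have subst: "(\<integral>\<^sup>+v. f v * indicator {g s..g 1} v \<partial>lborel)
      = (\<integral>\<^sup>+u. f (g u) * g' u * indicator {s..1} u \<partial>lborel)"
  proof (rule nn_integral_substitution)
    show "set_borel_measurable borel {g s..g 1} f" 
      unfolding set_borel_measurable_def by measurable
    show "(g has_real_derivative g' x) (at x)" if "x \<in> {s..1}" for x
    proof -
      have "x > 0" using that s by auto
      then show ?thesis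
        unfolding g_def g'_def using s
        by (auto intro!: derivative_eq_intros simp: power2_eq_square divide_simps) (simp add: algebra_simps)
    qed
    show "continuous_on {s..1} g'"
      unfolding g'_def using s by (intro continuous_intros) auto
    show "0 \<le> g' x" if "x \<in> {s..1}" for x
      unfolding g'_def using s by auto
    show "s \<le> 1" using s by simp
  qed
  have "c * (f (g u) * g' u) = (u - s) powr (\<alpha> - 1) * (u * (1 - u)) powr (- b)"
    if u: "s < u" "u < 1" for u
  proof -
    have pos: "0 < u" "0 < 1 - s" "0 < u - s" "0 < 1 - u" "0 < s" using u s by auto
    have 1: "1 - g u = s * (1 - u) / (u * (1 - s))"
      using pos by (simp add: g_def field_simps)
    have 2: "ln (g u) = ln (u - s) - ln u - ln (1 - s)" 
      unfolding g_def using pos by (simp add: ln_div ln_mult)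
    have 3: "ln (1 - g u) = ln s + ln (1 - u) - ln u - ln (1 - s)" 
      unfolding 1 using pos by (simp add: ln_div ln_mult)
    have 4: "ln (g' u) = ln s - 2 * ln u - ln (1 - s)" 
      unfolding g'_def using pos by (simp add: ln_div ln_mult ln_realpow)
    have p: "0 < g u" "0 < 1 - g u" "0 < g' u" 
      unfolding 1 using pos by (auto simp: g_def g'_def)
    have "c * (f (g u) * g' u) = exp ((b - 1) * ln (s * (1 - s)) + (\<alpha> - 1) * ln (g u) - b * ln (1 - g u) + ln (g' u))"
      using p pos by (simp add: c_def f_def powr_def exp_add exp_diff exp_minus field_simps)
    also have "\<dots> = exp ((\<alpha> - 1) * ln (u - s) - b * (ln u + ln (1 - u)))"
    proof -
      have 5: "ln (s * (1 - s)) = ln s + ln (1 - s)" using pos by (simp add: ln_mult)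
      \<comment> \<open>The choice of \<open>b\<close> enters here:
        \<open>2 * b = 1 + \<alpha>\<close> cancels all powers of \<open>1 - s\<close> and leaves
        exactly the exponent \<open>- b\<close> on \<open>u\<close>.\<close>
      have "b * x + b * x = x + \<alpha> * x" for x
        unfolding b by (simp add: field_simps)
      from this[of "ln u"] this[of "ln (1 - s)"] show ?thesis
        unfolding 2 3 4 5 by (intro arg_cong[where f = exp]) (simp add: algebra_simps)
    qed
    also have "\<dots> = (u - s) powr (\<alpha> - 1) * (u * (1 - u)) powr (- b)"
    proof -
      have 6: "ln (u * (1 - u)) = ln u + ln (1 - u)" using pos by (simp add: ln_mult)
      show ?thesis using pos unfolding powr_def 6
        by (simp add: mult_exp_exp algebra_simps)
    qed
    finally show ?thesis .
  qed
  then have eq: "c * (f (g u) * g' u) = (u - s) powr (\<alpha> - 1) * (u * (1 - u)) powr (- b)"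
    if "s \<le> u" "u \<le> 1" "u \<noteq> s" "u \<noteq> 1" for u
    using that by simp
  have AE: "AE u in lborel. u \<noteq> s \<and> u \<noteq> 1"
    by (intro AE_conjI AE_lborel_singleton)
  have "AE u in lborel. ennreal ((u - s) powr (\<alpha> - 1) * (u * (1 - u)) powr (- b)) * indicator {s..1} u
     = ennreal c * (ennreal (f (g u) * g' u) * indicator {s..1} u)"
  proof (use AE in eventually_elim)
    case (elim u)
    have "0 \<le> c" by (simp add: c_def)
    then show ?case
      using eq[of u] elim by (auto simp: indicator_def simp flip: ennreal_mult')
  qed
  then have "(\<integral>\<^sup>+u. ennreal ((u - s) powr (\<alpha> - 1) * (u * (1 - u)) powr (- b)) * indicator {s..1} u \<partial>lborel)
     = (\<integral>\<^sup>+u. ennreal c * (ennreal (f (g u) * g' u) * indicator {s..1} u) \<partial>lborel)"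
    by (intro nn_integral_cong_AE) auto
  also have "\<dots> = ennreal c * (\<integral>\<^sup>+v. f v * indicator {g s..g 1} v \<partial>lborel)"
    unfolding subst by (subst nn_integral_cmult) (auto simp: ennreal_mult'' ennreal_indicator)
  also have "{g s..g 1} = {0..1}" using s by (auto simp: g_def)
  also have "(\<integral>\<^sup>+v. f v * indicator {0..1} v \<partial>lborel) = ennreal (Beta \<alpha> (1 - b))"
  proof -
    have "0 < 1 - b" using assms by (simp add: b)
    then show ?thesis unfolding f_def ennreal_indicator[symmetric]
      using nn_integral_has_integral_lebesgue'[OF _ has_integral_Beta_real[of \<alpha> "1 - b"]] assms(1)
      by (simp add: ennreal_mult'' ennreal_indicator)
  qed
  finally show ?thesis by (simp add: c_def ennreal_mult')
qed

text \<open>The reflection of \<open>u\<close> to \<open>1 - u\<close> exchanges \<open>s\<close>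
  and \<open>1 - s\<close> and keeps the weight.\<close>

lemma nn_integral_equilibrium_left:
  fixes \<alpha> b s :: real
  assumes "0 < \<alpha>" "\<alpha> < 1" and b: "b = (1 + \<alpha>) / 2" and s: "0 < s" "s < 1"
  shows "(\<integral>\<^sup>+u. ennreal ((s - u) powr (\<alpha> - 1) * (u * (1 - u)) powr (- b)) * indicator {0..s} u \<partial>lborel)
       = ennreal ((s * (1 - s)) powr (b - 1) * Beta \<alpha> (1 - b))"
proof -
  have "(\<integral>\<^sup>+u. ennreal ((s - u) powr (\<alpha> - 1) * (u * (1 - u)) powr (- b)) * indicator {0..s} u \<partial>lborel)
     = (\<integral>\<^sup>+u. ennreal ((u - (1 - s)) powr (\<alpha> - 1) * (u * (1 - u)) powr (- b)) * indicator {1 - s..1} u \<partial>lborel)"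
    by (subst nn_integral_real_affine[where c = "-1" and t = 1])
       (auto intro!: nn_integral_cong simp: indicator_def algebra_simps)
  then show ?thesis
    using nn_integral_equilibrium_right[OF assms(1,2) b, of "1 - s"] s by (simp add: mult.commute)
qed

text \<open>For \<alpha> < 1 the integrand is singular at \<open>x = u\<close>, which may be the end
  point \<open>r\<close>. The primitive is still continuous there, so the version of the fundamental
  theorem that differentiates only in the interior applies.\<close>

lemma has_integral_powr_diff_right:
  fixes \<alpha> :: real
  assumes "0 < \<alpha>" "l \<le> r" "r \<le> u"
  shows "((\<lambda>x. \<alpha> * (u - x) powr (\<alpha> - 1)) has_integral ((u - l) powr \<alpha> - (u - r) powr \<alpha>)) {l..r}"
proof -
  have "((\<lambda>x. \<alpha> * (u - x) powr (\<alpha> - 1)) has_integral (- ((u - r) powr \<alpha>) - (- ((u - l) powr \<alpha>)))) {l..r}"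
  proof (rule fundamental_theorem_of_calculus_interior)
    show "continuous_on {l..r} (\<lambda>x. - ((u - x) powr \<alpha>))"
      using assms by (intro continuous_intros continuous_on_powr') auto
    show "((\<lambda>x. - ((u - x) powr \<alpha>)) has_vector_derivative \<alpha> * (u - x) powr (\<alpha> - 1)) (at x)"
      if "x \<in> {l<..<r}" for x
      unfolding has_real_derivative_iff_has_vector_derivative[symmetric]
      using that assms by (auto intro!: derivative_eq_intros simp: powr_diff divide_simps)
  qed fact
  then show ?thesis by simp
qed

lemma has_integral_powr_diff_left:
  fixes \<alpha> :: real
  assumes "0 < \<alpha>" "u \<le> l" "l \<le> r"
  shows "((\<lambda>x. \<alpha> * (x - u) powr (\<alpha> - 1)) has_integral ((r - u) powr \<alpha> - (l - u) powr \<alpha>)) {l..r}"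
proof (rule fundamental_theorem_of_calculus_interior)
  show "continuous_on {l..r} (\<lambda>x. (x - u) powr \<alpha>)"
    using assms by (intro continuous_intros continuous_on_powr') auto
  show "((\<lambda>x. (x - u) powr \<alpha>) has_vector_derivative \<alpha> * (x - u) powr (\<alpha> - 1)) (at x)"
    if "x \<in> {l<..<r}" for x
    unfolding has_real_derivative_iff_has_vector_derivative[symmetric]
    using that assms by (auto intro!: derivative_eq_intros simp: powr_diff divide_simps)
qed fact

text \<open>The fundamental theorem of calculus for \<open>|s - u| powr \<alpha>\<close>, arranged without subtraction so that
  Tonelli applies to both sides.\<close>

lemma abs_diff_powr_balance:
  fixes \<alpha> :: real
  assumes "0 < \<alpha>" "0 \<le> s" "0 \<le> u" 
  shows "ennreal (\<bar>s - u\<bar> powr \<alpha>) + (\<integral>\<^sup>+r. ennreal (\<alpha> * (u - r) powr (\<alpha> - 1)) * indicator {0..u} r * indicator {0..s} r \<partial>lborel)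
       = ennreal (u powr \<alpha>) + (\<integral>\<^sup>+r. ennreal (\<alpha> * (r - u) powr (\<alpha> - 1)) * indicator {u..} r * indicator {0..s} r \<partial>lborel)"
    (is "_ + ?L = _ + ?R")
proof -
  have "?L = (\<integral>\<^sup>+r. ennreal (\<alpha> * (u - r) powr (\<alpha> - 1)) * indicator {0..min s u} r \<partial>lborel)"
    by (intro nn_integral_cong) (auto simp: indicator_def)
  also have "\<dots> = ennreal (u powr \<alpha> - (u - min s u) powr \<alpha>)"
    using nn_integral_has_integral_lebesgue'[OF _ has_integral_powr_diff_right[of \<alpha> 0 "min s u" u]] assms
    by simp
  finally have L: "?L = ennreal (u powr \<alpha> - (u - min s u) powr \<alpha>)" .
  have "?R = (\<integral>\<^sup>+r. ennreal (\<alpha> * (r - u) powr (\<alpha> - 1)) * indicator {u..max s u} r \<partial>lborel)"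
    \<comment> \<open>For \<open>s < u\<close> the interval \<open>{u..max s u}\<close> degenerates
      to the point \<open>u\<close>, whereas the original domain is empty; the two differ by a null
      set.\<close>
    using AE_lborel_singleton[of u] assms by (intro nn_integral_cong_AE) (auto simp: indicator_def)
  also have "\<dots> = ennreal ((max s u - u) powr \<alpha>)"
    using nn_integral_has_integral_lebesgue'[OF _ has_integral_powr_diff_left[of \<alpha> u u "max s u"]] assms
    by simp
  finally have R: "?R = ennreal ((max s u - u) powr \<alpha>)" .
  have "(u - min s u) powr \<alpha> \<le> u powr \<alpha>" using assms by (intro powr_mono2) auto
  then show ?thesis unfolding L R using assms
    by (auto simp: min_def max_def simp flip: ennreal_plus)
qed

text \<open>Integrating the balance identity against the weight and exchanging the order of
  integration turns both correction terms into the same integral of \<open>B\<close>. Hence the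
  potential at \<open>s\<close> equals the potential at 0, which is a Beta integral.\<close>

lemma nn_integral_equilibrium_potential:
  fixes \<alpha> b s :: real
  assumes \<alpha>: "0 < \<alpha>" "\<alpha> < 1" and b: "b = (1 + \<alpha>) / 2" and s: "0 \<le> s" "s \<le> 1"
  shows "(\<integral>\<^sup>+u. ennreal (\<bar>s - u\<bar> powr \<alpha> * (u * (1 - u)) powr (- b)) * indicator {0..1} u \<partial>lborel)
       = ennreal (Beta (1 + \<alpha> - b) (1 - b))"
proof -
  define w where "w u = ennreal ((u * (1 - u)) powr (- b)) * indicator {0..1} u" for u :: real
  have [measurable]: "w \<in> borel_measurable borel" unfolding w_def[abs_def] by measurable
  define L where "L u r = ennreal (\<alpha> * (u - r) powr (\<alpha> - 1)) * indicator {0..u} r * indicator {0..s} r" for u r :: real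
  define R where "R u r = ennreal (\<alpha> * (r - u) powr (\<alpha> - 1)) * indicator {u..} r * indicator {0..s} r" for u r :: real
  have [measurable]: "case_prod L \<in> borel_measurable (borel \<Otimes>\<^sub>M borel)"
     "case_prod R \<in> borel_measurable (borel \<Otimes>\<^sub>M borel)"
    unfolding L_def R_def atLeast_def indicator_def atLeastAtMost_def atMost_def by measurable
  have [measurable]: "L u \<in> borel_measurable borel" "R u \<in> borel_measurable borel" for u
    unfolding L_def R_def by measurable
  \<comment> \<open>The common value of the two inner integrals at height \<open>r\<close>; up to
    the factor \<alpha> it is the value computed for both halves of the weight.\<close>
  define B where "B r = ennreal (\<alpha> * ((r * (1 - r)) powr (b - 1) * Beta \<alpha> (1 - b))) * indicator {0..s} r" for r :: real
  have bal: "ennreal (\<bar>s - u\<bar> powr \<alpha>) * w u + (\<integral>\<^sup>+r. w u * L u r \<partial>lborel)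
           = ennreal (u powr \<alpha>) * w u + (\<integral>\<^sup>+r. w u * R u r \<partial>lborel)" for u
  proof (cases "u \<in> {0..1}")
    case True
    then show ?thesis
      using arg_cong[OF abs_diff_powr_balance[of \<alpha> s u, folded L_def R_def], of "\<lambda>x. x * w u"] \<alpha> s
      by (simp add: nn_integral_cmult ring_distribs mult.commute)
  qed (auto simp: w_def)
  have AE: "AE r in lborel. r \<noteq> 0 \<and> r \<noteq> (1::real)" by (intro AE_conjI AE_lborel_singleton)
  have intL: "(\<integral>\<^sup>+u. \<integral>\<^sup>+r. w u * L u r \<partial>lborel \<partial>lborel) = (\<integral>\<^sup>+r. B r \<partial>lborel)"
  proof -
    have "(\<integral>\<^sup>+u. \<integral>\<^sup>+r. w u * L u r \<partial>lborel \<partial>lborel) = (\<integral>\<^sup>+r. \<integral>\<^sup>+u. w u * L u r \<partial>lborel \<partial>lborel)"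
      by (rule lborel_pair.Fubini') measurable
    also have "\<dots> = (\<integral>\<^sup>+r. B r \<partial>lborel)"
    proof (rule nn_integral_cong_AE, use AE in eventually_elim)
      fix r :: real assume r: "r \<noteq> 0 \<and> r \<noteq> 1"
      show "(\<integral>\<^sup>+u. w u * L u r \<partial>lborel) = B r"
      proof (cases "r \<in> {0..s}")
        case True
        then have "0 < r" "r < 1" using r s by auto
        have "(\<integral>\<^sup>+u. w u * L u r \<partial>lborel) = (\<integral>\<^sup>+u. ennreal \<alpha> * (ennreal ((u - r) powr (\<alpha> - 1) * (u * (1 - u)) powr (- b)) * indicator {r..1} u) \<partial>lborel)"
          using True \<open>0 < r\<close> \<alpha> by (intro nn_integral_cong) (auto simp: w_def L_def indicator_def ennreal_mult' mult_ac)
        also have "\<dots> = B r"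
          using True nn_integral_equilibrium_right[OF \<alpha> b \<open>0 < r\<close> \<open>r < 1\<close>] \<alpha>
          by (subst nn_integral_cmult) (auto simp: B_def ennreal_mult')
        finally show ?thesis .
      qed (auto simp: L_def B_def)
    qed
    finally show ?thesis .
  qed
  have intR: "(\<integral>\<^sup>+u. \<integral>\<^sup>+r. w u * R u r \<partial>lborel \<partial>lborel) = (\<integral>\<^sup>+r. B r \<partial>lborel)"
  proof -
    have "(\<integral>\<^sup>+u. \<integral>\<^sup>+r. w u * R u r \<partial>lborel \<partial>lborel) = (\<integral>\<^sup>+r. \<integral>\<^sup>+u. w u * R u r \<partial>lborel \<partial>lborel)"
      by (rule lborel_pair.Fubini') measurable
    also have "\<dots> = (\<integral>\<^sup>+r. B r \<partial>lborel)"
    proof (rule nn_integral_cong_AE, use AE in eventually_elim)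
      fix r :: real assume r: "r \<noteq> 0 \<and> r \<noteq> 1"
      show "(\<integral>\<^sup>+u. w u * R u r \<partial>lborel) = B r"
      proof (cases "r \<in> {0..s}")
        case True
        then have "0 < r" "r < 1" using r s by auto
        have "(\<integral>\<^sup>+u. w u * R u r \<partial>lborel) = (\<integral>\<^sup>+u. ennreal \<alpha> * (ennreal ((r - u) powr (\<alpha> - 1) * (u * (1 - u)) powr (- b)) * indicator {0..r} u) \<partial>lborel)"
          using True \<open>r < 1\<close> \<alpha> by (intro nn_integral_cong) (auto simp: w_def R_def indicator_def ennreal_mult' mult_ac)
        also have "\<dots> = B r"
          using True nn_integral_equilibrium_left[OF \<alpha> b \<open>0 < r\<close> \<open>r < 1\<close>] \<alpha>
          by (subst nn_integral_cmult) (auto simp: B_def ennreal_mult')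
        finally show ?thesis .
      qed (auto simp: R_def B_def)
    qed
    finally show ?thesis .
  qed
  have zero: "(\<integral>\<^sup>+u. ennreal (u powr \<alpha>) * w u \<partial>lborel) = ennreal (Beta (1 + \<alpha> - b) (1 - b))"
  proof -
    have "(\<integral>\<^sup>+u. ennreal (u powr \<alpha>) * w u \<partial>lborel)
       = (\<integral>\<^sup>+u. ennreal (u powr (1 + \<alpha> - b - 1) * (1 - u) powr (1 - b - 1)) * indicator {0..1} u \<partial>lborel)"
      by (intro nn_integral_cong) 
        (auto simp: w_def indicator_def powr_mult powr_add[symmetric] simp flip: ennreal_mult' mult.assoc)
    also have "\<dots> = ennreal (Beta (1 + \<alpha> - b) (1 - b))"
    proof (rule nn_integral_has_integral_lebesgue'[OF _ has_integral_Beta_real])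
      show "0 < 1 + \<alpha> - b" "0 < 1 - b" using \<alpha> by (auto simp: b)
    qed auto
    finally show ?thesis .
  qed
  \<comment> \<open>Cancellation in \<open>ennreal\<close> requires the common term to be finite.
    Enlarging the range of integration to the unit interval bounds it by a multiple of
    \<open>Beta b b\<close>.\<close>
  have fin: "(\<integral>\<^sup>+r. B r \<partial>lborel) \<noteq> \<infinity>"
  proof -
    have "(\<integral>\<^sup>+r. B r \<partial>lborel) \<le> (\<integral>\<^sup>+r. ennreal (\<alpha> * Beta \<alpha> (1 - b)) * (ennreal (r powr (b - 1) * (1 - r) powr (b - 1)) * indicator {0..1} r) \<partial>lborel)"
      using s \<alpha> by (intro nn_integral_mono) (auto simp: B_def indicator_def powr_mult mult.assoc simp flip: ennreal_mult'' intro!: ennreal_leI mult_left_mono)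
    also have "\<dots> = ennreal (\<alpha> * Beta \<alpha> (1 - b)) * ennreal (Beta b b)"
    proof -
      have "0 < b" using \<alpha> by (simp add: b)
      then show ?thesis
        using nn_integral_has_integral_lebesgue'[OF _ has_integral_Beta_real[of b b]]
        by (subst nn_integral_cmult) (auto simp del: One_nat_def)
    qed
    also have "\<dots> < \<infinity>" by (simp add: ennreal_mult_less_top)
    finally show ?thesis by simp
  qed
  have "(\<integral>\<^sup>+u. ennreal (\<bar>s - u\<bar> powr \<alpha>) * w u \<partial>lborel) + (\<integral>\<^sup>+r. B r \<partial>lborel)
      = (\<integral>\<^sup>+u. ennreal (u powr \<alpha>) * w u \<partial>lborel) + (\<integral>\<^sup>+r. B r \<partial>lborel)"
  proof -
    have "(\<integral>\<^sup>+u. ennreal (\<bar>s - u\<bar> powr \<alpha>) * w u + (\<integral>\<^sup>+r. w u * L u r \<partial>lborel) \<partial>lborel)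
        = (\<integral>\<^sup>+u. ennreal (u powr \<alpha>) * w u + (\<integral>\<^sup>+r. w u * R u r \<partial>lborel) \<partial>lborel)"
      by (simp only: bal)
    then show ?thesis
      by (subst (asm) (1 2) nn_integral_add) (simp_all add: intL intR)
  qed
  then have "(\<integral>\<^sup>+u. ennreal (\<bar>s - u\<bar> powr \<alpha>) * w u \<partial>lborel) = ennreal (Beta (1 + \<alpha> - b) (1 - b))"
    using fin zero by (simp add: add.commute[of _ "\<integral>\<^sup>+r. B r \<partial>lborel"] ennreal_add_left_cancel)
  then show ?thesis by (simp add: w_def ennreal_mult' mult.assoc)
qed

text \<open>Origin of the Gamma quotient: the numerator is the potential at 0 of the unnormalised
  equilibrium density, the denominator its total mass. In the first Beta value the arguments add up
  to 1, in the second to \<open>1 - 2 * H\<close>.\<close>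

lemma A_fbm_eq_Beta:
  assumes "0 < H" "H < 1/2"
  shows "A_fbm H = Beta (H + 1/2) (1/2 - H) / Beta (1/2 - H) (1/2 - H)"
proof -
  have "Gamma (1/2 - H) > 0" using assms by (intro Gamma_real_pos) auto
  then show ?thesis
    using assms by (simp add: A_fbm_def Beta_def power2_eq_square)
qed

text \<open>The density has exponent \<open>- (H + 1/2)\<close> at both end points and is integrable
  there precisely because \<open>H < 1/2\<close>.\<close>

lemma obtain_equilibrium_measure:
  assumes H: "0 < H" "H < 1/2"
  obtains \<mu> :: "real measure" where "prob_space \<mu>" "sets \<mu> = sets borel" "AE u in \<mu>. 0 < u \<and> u < 1"
    "\<And>s. 0 \<le> s \<Longrightarrow> s \<le> 1 \<Longrightarrow> integrable \<mu> (\<lambda>u. \<bar>s - u\<bar> powr (2 * H))"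
    "\<And>s. 0 \<le> s \<Longrightarrow> s \<le> 1 \<Longrightarrow> (\<integral>u. \<bar>s - u\<bar> powr (2 * H) \<partial>\<mu>) = A_fbm H"
proof -
  define b where "b = H + 1/2"
  have b: "b = (1 + 2 * H) / 2" "0 < 1 - b" "1 - b = 1/2 - H" "1 + 2 * H - b = H + 1/2" 
    "- b = 1/2 - H - 1"
    using H by (auto simp: b_def field_simps)
  define c where "c = Beta (1/2 - H) (1/2 - H)"
  have c: "c > 0"
    unfolding c_def Beta_def using H by (intro divide_pos_pos mult_pos_pos Gamma_real_pos) auto
  define w where "w u = ennreal ((u * (1 - u)) powr (- b)) * indicator {0..1} u" for u :: real
  have [measurable]: "w \<in> borel_measurable borel" unfolding w_def[abs_def] by measurable
  define \<mu> where "\<mu> = density lborel (\<lambda>u. w u * ennreal (1 / c))"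
  have sets: "sets \<mu> = sets borel" by (simp add: \<mu>_def)
  have nn: "(\<integral>\<^sup>+u. ennreal (f u) \<partial>\<mu>) = (\<integral>\<^sup>+u. ennreal (f u * (u * (1 - u)) powr (- b)) * indicator {0..1} u \<partial>lborel) * ennreal (1 / c)"
    if [measurable]: "f \<in> borel_measurable borel" and "\<And>u. 0 \<le> f u" for f
    unfolding \<mu>_def using that
    by (subst nn_integral_density, simp, simp, subst nn_integral_multc[symmetric])
       (auto simp: w_def ennreal_mult' mult_ac intro!: nn_integral_cong)
  have "(\<integral>\<^sup>+u. ennreal 1 \<partial>\<mu>) = 1"
  proof -
    have "(\<integral>\<^sup>+u. ennreal (1 * (u * (1 - u)) powr (- b)) * indicator {0..1} u \<partial>lborel)
       = (\<integral>\<^sup>+u. ennreal (u powr (1/2 - H - 1) * (1 - u) powr (1/2 - H - 1)) * indicator {0..1} u \<partial>lborel)"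
      unfolding b(5) by (intro nn_integral_cong) (auto simp: indicator_def powr_mult)
    also have "\<dots> = ennreal c"
      unfolding c_def by (rule nn_integral_has_integral_lebesgue'[OF _ has_integral_Beta_real]) (use H in auto)
    finally show ?thesis
      using c by (subst nn) (auto simp flip: ennreal_mult')
  qed
  then have "emeasure \<mu> (space \<mu>) = 1" by simp
  then interpret prob_space \<mu> by (rule prob_spaceI)
  have AE: "AE u in \<mu>. 0 < u \<and> u < 1"
  proof -
    have "AE u in lborel. u \<noteq> 0 \<and> u \<noteq> (1::real)" by (intro AE_conjI AE_lborel_singleton)
    then have "AE u in lborel. 0 < w u * ennreal (1 / c) \<longrightarrow> 0 < u \<and> u < 1"
      by eventually_elim (auto simp: w_def indicator_def split: if_splits)
    then show ?thesis unfolding \<mu>_def by (subst AE_density) auto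
  qed
  have pot: "(\<integral>\<^sup>+u. ennreal (\<bar>s - u\<bar> powr (2 * H)) \<partial>\<mu>) = ennreal (A_fbm H)" if "0 \<le> s" "s \<le> 1" for s
  proof -
    have B: "0 \<le> Beta (H + 1/2) (1/2 - H)" unfolding Beta_def using H
      by (intro divide_nonneg_pos mult_nonneg_nonneg less_imp_le[OF Gamma_real_pos] Gamma_real_pos) auto
    show ?thesis
      using nn_integral_equilibrium_potential[OF _ _ b(1) that] H c B
      by (subst nn) (auto simp: A_fbm_eq_Beta[OF H] b(3,4) c_def[symmetric] simp flip: ennreal_mult'')
  qed
  have A: "0 \<le> A_fbm H" unfolding A_fbm_def using H
      by (auto intro!: divide_nonneg_pos mult_nonneg_nonneg less_imp_le[OF Gamma_real_pos] Gamma_real_pos)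
  have int: "integrable \<mu> (\<lambda>u. \<bar>s - u\<bar> powr (2 * H))" if "0 \<le> s" "s \<le> 1" for s
    using pot[OF that] sets by (intro integrableI_nonneg) (auto simp: measurable_cong_sets[OF sets refl])
  show ?thesis
  proof (rule that[OF _ sets AE int])
    show "prob_space \<mu>" by unfold_locales
    show "(\<integral>u. \<bar>s - u\<bar> powr (2 * H) \<partial>\<mu>) = A_fbm H" if "0 \<le> s" "s \<le> 1" for s
      using pot[OF that] A by (subst integral_eq_nn_integral) (auto simp: measurable_cong_sets[OF sets refl])
  qed
qed

text \<open>The constant potential is evaluated at the end points. At 0 the integrand
  \<open>u powr (2 * H)\<close> is below 1. Adding the values at 0 and 1 gives
  \<open>2 * A_fbm H\<close> as the integral of
  \<open>u powr (2 * H) + (1 - u) powr (2 * H)\<close>, which exceeds \<open>u + (1 - u) = 1\<close>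
  since \<open>2 * H < 1\<close>.\<close>

lemma A_fbm_bounds:
  assumes H: "0 < H" "H < 1/2"
  shows "1/2 < A_fbm H" "A_fbm H < 1"
proof -
  obtain \<mu> :: "real measure" where "prob_space \<mu>" and sets: "sets \<mu> = sets borel"
    and AE: "AE u in \<mu>. 0 < u \<and> u < 1"
    and int: "\<And>s. 0 \<le> s \<Longrightarrow> s \<le> 1 \<Longrightarrow> integrable \<mu> (\<lambda>u. \<bar>s - u\<bar> powr (2 * H))"
    and pot: "\<And>s. 0 \<le> s \<Longrightarrow> s \<le> 1 \<Longrightarrow> (\<integral>u. \<bar>s - u\<bar> powr (2 * H) \<partial>\<mu>) = A_fbm H"
    using obtain_equilibrium_measure[OF H] by blast
  interpret prob_space \<mu> by fact
  have "(\<integral>u. \<bar>0 - u\<bar> powr (2 * H) \<partial>\<mu>) < (\<integral>u. 1 \<partial>\<mu>)"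
  proof (rule integral_less_AE_space)
    show "AE u in \<mu>. \<bar>0 - u\<bar> powr (2 * H) < 1"
      using AE by eventually_elim (use H powr_less_mono2[of "2 * H" _ 1] in auto)
    show "integrable \<mu> (\<lambda>u. \<bar>0 - u\<bar> powr (2 * H))" by (rule int) auto
  qed (use emeasure_space_1 in auto)
  then show "A_fbm H < 1" using pot[of 0] by (simp add: prob_space)
  have "(\<integral>u. 1 \<partial>\<mu>) < (\<integral>u. \<bar>0 - u\<bar> powr (2 * H) + \<bar>1 - u\<bar> powr (2 * H) \<partial>\<mu>)"
  proof (rule integral_less_AE_space)
    show "AE u in \<mu>. 1 < \<bar>0 - u\<bar> powr (2 * H) + \<bar>1 - u\<bar> powr (2 * H)"
    proof (use AE in eventually_elim)
      fix u :: real assume u: "0 < u \<and> u < 1"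
      have "u powr 1 < u powr (2 * H)"
        by (rule powr_less_mono') (use u H in auto)
      moreover have "(1 - u) powr 1 < (1 - u) powr (2 * H)"
        by (rule powr_less_mono') (use u H in auto)
      ultimately show "1 < \<bar>0 - u\<bar> powr (2 * H) + \<bar>1 - u\<bar> powr (2 * H)" using u by simp
    qed
    show "integrable \<mu> (\<lambda>u. \<bar>0 - u\<bar> powr (2 * H) + \<bar>1 - u\<bar> powr (2 * H))"
      by (intro Bochner_Integration.integrable_add int) auto
  qed (use emeasure_space_1 in auto)
  also have "\<dots> = A_fbm H + A_fbm H"
    using pot[of 0] pot[of 1] int[of 0] int[of 1] by (subst Bochner_Integration.integral_add) auto
  finally show "1/2 < A_fbm H" by (simp add: prob_space)
qed

section \<open>Finitely supported approximations of the equilibrium measure\<close>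

lemma abs_powr_diff_le:
  fixes a b :: real
  assumes "0 \<le> \<alpha>" "\<alpha> \<le> 1"
  shows "\<bar>\<bar>a\<bar> powr \<alpha> - \<bar>b\<bar> powr \<alpha>\<bar> \<le> \<bar>a - b\<bar> powr \<alpha>"
proof -
  have *: "x powr \<alpha> \<le> y powr \<alpha> + z powr \<alpha>" if "0 \<le> x" "0 \<le> y" "0 \<le> z" "x \<le> y + z" for x y z :: real
  proof -
    define t where "t = y + z"
    have "x powr \<alpha> \<le> t powr \<alpha>" using that assms unfolding t_def by (intro powr_mono2) auto
    also have "t powr \<alpha> \<le> y powr \<alpha> + z powr \<alpha>"
    proof (cases "t = 0")
      case False
      then have t: "t > 0" using that by (auto simp: t_def)
      \<comment> \<open>A fraction in the unit interval is at most its \<alpha>-th power. Applied to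
        \<open>y / t\<close> and \<open>z / t\<close>, which add up to 1, this yields subadditivity
        of the power function.\<close>
      have le: "t powr \<alpha> * (v / t) \<le> v powr \<alpha>" if "0 \<le> v" "v \<le> t" for v
      proof -
        have "(v / t) powr 1 \<le> (v / t) powr \<alpha>" using that t assms by (intro powr_mono') auto
        then have "t powr \<alpha> * (v / t) \<le> t powr \<alpha> * (v / t) powr \<alpha>"
          using that t by (intro mult_left_mono) auto
        then show ?thesis using that t by (simp add: powr_divide)
      qed
      have "t powr \<alpha> = t powr \<alpha> * (y / t) + t powr \<alpha> * (z / t)"
        using t by (simp add: t_def flip: distrib_left add_divide_distrib)
      then show ?thesis using le[of y] le[of z] that by (simp add: t_def)
    qed simp
    finally show ?thesis .
  qed
  have "\<bar>a\<bar> \<le> \<bar>b\<bar> + \<bar>a - b\<bar>" "\<bar>b\<bar> \<le> \<bar>a\<bar> + \<bar>a - b\<bar>" by linarith+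
  then have "\<bar>a\<bar> powr \<alpha> \<le> \<bar>b\<bar> powr \<alpha> + \<bar>a - b\<bar> powr \<alpha>" "\<bar>b\<bar> powr \<alpha> \<le> \<bar>a\<bar> powr \<alpha> + \<bar>a - b\<bar> powr \<alpha>"
    by (intro *; simp)+
  then show ?thesis by linarith
qed

text \<open>Rounding \<mu> to a grid of mesh \<open>1 / n\<close> changes the potential by at most
  \<open>n powr (- \<alpha>)\<close>. The delicate part is an excess over the value at 0 that is
  small relative to \<open>s powr \<alpha>\<close>. For \<open>s\<close> below \<delta>, atoms to
  the right of \<open>s\<close> get closer and contribute no excess; the others come from the set
  \<open>u < 2 * \<delta>\<close> of mass at most \<epsilon>, and each contributes at most
  \<open>s powr \<alpha>\<close>. For \<open>s\<close> above \<delta> the uniform error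
  suffices.\<close>

lemma ex_discrete_equilibrium:
  assumes H: "0 < H" "H < 1" and \<epsilon>: "0 < \<epsilon>"
  obtains n :: nat and m x :: "nat \<Rightarrow> real" where
    "\<forall>j<n. 0 \<le> m j" "\<forall>j<n. 0 \<le> x j \<and> x j \<le> 1" "(\<Sum>j<n. m j) = 1"
    "\<forall>s\<in>{0..1}. (\<Sum>j<n. m j * \<bar>s - x j\<bar> powr (2 * H))
       \<le> (\<Sum>j<n. m j * x j powr (2 * H)) + \<epsilon> * s powr (2 * H)"
    "\<bar>(\<Sum>j<n. m j * x j powr (2 * H)) - A_fbm H\<bar> \<le> \<epsilon>"
    "A_fbm H - \<epsilon> \<le> (\<Sum>i<n. \<Sum>j<n. m i * m j * \<bar>x i - x j\<bar> powr (2 * H))"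
proof (cases "H < 1/2")
  case False
  define x m :: "nat \<Rightarrow> real" where "x j = (if j = 0 then 0 else 1)" and "m j = 1/2" for j
  \<comment> \<open>For \<open>2 * H \<ge> 1\<close> powers of numbers in the unit interval lie
    below the numbers themselves, so the potential of the two atoms is largest at the end
    points.\<close>
  have le: "s powr (2 * H) + (1 - s) powr (2 * H) \<le> 1" if "0 \<le> s" "s \<le> 1" for s
  proof -
    have "s powr (2 * H) \<le> s powr 1"
      by (rule powr_mono') (use False that in auto)
    moreover have "(1 - s) powr (2 * H) \<le> (1 - s) powr 1"
      by (rule powr_mono') (use False that in auto)
    ultimately show ?thesis using that by simp
  qed
  have \<phi>: "(\<Sum>j<2. m j * \<bar>s - x j\<bar> powr (2 * H)) \<le> (\<Sum>j<2. m j * x j powr (2 * H)) + \<epsilon> * s powr (2 * H)"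
    if "0 \<le> s" "s \<le> 1" for s
    proof -
      have "0 \<le> \<epsilon> * s powr (2 * H)" using \<epsilon> by simp
      then show ?thesis using le[OF that] that
        by (simp add: m_def x_def numeral_2_eq_2)
    qed
  show ?thesis
    by (rule that[of 2 m x]) (use False \<epsilon> \<phi> in \<open>auto simp: m_def x_def A_fbm_def numeral_2_eq_2\<close>)
next
  case True
  define \<alpha> where "\<alpha> = 2 * H"
  have \<alpha>: "0 < \<alpha>" "\<alpha> < 1" using H True by (auto simp: \<alpha>_def)
  obtain \<mu> :: "real measure" where "prob_space \<mu>" and sets: "sets \<mu> = sets borel"
    and AE: "AE u in \<mu>. 0 < u \<and> u < 1"
    and int: "\<And>s. 0 \<le> s \<Longrightarrow> s \<le> 1 \<Longrightarrow> integrable \<mu> (\<lambda>u. \<bar>s - u\<bar> powr \<alpha>)"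
    and pot: "\<And>s. 0 \<le> s \<Longrightarrow> s \<le> 1 \<Longrightarrow> (\<integral>u. \<bar>s - u\<bar> powr \<alpha> \<partial>\<mu>) = A_fbm H"
    using obtain_equilibrium_measure[OF H(1) True] unfolding \<alpha>_def by blast
  interpret prob_space \<mu> by fact
  note [measurable_cong] = sets
  have [simp]: "space \<mu> = UNIV" using sets_eq_imp_space_eq[OF sets] by simp
  have [simp]: "prob UNIV = 1" using prob_space by simp
  obtain \<delta> where \<delta>: "0 < \<delta>" "\<delta> \<le> 1" "measure \<mu> {u. u < 2 * \<delta>} \<le> \<epsilon>"
  proof -
    have "(\<lambda>k. measure \<mu> {u. u < 2 / real (Suc k)}) \<longlonglongrightarrow> measure \<mu> (\<Inter>k. {u. u < 2 / real (Suc k)})"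
    proof (rule finite_Lim_measure_decseq)
      show "decseq (\<lambda>k. {u. u < 2 / real (Suc k)})"
      proof (intro decseq_SucI subsetI)
        fix k u assume "u \<in> {u. u < 2 / real (Suc (Suc k))}"
        moreover have "2 / real (Suc (Suc k)) \<le> 2 / real (Suc k)" by (intro divide_left_mono) auto
        ultimately show "u \<in> {u. u < 2 / real (Suc k)}" by simp
      qed
    qed auto
    moreover have "measure \<mu> (\<Inter>k. {u. u < 2 / real (Suc k)}) = 0"
    proof -
      have "(\<Inter>k. {u. u < 2 / real (Suc k)}) \<subseteq> {u. u \<le> 0}"
      proof
        fix u :: real assume u: "u \<in> (\<Inter>k. {u. u < 2 / real (Suc k)})"
        have lim: "(\<lambda>k. 2 / real (Suc k)) \<longlonglongrightarrow> 0"
          using LIMSEQ_Suc[OF lim_const_over_n[of "2::real"]] by simp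
        have "u \<le> 0" by (rule LIMSEQ_le_const[OF lim]) (use u in \<open>auto intro: less_imp_le\<close>)
        then show "u \<in> {u. u \<le> 0}" by simp
      qed
      then have "measure \<mu> (\<Inter>k. {u. u < 2 / real (Suc k)}) \<le> measure \<mu> {u. u \<le> 0}"
        by (intro finite_measure_mono) auto
      also have "measure \<mu> {u. u \<le> 0} = 0"
        using AE by (subst prob_eq_0) (auto elim!: eventually_mono)
      finally show ?thesis by (simp add: antisym)
    qed
    ultimately have "eventually (\<lambda>k. measure \<mu> {u. u < 2 / real (Suc k)} < \<epsilon>) sequentially"
      using \<epsilon> by (auto dest: order_tendstoD(2))
    then obtain k where "measure \<mu> {u. u < 2 / real (Suc k)} < \<epsilon>"
      by (auto simp: eventually_sequentially)
    then show ?thesis by (intro that[of "1 / real (Suc k)"]) auto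
  qed
  \<comment> \<open>A mesh below \<delta> keeps points beyond \<open>2 * \<delta>\<close> to the
    right of \<open>s < \<delta>\<close> after rounding. The third condition bounds the uniform
    error. The fourth serves \<open>s \<ge> \<delta>\<close>; its factor 2 accounts for the errors
    at \<open>s\<close> and at 0.\<close>
  obtain n :: nat where n: "n > 0" "1 / real n \<le> \<delta>" "real n powr (- \<alpha>) \<le> \<epsilon>" "2 * real n powr (- \<alpha>) \<le> \<epsilon> * \<delta> powr \<alpha>"
  proof -
    have lim: "(\<lambda>n. real n powr (- \<alpha>)) \<longlonglongrightarrow> 0" 
      using \<alpha> by (intro tendsto_neg_powr filterlim_real_sequentially) auto
    have "eventually (\<lambda>n. 1 / real n < \<delta>) sequentially"
      using \<delta> lim_1_over_n by (auto dest: order_tendstoD(2))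
    moreover have "eventually (\<lambda>n. real n powr (- \<alpha>) < \<epsilon>) sequentially"
      using \<epsilon> lim by (auto dest: order_tendstoD(2))
    moreover have "eventually (\<lambda>n. real n powr (- \<alpha>) < \<epsilon> * \<delta> powr \<alpha> / 2) sequentially"
      using \<epsilon> \<delta> by (intro order_tendstoD(2)[OF lim]) auto
    ultimately have "eventually (\<lambda>n. n > 0 \<and> 1 / real n < \<delta> \<and> real n powr (- \<alpha>) < \<epsilon> \<and> real n powr (- \<alpha>) < \<epsilon> * \<delta> powr \<alpha> / 2) sequentially"
      using eventually_gt_at_top[of 0] by eventually_elim auto
    from eventually_happens'[OF sequentially_bot this] obtain n
      where "n > 0 \<and> 1 / real n < \<delta> \<and> real n powr (- \<alpha>) < \<epsilon> \<and> real n powr (- \<alpha>) < \<epsilon> * \<delta> powr \<alpha> / 2"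
      by blast
    then show ?thesis by (intro that[of n]) auto
  qed
  define d where "d u = real (nat \<lfloor>real n * u\<rfloor>) / real n" for u
  define x where "x j = real j / real n" for j
  define m where "m j = measure \<mu> {u. nat \<lfloor>real n * u\<rfloor> = j}" for j
  define \<phi> where "\<phi> s = (\<integral>u. \<bar>s - d u\<bar> powr \<alpha> \<partial>\<mu>)" for s
  have [measurable]: "d \<in> borel_measurable \<mu>" unfolding d_def by measurable
  have d: "0 \<le> d u" "d u \<le> 1" "\<bar>u - d u\<bar> \<le> 1 / real n" if "0 < u \<and> u < 1" for u
  proof -
    have fl: "real_of_int \<lfloor>real n * u\<rfloor> \<le> real n * u" "real n * u < real_of_int \<lfloor>real n * u\<rfloor> + 1" 
      by linarith+
    have d: "d u = real_of_int \<lfloor>real n * u\<rfloor> / real n"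
      using that n by (simp add: d_def)
    have "d u \<le> u" using fl(1) n by (simp add: d field_simps)
    moreover have "u \<le> (real_of_int \<lfloor>real n * u\<rfloor> + 1) / real n"
      using fl(2) n by (simp add: pos_le_divide_eq mult.commute)
    then have "u - d u \<le> 1 / real n" by (simp add: d add_divide_distrib)
    ultimately show "0 \<le> d u" "d u \<le> 1" "\<bar>u - d u\<bar> \<le> 1 / real n"
      using that by (auto simp: d_def)
  qed
  have AEd: "AE u in \<mu>. 0 \<le> d u \<and> d u \<le> 1"
    using AE by eventually_elim (use d in auto)
  \<comment> \<open>The weights \<open>m\<close> are the push-forward of \<mu> under the rounding
    map \<open>d\<close>, so finite sums over the grid are integrals with respect to \<mu>.\<close>
  have sum_d: "(\<Sum>j<n. m j * f (x j)) = (\<integral>u. f (d u) \<partial>\<mu>)" for f :: "real \<Rightarrow> real"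
  proof -
    have "(\<integral>u. f (d u) \<partial>\<mu>) = (\<integral>u. (\<Sum>j<n. indicator {u. nat \<lfloor>real n * u\<rfloor> = j} u * f (x j)) \<partial>\<mu>)"
    proof (rule integral_cong_AE)
      show "AE u in \<mu>. f (d u) = (\<Sum>j<n. indicator {u. nat \<lfloor>real n * u\<rfloor> = j} u * f (x j))"
      proof (use AE in eventually_elim)
        fix u :: real assume u: "0 < u \<and> u < 1"
        then have "real n * u < real n" using n by simp
        then have "nat \<lfloor>real n * u\<rfloor> < n" using n u by (simp add: nat_less_iff floor_less_iff)
        then show "f (d u) = (\<Sum>j<n. indicator {u. nat \<lfloor>real n * u\<rfloor> = j} u * f (x j))"
          by (simp add: indicator_def d_def x_def if_distrib sum.delta cong: if_cong)
      qed
      have "(\<lambda>u. (\<lambda>j. f (x j)) (nat \<lfloor>real n * u\<rfloor>)) \<in> borel_measurable \<mu>"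
        by measurable
      then show "(\<lambda>u. f (d u)) \<in> borel_measurable \<mu>" by (simp add: d_def x_def)
    qed auto
    also have "\<dots> = (\<Sum>j<n. m j * f (x j))"
      by (subst Bochner_Integration.integral_sum) (auto simp: m_def emeasure_eq_measure)
    finally show ?thesis by simp
  qed
  have intd: "integrable \<mu> (\<lambda>u. \<bar>s - d u\<bar> powr \<alpha>)" if "0 \<le> s" "s \<le> 1" for s
  proof (rule integrable_const_bound[where B = 1])
    show "AE u in \<mu>. norm (\<bar>s - d u\<bar> powr \<alpha>) \<le> 1"
      using AEd by eventually_elim (use that \<alpha> in \<open>auto intro!: powr_le1\<close>)
  qed auto
  have near: "\<bar>\<phi> s - A_fbm H\<bar> \<le> real n powr (- \<alpha>)" if s: "0 \<le> s" "s \<le> 1" for s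
  proof -
    have "\<bar>\<phi> s - A_fbm H\<bar> = \<bar>\<integral>u. \<bar>s - d u\<bar> powr \<alpha> - \<bar>s - u\<bar> powr \<alpha> \<partial>\<mu>\<bar>"
      using intd[OF s] int[OF s] pot[OF s] by (simp add: \<phi>_def)
    also have "\<dots> \<le> (\<integral>u. \<bar>\<bar>s - d u\<bar> powr \<alpha> - \<bar>s - u\<bar> powr \<alpha>\<bar> \<partial>\<mu>)"
      by (rule integral_abs_bound)
    also have "\<dots> \<le> (\<integral>u. real n powr (- \<alpha>) \<partial>\<mu>)"
    proof (rule integral_mono_AE)
      show "AE u in \<mu>. \<bar>\<bar>s - d u\<bar> powr \<alpha> - \<bar>s - u\<bar> powr \<alpha>\<bar> \<le> real n powr (- \<alpha>)"
      proof (use AE in eventually_elim)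
        fix u :: real assume u: "0 < u \<and> u < 1"
        have "\<bar>\<bar>s - d u\<bar> powr \<alpha> - \<bar>s - u\<bar> powr \<alpha>\<bar> \<le> \<bar>(s - d u) - (s - u)\<bar> powr \<alpha>"
          using \<alpha> by (intro abs_powr_diff_le) auto
        also have "\<dots> \<le> (1 / real n) powr \<alpha>" using d(3)[OF u] \<alpha> by (intro powr_mono2) auto
        also have "\<dots> = real n powr (- \<alpha>)" using n by (simp add: powr_divide powr_minus_divide)
        finally show "\<bar>\<bar>s - d u\<bar> powr \<alpha> - \<bar>s - u\<bar> powr \<alpha>\<bar> \<le> real n powr (- \<alpha>)" .
      qed
    qed (use intd[OF s] int[OF s] in auto)
    finally show ?thesis by (simp add: prob_space)
  qed
  have m1: "(\<Sum>j<n. m j) = 1" using sum_d[of "\<lambda>_. 1"] by (simp add: prob_space)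
  have x01: "0 \<le> x j \<and> x j \<le> 1" if "j < n" for j using that by (auto simp: x_def)
  have phi_sum: "(\<Sum>j<n. m j * \<bar>s - x j\<bar> powr \<alpha>) = \<phi> s" for s
    unfolding \<phi>_def by (rule sum_d)
  have phi0: "(\<Sum>j<n. m j * x j powr \<alpha>) = \<phi> 0"
    unfolding phi_sum[symmetric] using x01 by (intro sum.cong) auto
  show ?thesis
  proof (rule that[of n m x, folded \<alpha>_def])
    have "(\<Sum>j<n. m j * \<bar>s - x j\<bar> powr \<alpha>) \<le> (\<Sum>j<n. m j * x j powr \<alpha>) + \<epsilon> * s powr \<alpha>"
      if s: "0 \<le> s" "s \<le> 1" for s
    proof (cases "s < \<delta>")
      case True
      have "\<phi> s - \<phi> 0 = (\<integral>u. \<bar>s - d u\<bar> powr \<alpha> - \<bar>0 - d u\<bar> powr \<alpha> \<partial>\<mu>)"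
        using intd[OF s] intd[of 0] by (simp add: \<phi>_def)
      also have "\<dots> \<le> (\<integral>u. s powr \<alpha> * indicator {u. u < 2 * \<delta>} u \<partial>\<mu>)"
      proof (rule integral_mono_AE)
        show "AE u in \<mu>. \<bar>s - d u\<bar> powr \<alpha> - \<bar>0 - d u\<bar> powr \<alpha> \<le> s powr \<alpha> * indicator {u. u < 2 * \<delta>} u"
        proof (use AE in eventually_elim)
          fix u :: real assume u: "0 < u \<and> u < 1"
          show "\<bar>s - d u\<bar> powr \<alpha> - \<bar>0 - d u\<bar> powr \<alpha> \<le> s powr \<alpha> * indicator {u. u < 2 * \<delta>} u"
          proof (cases "u < 2 * \<delta>")
            case True
            then show ?thesis 
              using abs_powr_diff_le[of \<alpha> "s - d u" "0 - d u"] \<alpha> s by (simp add: abs_le_iff)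
          next
            case False
            then have "s \<le> d u" using d(3)[OF u] n(2) \<open>s < \<delta>\<close> by linarith
            then have "\<bar>s - d u\<bar> powr \<alpha> \<le> \<bar>0 - d u\<bar> powr \<alpha>"
              using s \<alpha> by (intro powr_mono2) auto
            with False show ?thesis by simp
          qed
        qed
      qed (use intd[OF s] intd[of 0] in \<open>auto simp: emeasure_eq_measure\<close>)
      also have "\<dots> = s powr \<alpha> * measure \<mu> {u. u < 2 * \<delta>}" by simp
      also have "\<dots> \<le> s powr \<alpha> * \<epsilon>" using \<delta> by (intro mult_left_mono) auto
      finally show ?thesis unfolding phi_sum phi0 by (simp add: mult.commute)
    next
      case False
      then have "\<epsilon> * \<delta> powr \<alpha> \<le> \<epsilon> * s powr \<alpha>" using \<epsilon> \<delta> \<alpha> by (intro mult_left_mono powr_mono2) auto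
      then show ?thesis unfolding phi_sum phi0
        using near[OF s] near[of 0] n(4) by (simp add: abs_le_iff)
    qed
    then show "\<forall>s\<in>{0..1}. (\<Sum>j<n. m j * \<bar>s - x j\<bar> powr \<alpha>) \<le> (\<Sum>j<n. m j * x j powr \<alpha>) + \<epsilon> * s powr \<alpha>"
      by simp
    show "\<bar>(\<Sum>j<n. m j * x j powr \<alpha>) - A_fbm H\<bar> \<le> \<epsilon>"
      unfolding phi0 using near[of 0] n(3) by simp
    have "(\<Sum>i<n. \<Sum>j<n. m i * m j * \<bar>x i - x j\<bar> powr \<alpha>) = (\<Sum>i<n. m i * \<phi> (x i))"
      unfolding phi_sum[symmetric] by (simp add: sum_distrib_left mult.assoc)
    also have "\<dots> \<ge> (\<Sum>i<n. m i * (A_fbm H - \<epsilon>))"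
      using near x01 n(3) by (intro sum_mono mult_left_mono) (fastforce simp: abs_le_iff m_def)+
    also have "(\<Sum>i<n. m i * (A_fbm H - \<epsilon>)) = A_fbm H - \<epsilon>"
      by (simp add: m1 flip: sum_distrib_right)
    finally show "A_fbm H - \<epsilon> \<le> (\<Sum>i<n. \<Sum>j<n. m i * m j * \<bar>x i - x j\<bar> powr \<alpha>)" .
  qed (use m1 x01 in \<open>auto simp: m_def\<close>)
qed

section \<open>Regular variation of subadditive functions\<close>

text \<open>Models the standard deviation of increments: as an L2 norm it is subadditive, and
  stationarity makes it even. With these properties uniform convergence holds on the whole interval
  from 0 to 1, including the origin.\<close>

locale regularly_varying_norm =
  fixes \<sigma> :: "real \<Rightarrow> real" and H :: real
  assumes H_pos: "0 < H" and H_less: "H < 1" and cont: "continuous_on UNIV \<sigma>" and nonneg: "0 \<le> \<sigma> t"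
    and even: "\<sigma> (- t) = \<sigma> t" and zero: "\<sigma> 0 = 0" and subadd: "\<sigma> (s + t) \<le> \<sigma> s + \<sigma> t"
    and rv: "regularly_varying \<sigma> H"
begin

lemma abs_diff_le: "\<bar>\<sigma> s - \<sigma> t\<bar> \<le> \<sigma> (s - t)"
  using subadd[of "s - t" t] subadd[of "t - s" s] even[of "s - t"] by simp

lemma eventually_ratio_le:
  assumes "0 < l" "l powr H < a"
  shows "\<forall>\<^sub>F T in at_top. \<sigma> (l * T) \<le> a * \<sigma> T"
proof -
  have "\<forall>\<^sub>F T in at_top. \<sigma> (l * T) / \<sigma> T < a"
    using rv assms by (intro order_tendstoD(2)[of _ "l powr H"]) (auto simp: regularly_varying_def)
  moreover have "\<forall>\<^sub>F T in at_top. 0 < \<sigma> T" using rv by (simp add: regularly_varying_def)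
  ultimately show ?thesis by eventually_elim (auto simp: field_simps)
qed

lemma eventually_ratio_ge:
  assumes "0 < l" "a < l powr H"
  shows "\<forall>\<^sub>F T in at_top. a * \<sigma> T \<le> \<sigma> (l * T)"
proof -
  have "\<forall>\<^sub>F T in at_top. a < \<sigma> (l * T) / \<sigma> T"
    using rv assms by (intro order_tendstoD(1)[of _ "l powr H"]) (auto simp: regularly_varying_def)
  moreover have "\<forall>\<^sub>F T in at_top. 0 < \<sigma> T" using rv by (simp add: regularly_varying_def)
  ultimately show ?thesis by eventually_elim (auto simp: field_simps)
qed

text \<open>The pointwise bounds hold on closed sets covering \<^term>\<open>{1..2::real}\<close>, so by Baire one of these
  sets contains an interval; subadditivity transfers the bound to an interval at the origin.\<close>

lemma locally_bounded:
  obtains d K N where "0 < d" "0 < K" "\<And>T u. N \<le> T \<Longrightarrow> 0 \<le> u \<Longrightarrow> u \<le> d * T \<Longrightarrow> \<sigma> u \<le> K * \<sigma> T"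
proof -
  \<comment> \<open>Strictly larger than \<open>s powr H\<close> for every \<open>s\<close> between
    1 and 2, so each such \<open>s\<close> satisfies the bound eventually.\<close>
  define k where "k = 2 powr H + 1"
  define E where "E N = {s \<in> {1..2}. \<forall>T\<ge>real N. \<sigma> (s * T) \<le> k * \<sigma> T}" for N
  have closed: "closed (E N)" for N
  proof -
    have "E N = {1..2} \<inter> (\<Inter>T\<in>{real N..}. {s. \<sigma> (s * T) \<le> k * \<sigma> T})" by (auto simp: E_def)
    also have "closed \<dots>"
      by (intro closed_Int closed_INT ballI closed_Collect_le continuous_intros
            continuous_on_compose2[OF cont]) auto
    finally show ?thesis .
  qed
  have cover: "\<exists>N. s \<in> E N" if "s \<in> {1..2}" for s
  proof -
    have "s powr H \<le> 2 powr H" using that H_pos by (intro powr_mono2) auto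
    then have "\<forall>\<^sub>F T in at_top. \<sigma> (s * T) \<le> k * \<sigma> T"
      using that by (intro eventually_ratio_le) (auto simp: k_def)
    then obtain N0 where "\<And>T. N0 \<le> T \<Longrightarrow> \<sigma> (s * T) \<le> k * \<sigma> T" by (auto simp: eventually_at_top_linorder)
    moreover obtain N where "N0 \<le> real N" using real_arch_simple by blast
    ultimately show ?thesis using that by (intro exI[of _ N]) (auto simp: E_def)
  qed
  have "\<exists>N a b. a < b \<and> {a..b} \<subseteq> E N"
  proof (rule ccontr)
    assume no: "\<nexists>N a b. a < b \<and> {a..b} \<subseteq> E N"
    have "{1..2::real} \<subseteq> closure (\<Inter>(range (\<lambda>N. {1..2} - E N)))"
    proof (rule Baire)
      fix T assume "T \<in> range (\<lambda>N. {1..2} - E N)"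
      then obtain N where T: "T = {1..2} - E N" by auto
      have "openin (top_of_set {1..2}) T"
        unfolding T openin_open using closed[of N] by (intro exI[of _ "- E N"]) auto
      moreover have "{1..2} \<subseteq> closure T"
      proof
        fix x :: real assume x: "x \<in> {1..2}"
        show "x \<in> closure T"
        proof (rule ccontr)
          assume "x \<notin> closure T"
          then obtain e where e: "e > 0" "\<And>y. dist y x < e \<Longrightarrow> y \<notin> T"
            unfolding closure_approachable by auto
          define a b where "a = max 1 (x - e/2)" and "b = min 2 (x + e/2)"
          have "a < b" using x e by (auto simp: a_def b_def)
          moreover have "{a..b} \<subseteq> E N"
          proof
            fix y assume y: "y \<in> {a..b}"
            then have "dist y x < e" using e(1) by (auto simp: a_def b_def dist_real_def abs_if)
            with e(2) have "y \<notin> T" by blast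
            moreover have "y \<in> {1..2}" using y by (auto simp: a_def b_def)
            ultimately show "y \<in> E N" by (simp add: T)
          qed
          ultimately show False using no by blast
        qed
      qed
      ultimately show "openin (top_of_set {1..2}) T \<and> {1..2} \<subseteq> closure T" by blast
    qed auto
    moreover have "\<Inter>(range (\<lambda>N. {1..2} - E N)) = {}"
    proof -
      have False if "\<And>N. y \<in> {1..2} - E N" for y using cover[of y] that by blast
      then show ?thesis by blast
    qed
    ultimately have "{1..2::real} \<subseteq> closure {}" by metis
    then show False by simp
  qed
  then obtain N a b where ab: "a < b" "{a..b} \<subseteq> E N" by blast
  have k: "k > 0" unfolding k_def by (simp add: add_pos_pos)
  show ?thesis
  proof (rule that[of "b - a" "2 * k" "real N + 1"])
    fix T u assume T: "real N + 1 \<le> T" and u: "0 \<le> u" "u \<le> (b - a) * T"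
    have T0: "T > 0" using T by (auto intro: less_le_trans[of 0 "real N + 1"])
    have "u / T \<le> b - a" "0 \<le> u / T" using u T0 by (auto simp: field_simps)
    then have "a + u / T \<in> E N" "a \<in> E N" using ab by (auto intro!: subsetD[OF ab(2)])
    then have "\<sigma> ((a + u / T) * T) \<le> k * \<sigma> T" "\<sigma> (a * T) \<le> k * \<sigma> T" using T by (auto simp: E_def)
    moreover have "(a + u / T) * T + - (a * T) = u" using T0 by (simp add: field_simps)
    ultimately show "\<sigma> u \<le> 2 * k * \<sigma> T"
      using subadd[of "(a + u / T) * T" "- (a * T)"] even[of "a * T"] by simp
  qed (use ab k in auto)
qed

lemma eventually_small_args:
  assumes "0 < e"
  obtains d where "0 < d" "\<forall>\<^sub>F T in at_top. \<forall>u. 0 \<le> u \<longrightarrow> u \<le> d * T \<longrightarrow> \<sigma> u \<le> e * \<sigma> T"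
proof -
  obtain d K N where d: "0 < d" "0 < K" and bd: "\<And>T u. N \<le> T \<Longrightarrow> 0 \<le> u \<Longrightarrow> u \<le> d * T \<Longrightarrow> \<sigma> u \<le> K * \<sigma> T"
    using locally_bounded by blast
  \<comment> \<open>The local bound is used at \<open>l * T\<close> instead of \<open>T\<close>:
    there \<sigma> is asymptotically \<open>e / (2 * K)\<close> times \<open>\<sigma> T\<close>, and
    the factor 2 leaves room for the limit.\<close>
  define l where "l = (e / (2 * K)) powr (1 / H)"
  have l: "0 < l" "l powr H = e / (2 * K)" using assms d H_pos by (auto simp: l_def powr_powr)
  have "\<forall>\<^sub>F T in at_top. \<sigma> (l * T) \<le> (e / K) * \<sigma> T"
    using l assms d by (intro eventually_ratio_le) (auto simp: field_simps)
  moreover have "\<forall>\<^sub>F T in at_top. N / l \<le> T" by (rule eventually_ge_at_top)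
  ultimately have "\<forall>\<^sub>F T in at_top. \<forall>u. 0 \<le> u \<longrightarrow> u \<le> (d * l) * T \<longrightarrow> \<sigma> u \<le> e * \<sigma> T"
  proof eventually_elim
    case (elim T)
    show ?case
    proof (intro allI impI)
      fix u assume u: "0 \<le> u" "u \<le> (d * l) * T"
      have "\<sigma> u \<le> K * \<sigma> (l * T)" using u elim(2) l by (intro bd) (auto simp: field_simps)
      also have "\<dots> \<le> K * ((e / K) * \<sigma> T)" using elim(1) d by (intro mult_left_mono) auto
      finally show "\<sigma> u \<le> e * \<sigma> T" using d by simp
    qed
  qed
  then show ?thesis using d l by (intro that[of "d * l"]) auto
qed

text \<open>Pointwise limits on a finite grid extend to all \<open>s\<close> because the oscillation
  between neighbouring points is at most \<sigma> of their distance, which is small by subadditivity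
  and the bound near the origin. Grid limit, oscillation of \<sigma> and oscillation of the power
  each use a third of \<open>e\<close>.\<close>

lemma eventually_uniform:
  assumes "0 < e"
  shows "\<forall>\<^sub>F T in at_top. \<forall>s\<in>{0..1}. \<bar>\<sigma> (s * T) - s powr H * \<sigma> T\<bar> \<le> e * \<sigma> T"
proof -
  define e' where "e' = e / 3"
  have e': "e' > 0" using assms by (simp add: e'_def)
  obtain d where d: "0 < d" and small: "\<forall>\<^sub>F T in at_top. \<forall>u. 0 \<le> u \<longrightarrow> u \<le> d * T \<longrightarrow> \<sigma> u \<le> e' * \<sigma> T"
    using eventually_small_args[OF e'] by blast
  obtain n :: nat where n: "n > 0" "1 / real n \<le> d" "(1 / real n) powr H \<le> e'"
  proof -
    have lim: "(\<lambda>n. real n powr (- H)) \<longlonglongrightarrow> 0"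
      using H_pos by (intro tendsto_neg_powr filterlim_real_sequentially) auto
    have "\<forall>\<^sub>F n in sequentially. 1 / real n < d"
      using d lim_1_over_n by (auto dest: order_tendstoD(2))
    moreover have "\<forall>\<^sub>F n in sequentially. real n powr (- H) < e'"
      using lim e' by (auto dest: order_tendstoD(2))
    ultimately have "\<forall>\<^sub>F n in sequentially. n > 0 \<and> 1 / real n \<le> d \<and> (1 / real n) powr H \<le> e'"
      using eventually_gt_at_top[of 0] by eventually_elim (auto simp: powr_divide powr_minus_divide)
    from eventually_happens'[OF sequentially_bot this] show ?thesis using that by blast
  qed
  define q where "q i = real i / real n" for i
  have grid: "\<forall>\<^sub>F T in at_top. \<forall>i\<in>{0..n}. \<bar>\<sigma> (q i * T) - q i powr H * \<sigma> T\<bar> \<le> e' * \<sigma> T"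
  proof (rule eventually_ball_finite)
    show "\<forall>i\<in>{0..n}. \<forall>\<^sub>F T in at_top. \<bar>\<sigma> (q i * T) - q i powr H * \<sigma> T\<bar> \<le> e' * \<sigma> T"
    proof
      fix i
      show "\<forall>\<^sub>F T in at_top. \<bar>\<sigma> (q i * T) - q i powr H * \<sigma> T\<bar> \<le> e' * \<sigma> T"
      proof (cases "i = 0")
        case True
        then show ?thesis using e' nonneg by (simp add: q_def zero)
      next
        case False
        then have "q i > 0" using n by (simp add: q_def)
        then have "\<forall>\<^sub>F T in at_top. \<sigma> (q i * T) \<le> (q i powr H + e') * \<sigma> T"
          "\<forall>\<^sub>F T in at_top. (q i powr H - e') * \<sigma> T \<le> \<sigma> (q i * T)"
          using e' by (auto intro!: eventually_ratio_le eventually_ratio_ge)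
        then show ?thesis by eventually_elim (auto simp: abs_le_iff algebra_simps)
      qed
    qed
  qed simp
  show ?thesis
    using grid small eventually_gt_at_top[of 0]
  proof eventually_elim
    case (elim T)
    show ?case
    proof
      fix s :: real assume s: "s \<in> {0..1}"
      define i where "i = nat \<lfloor>real n * s\<rfloor>"
      have fl: "real i \<le> real n * s" "real n * s < real i + 1"
        using s n by (auto simp: i_def)
      have "real n * s \<le> real n * 1" using s by (intro mult_left_mono) auto
      then have "i \<le> n" using fl(1) by linarith
      have "q i \<le> s" using fl(1) n by (simp add: q_def field_simps)
      moreover have "s \<le> (real i + 1) / real n"
        using fl(2) n by (simp add: pos_le_divide_eq mult.commute)
      ultimately have "0 \<le> s - q i" "s - q i \<le> 1 / real n"
        by (simp_all add: q_def add_divide_distrib)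
      then have near: "0 \<le> s - q i" "s - q i \<le> 1 / real n" "0 \<le> (s - q i) * T" "(s - q i) * T \<le> d * T"
        using n elim(3) by (auto intro!: mult_right_mono)
      have "\<bar>\<sigma> (s * T) - \<sigma> (q i * T)\<bar> \<le> \<sigma> ((s - q i) * T)"
        using abs_diff_le[of "s * T" "q i * T"] by (simp add: algebra_simps)
      also have "\<dots> \<le> e' * \<sigma> T" using elim(2) near by blast
      finally have 1: "\<bar>\<sigma> (s * T) - \<sigma> (q i * T)\<bar> \<le> e' * \<sigma> T" .
      have 2: "\<bar>\<sigma> (q i * T) - q i powr H * \<sigma> T\<bar> \<le> e' * \<sigma> T" using elim(1) \<open>i \<le> n\<close> by simp
      have "\<bar>s powr H - q i powr H\<bar> \<le> \<bar>s - q i\<bar> powr H"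
        using abs_powr_diff_le[of H s "q i"] H_pos H_less s by (simp add: q_def)
      also have "\<dots> \<le> (1 / real n) powr H" using near H_pos by (intro powr_mono2) auto
      also have "\<dots> \<le> e'" by fact
      finally have "\<bar>s powr H - q i powr H\<bar> * \<sigma> T \<le> e' * \<sigma> T"
        using nonneg by (intro mult_right_mono)
      then have 3: "\<bar>q i powr H * \<sigma> T - s powr H * \<sigma> T\<bar> \<le> e' * \<sigma> T"
        using nonneg[of T] by (simp add: abs_mult abs_minus_commute flip: left_diff_distrib)
      show "\<bar>\<sigma> (s * T) - s powr H * \<sigma> T\<bar> \<le> e * \<sigma> T"
      proof -
        have "e * \<sigma> T = e' * \<sigma> T + e' * \<sigma> T + e' * \<sigma> T" by (simp add: e'_def)
        then show ?thesis using 1 2 3 by linarith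
      qed
    qed
  qed
qed

lemma eventually_uniform_square:
  assumes "0 < e"
  shows "\<forall>\<^sub>F T in at_top. \<forall>s\<in>{0..1}. \<bar>(\<sigma> (s * T))\<^sup>2 - s powr (2 * H) * (\<sigma> T)\<^sup>2\<bar> \<le> e * (\<sigma> T)\<^sup>2"
proof -
  \<comment> \<open>The cap 1 gives \<open>a \<le> 2 * \<sigma> T\<close>, hence
    \<open>a + b \<le> 3 * \<sigma> T\<close> in the factorisation of the difference of squares; the
    3 is compensated by \<open>e / 3\<close>.\<close>
  define e' where "e' = min 1 (e / 3)"
  have e': "e' > 0" "e' \<le> 1" "3 * e' \<le> e" using assms by (auto simp: e'_def)
  show ?thesis
    using eventually_uniform[OF e'(1)]
  proof eventually_elim
    case (elim T)
    show ?case
    proof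
      fix s :: real assume s: "s \<in> {0..1}"
      define a b where "a = \<sigma> (s * T)" and "b = s powr H * \<sigma> T"
      have ab: "\<bar>a - b\<bar> \<le> e' * \<sigma> T" using elim s by (simp add: a_def b_def)
      have "s powr H \<le> 1" using s H_pos by (intro powr_le1) auto
      then have b: "0 \<le> b" "b \<le> \<sigma> T" using nonneg[of T] by (auto simp: b_def intro: mult_left_le_one_le)
      have "e' * \<sigma> T \<le> \<sigma> T" using e' nonneg[of T] by (intro mult_left_le_one_le) auto
      then have "0 \<le> a" "a + b \<le> 3 * \<sigma> T" using ab b nonneg[of "s * T"] by (auto simp: a_def)
      then have "\<bar>a - b\<bar> * (a + b) \<le> (e' * \<sigma> T) * (3 * \<sigma> T)"
        using ab b e' nonneg[of T] by (intro mult_mono) auto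
      also have "\<dots> = 3 * e' * (\<sigma> T)\<^sup>2" by (simp add: power2_eq_square)
      also have "\<dots> \<le> e * (\<sigma> T)\<^sup>2" using e' by (intro mult_right_mono) auto
      also have "\<bar>a - b\<bar> * (a + b) = \<bar>a\<^sup>2 - b\<^sup>2\<bar>"
        using \<open>0 \<le> a\<close> b by (simp add: abs_mult power2_eq_square square_diff_square_factored mult.commute)
      also have "b\<^sup>2 = s powr (2 * H) * (\<sigma> T)\<^sup>2"
        by (simp add: b_def power_mult_distrib power2_eq_square[of "s powr H"] flip: powr_add)
      finally show "\<bar>(\<sigma> (s * T))\<^sup>2 - s powr (2 * H) * (\<sigma> T)\<^sup>2\<bar> \<le> e * (\<sigma> T)\<^sup>2" by (simp add: a_def)
    qed
  qed
qed

text \<open>\<sigma> need not be monotone; this is the substitute, from the uniform limit with error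
  1 and \<open>s powr H \<le> 1\<close>.\<close>

lemma eventually_max_le:
  "\<forall>\<^sub>F T in at_top. \<forall>u\<in>{0..T}. \<sigma> u \<le> 2 * \<sigma> T"
  using eventually_uniform[OF zero_less_one] eventually_gt_at_top[of 0]
proof eventually_elim
  case (elim T)
  show ?case
  proof
    fix u assume u: "u \<in> {0..T}"
    have "u / T \<in> {0..1}" using u elim by auto
    moreover have "(u / T) powr H * \<sigma> T \<le> 1 * \<sigma> T"
      using u elim H_pos nonneg by (intro mult_right_mono powr_le1) auto
    ultimately show "\<sigma> u \<le> 2 * \<sigma> T" using elim(1) elim(2) by (fastforce simp: abs_le_iff)
  qed
qed

text \<open>The exponent is lowered from \<open>H\<close> to \<open>H / 2\<close> so that a doubling
  of the argument eventually multiplies \<sigma> by at least \<open>2 powr (H / 2)\<close>.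
  Iterating from a fixed \<open>N\<close> controls the points \<open>2 ^ n * N\<close>, and almost
  monotonicity covers the times in between. The growth makes the tail series over integer times
  summable.\<close>

lemma power_growth:
  obtains c where "0 < c" "\<forall>\<^sub>F T in at_top. c * T powr (H / 2) \<le> \<sigma> T"
proof -
  have "\<forall>\<^sub>F T in at_top. 2 powr (H / 2) * \<sigma> T \<le> \<sigma> (2 * T)"
    using H_pos by (intro eventually_ratio_ge) auto
  moreover have "\<forall>\<^sub>F T in at_top. 0 < \<sigma> T" using rv by (simp add: regularly_varying_def)
  ultimately have "\<forall>\<^sub>F T in at_top. T > 0 \<and> 0 < \<sigma> T \<and> 2 powr (H / 2) * \<sigma> T \<le> \<sigma> (2 * T) \<and> (\<forall>u\<in>{0..T}. \<sigma> u \<le> 2 * \<sigma> T)"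
    using eventually_max_le eventually_gt_at_top[of 0] by eventually_elim auto
  then obtain N where N: "\<And>T. N \<le> T \<Longrightarrow> T > 0 \<and> 0 < \<sigma> T \<and> 2 powr (H / 2) * \<sigma> T \<le> \<sigma> (2 * T) \<and> (\<forall>u\<in>{0..T}. \<sigma> u \<le> 2 * \<sigma> T)"
    by (auto simp: eventually_at_top_linorder)
  have N0: "N > 0" "\<sigma> N > 0" using N[of N] by auto
  have iter: "(2 ^ n) powr (H / 2) * \<sigma> N \<le> \<sigma> (2 ^ n * N)" for n :: nat
  proof (induction n)
    case (Suc n)
    have "1 * N \<le> 2 ^ n * N" using N0 by (intro mult_right_mono) auto
    then have "2 powr (H / 2) * \<sigma> (2 ^ n * N) \<le> \<sigma> (2 * (2 ^ n * N))" using N[of "2 ^ n * N"] by auto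
    moreover have "2 powr (H / 2) * ((2 ^ n) powr (H / 2) * \<sigma> N) \<le> 2 powr (H / 2) * \<sigma> (2 ^ n * N)"
      using Suc by (intro mult_left_mono) auto
    ultimately have "2 powr (H / 2) * ((2 ^ n) powr (H / 2) * \<sigma> N) \<le> \<sigma> (2 * (2 ^ n * N))" by linarith
    then show ?case by (simp add: powr_mult mult.assoc)
  qed simp
  \<comment> \<open>The \<open>1 / 2\<close> is the loss in almost monotonicity, the factor
    \<open>2 * N\<close> comes from rounding \<open>T\<close> down to the last point
    \<open>2 ^ n * N\<close>.\<close>
  define c where "c = \<sigma> N / 2 * (1 / (2 * N)) powr (H / 2)"
  have "c * T powr (H / 2) \<le> \<sigma> T" if T: "N \<le> T" for T
  proof -
    define n where "n = nat \<lfloor>log 2 (T / N)\<rfloor>"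
    have "0 \<le> log 2 (T / N)" using T N0 by simp
    then have fl: "real n \<le> log 2 (T / N)" "log 2 (T / N) < real n + 1" by (auto simp: n_def)
    have TN: "T / N > 0" "T > 0" using T N0 by auto
    have "2 ^ n \<le> T / N" 
      using fl(1) TN by (simp add: le_log_iff powr_realpow)
    then have 1: "2 ^ n * N \<le> T" using N0 by (simp add: field_simps)
    have "T / N < 2 powr (real n + 1)" using fl(2) TN by (simp add: log_less_iff)
    also have "\<dots> = 2 ^ n * 2" by (simp add: powr_add powr_realpow)
    finally have 2: "T / (2 * N) \<le> 2 ^ n" using N0 by (simp add: field_simps)
    have "c * T powr (H / 2) = \<sigma> N / 2 * (T / (2 * N)) powr (H / 2)"
      using TN N0 by (simp add: c_def powr_divide)
    also have "\<dots> \<le> \<sigma> N / 2 * (2 ^ n) powr (H / 2)"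
      using 2 TN N0 H_pos by (intro mult_left_mono powr_mono2) auto
    also have "\<dots> \<le> \<sigma> (2 ^ n * N) / 2" using iter[of n] by (simp add: mult.commute)
    also have "\<dots> \<le> \<sigma> T" 
    proof -
      have "2 ^ n * N \<in> {0..T}" using 1 N0 by auto
      then show ?thesis using N[OF T] by force
    qed
    finally show ?thesis .
  qed
  then show ?thesis
    using N0 by (intro that[of c]) (auto simp: c_def eventually_at_top_linorder)
qed

end

section \<open>Multivariate characteristic functions\<close>

lemma (in finite_measure) integrable_iexp_finite:
  assumes [measurable]: "f \<in> borel_measurable M"
  shows "integrable M (\<lambda>x. iexp (f x))"
  by (intro integrable_const_bound[where B = 1]) auto

text \<open>Argument 0 shows that the total masses agree, so both measures can be normalised and
  Levy's uniqueness theorem applies. Finite measures are allowed because the induction over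
  coordinates restricts measures to events.\<close>

lemma finite_measure_eq_of_char_eq:
  fixes X :: "'a \<Rightarrow> real" and Y :: "'b \<Rightarrow> real"
  assumes "finite_measure M" "finite_measure N"
    and [measurable]: "X \<in> borel_measurable M" "Y \<in> borel_measurable N"
    and eq: "\<And>t. (\<integral>x. iexp (t * X x) \<partial>M) = (\<integral>x. iexp (t * Y x) \<partial>N)"
    and A [measurable]: "A \<in> sets borel"
  shows "measure M {x \<in> space M. X x \<in> A} = measure N {x \<in> space N. Y x \<in> A}"
proof -
  interpret M: finite_measure M by fact
  interpret N: finite_measure N by fact
  have mass: "measure M (space M) = measure N (space N)"
    using eq[of 0] by simp
  define m where "m = measure M (space M)"
  show ?thesis
  proof (cases "m = 0")
    case True
    then have "measure M B = 0" "measure N C = 0" for B C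
      using M.bounded_measure[of B] N.bounded_measure[of C] mass 
      by (auto simp: m_def antisym)
    then show ?thesis by simp
  next
    case False
    then have m: "m > 0" by (simp add: m_def zero_less_measure_iff)
    have key: "prob_space (density K (\<lambda>_. ennreal (1 / m)))
      \<and> (\<forall>t. char (distr (density K (\<lambda>_. ennreal (1 / m))) borel Z) t = (1 / m) *\<^sub>R (\<integral>x. iexp (t * Z x) \<partial>K))
      \<and> measure (distr (density K (\<lambda>_. ennreal (1 / m))) borel Z) A = measure K {x \<in> space K. Z x \<in> A} / m"
      if K: "finite_measure K" "measure K (space K) = m" and [measurable]: "Z \<in> borel_measurable K" 
      for K :: "'c measure" and Z :: "'c \<Rightarrow> real"
    proof -
      interpret K: finite_measure K by fact
      let ?D = "density K (\<lambda>_. ennreal (1 / m))"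
      have em: "emeasure ?D B = ennreal (measure K B / m)" if "B \<in> sets K" for B
        using that m by (simp add: emeasure_density K.emeasure_eq_measure nn_integral_cmult_indicator flip: ennreal_mult')
      have "prob_space ?D"
        using m K(2) by (intro prob_spaceI) (simp add: em)
      moreover have "char (distr ?D borel Z) t = (1 / m) *\<^sub>R (\<integral>x. iexp (t * Z x) \<partial>K)" for t
        unfolding char_def using m
        by (subst integral_distr) (simp_all add: integral_density)
      moreover have "measure (distr ?D borel Z) A = measure K {x \<in> space K. Z x \<in> A} / m"
      proof -
        have "measure (distr ?D borel Z) A = measure ?D {x \<in> space K. Z x \<in> A}"
          by (subst measure_distr) (auto simp: vimage_def Int_def conj_commute)
        also have "\<dots> = measure K {x \<in> space K. Z x \<in> A} / m"
          using m by (simp add: measure_def[of ?D] em)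
        finally show ?thesis .
      qed
      ultimately show ?thesis by blast
    qed
    note kM = key[OF assms(1) m_def[symmetric] assms(3)]
    note kN = key[OF assms(2) mass[folded m_def, symmetric] assms(4)]
    have "distr (density M (\<lambda>_. ennreal (1 / m))) borel X = distr (density N (\<lambda>_. ennreal (1 / m))) borel Y"
    proof (rule Levy_uniqueness)
      show "real_distribution (distr (density M (\<lambda>_. ennreal (1 / m))) borel X)"
        using kM by (intro prob_space.real_distribution_distr) auto
      show "real_distribution (distr (density N (\<lambda>_. ennreal (1 / m))) borel Y)"
        using kN by (intro prob_space.real_distribution_distr) auto
      show "char (distr (density M (\<lambda>_. ennreal (1 / m))) borel X) = char (distr (density N (\<lambda>_. ennreal (1 / m))) borel Y)"
        using kM kN eq by (intro ext) simp
    qed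
    then show ?thesis using kM kN m by simp
  qed
qed

text \<open>Bounded nonnegative weights are absorbed into the measures, which stay finite.\<close>

lemma weighted_measure_eq_of_char_eq:
  fixes X g :: "'a \<Rightarrow> real" and Y h :: "'b \<Rightarrow> real"
  assumes "finite_measure M" "finite_measure N"
    and [measurable]: "X \<in> borel_measurable M" "Y \<in> borel_measurable N"
      "g \<in> borel_measurable M" "h \<in> borel_measurable N"
    and g: "\<And>x. 0 \<le> g x" "\<And>x. g x \<le> B" and h: "\<And>x. 0 \<le> h x" "\<And>x. h x \<le> B"
    and eq: "\<And>t. (\<integral>x. g x *\<^sub>R iexp (t * X x) \<partial>M) = (\<integral>x. h x *\<^sub>R iexp (t * Y x) \<partial>N)"
    and A [measurable]: "A \<in> sets borel"
  shows "(\<integral>x. indicator A (X x) * g x \<partial>M) = (\<integral>x. indicator A (Y x) * h x \<partial>N)"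
proof -
  have fin: "finite_measure (density K (\<lambda>x. ennreal (w x)))
     \<and> measure (density K (\<lambda>x. ennreal (w x))) {x \<in> space K. Z x \<in> A} = (\<integral>x. indicator A (Z x) * w x \<partial>K)"
    if "finite_measure K" and [measurable]: "w \<in> borel_measurable K" "Z \<in> borel_measurable K"
      and w: "\<And>x. 0 \<le> w x" "\<And>x. w x \<le> B" for K :: "'c measure" and w Z :: "'c \<Rightarrow> real"
  proof -
    interpret finite_measure K by fact
    have "integrable K w" using w by (intro integrable_const_bound[where B = B]) auto
    then have "(\<integral>\<^sup>+x. ennreal (w x) \<partial>K) < \<infinity>"
      using w by (simp add: nn_integral_eq_integral)
    moreover have "emeasure (density K (\<lambda>x. ennreal (w x))) (space K) = (\<integral>\<^sup>+x. ennreal (w x) \<partial>K)"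
      by (subst emeasure_density) (auto intro!: nn_integral_cong)
    ultimately have "finite_measure (density K (\<lambda>x. ennreal (w x)))"
      by (intro finite_measureI) auto
    moreover have "measure (density K (\<lambda>x. ennreal (w x))) {x \<in> space K. Z x \<in> A} = (\<integral>x. indicator A (Z x) * w x \<partial>K)"
    proof -
      have "emeasure (density K (\<lambda>x. ennreal (w x))) {x \<in> space K. Z x \<in> A} = (\<integral>\<^sup>+x. ennreal (indicator A (Z x) * w x) \<partial>K)"
        by (subst emeasure_density) (auto intro!: nn_integral_cong simp: indicator_def)
      then show ?thesis
        using w by (simp add: measure_def integral_eq_nn_integral)
    qed
    ultimately show ?thesis by blast
  qed
  note fM = fin[OF assms(1,5,3) g] and fN = fin[OF assms(2,6,4) h]
  have "measure (density M (\<lambda>x. ennreal (g x))) {x \<in> space (density M (\<lambda>x. ennreal (g x))). X x \<in> A}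
      = measure (density N (\<lambda>x. ennreal (h x))) {x \<in> space (density N (\<lambda>x. ennreal (h x))). Y x \<in> A}"
    using fM fN g h eq
    by (intro finite_measure_eq_of_char_eq A) (simp_all add: integral_density)
  then show ?thesis using fM fN by simp
qed

text \<open>The complex weights \<^term>\<open>iexp \<eta>\<close> are combinations of the nonnegative weights
  \<^term>\<open>1\<close>, \<^term>\<open>1 + cos \<eta>\<close> and \<^term>\<open>1 + sin \<eta>\<close>.\<close>

lemma iexp_weighted_eq_of_char_eq:
  fixes X \<eta> :: "'a \<Rightarrow> real" and Y \<theta> :: "'b \<Rightarrow> real"
  assumes "finite_measure M" "finite_measure N"
    and [measurable]: "X \<in> borel_measurable M" "Y \<in> borel_measurable N"
      "\<eta> \<in> borel_measurable M" "\<theta> \<in> borel_measurable N"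
    and eq: "\<And>t u. (\<integral>x. iexp (t * X x + u * \<eta> x) \<partial>M) = (\<integral>x. iexp (t * Y x + u * \<theta> x) \<partial>N)"
    and A [measurable]: "A \<in> sets borel"
  shows "(\<integral>x. indicator A (X x) *\<^sub>R iexp (\<eta> x) \<partial>M) = (\<integral>x. indicator A (Y x) *\<^sub>R iexp (\<theta> x) \<partial>N)"
proof -
  interpret M: finite_measure M by fact
  interpret N: finite_measure N by fact
  have one: "(\<integral>x. indicator A (X x) * (1::real) \<partial>M) = (\<integral>x. indicator A (Y x) * 1 \<partial>N)"
    by (rule weighted_measure_eq_of_char_eq[where B = 1 and X = X and Y = Y and g = "\<lambda>_. 1" and h = "\<lambda>_. 1"])
       (use eq[of _ 0] in \<open>auto intro: assms(1,2)\<close>)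
  have iC: "iexp a = complex_of_real (cos a) + \<i> * complex_of_real (sin a)" for a
    by (simp add: exp_Euler cos_of_real sin_of_real)
  \<comment> \<open>Multiplying a character by a cosine or sine shifts its phase by \<open>b\<close>
    in both directions, so the weighted characteristic functions are combinations of the hypothesis
    for \<open>u\<close> equal to 0, 1 and -1. The factors \<open>1\<close> and \<open>(-1)\<close>
    are kept visible to match these instances.\<close>
  have cos: "(1 + cos b) *\<^sub>R iexp a = iexp a + (1/2) * iexp (a + 1 * b) + (1/2) * iexp (a + (-1) * b)" for a b
    unfolding iC by (simp add: complex_eq_iff cos_add sin_add cos_diff sin_diff algebra_simps)
  have sin: "(1 + sin b) *\<^sub>R iexp a = iexp a + (- \<i>/2) * iexp (a + 1 * b) + (\<i>/2) * iexp (a + (-1) * b)" for a b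
    unfolding iC by (simp add: complex_eq_iff cos_add sin_add cos_diff sin_diff algebra_simps)
  have ge: "0 \<le> 1 + cos a" "0 \<le> 1 + sin a" for a :: real
    using cos_ge_minus_one[of a] sin_ge_minus_one[of a] by linarith+
  have iM: "integrable M (\<lambda>x. iexp (t * X x))" "integrable M (\<lambda>x. iexp (t * X x + u * \<eta> x))" for t u
    by (intro M.integrable_iexp_finite; measurable)+
  have iN: "integrable N (\<lambda>x. iexp (t * Y x))" "integrable N (\<lambda>x. iexp (t * Y x + u * \<theta> x))" for t u
    by (intro N.integrable_iexp_finite; measurable)+
  have cos': "(\<integral>x. indicator A (X x) * (1 + cos (\<eta> x)) \<partial>M) = (\<integral>x. indicator A (Y x) * (1 + cos (\<theta> x)) \<partial>N)"
  proof (rule weighted_measure_eq_of_char_eq[where B = 2 and X = X and Y = Y and g = "\<lambda>x. 1 + cos (\<eta> x)" and h = "\<lambda>x. 1 + cos (\<theta> x)"])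
    show "(\<integral>x. (1 + cos (\<eta> x)) *\<^sub>R iexp (t * X x) \<partial>M) = (\<integral>x. (1 + cos (\<theta> x)) *\<^sub>R iexp (t * Y x) \<partial>N)" for t
      unfolding cos using eq[of t 0] eq[of t 1] eq[of t "-1"] iM(1)[of t] iM(2)[of t 1] iM(2)[of t "-1"] iN(1)[of t] iN(2)[of t 1] iN(2)[of t "-1"]
      by (simp del: mult_1 mult_minus1 of_real_add)
  qed (auto intro: assms(1,2) ge)
  have sin': "(\<integral>x. indicator A (X x) * (1 + sin (\<eta> x)) \<partial>M) = (\<integral>x. indicator A (Y x) * (1 + sin (\<theta> x)) \<partial>N)"
  proof (rule weighted_measure_eq_of_char_eq[where B = 2 and X = X and Y = Y and g = "\<lambda>x. 1 + sin (\<eta> x)" and h = "\<lambda>x. 1 + sin (\<theta> x)"])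
    show "(\<integral>x. (1 + sin (\<eta> x)) *\<^sub>R iexp (t * X x) \<partial>M) = (\<integral>x. (1 + sin (\<theta> x)) *\<^sub>R iexp (t * Y x) \<partial>N)" for t
      unfolding sin using eq[of t 0] eq[of t 1] eq[of t "-1"] iM(1)[of t] iM(2)[of t 1] iM(2)[of t "-1"] iN(1)[of t] iN(2)[of t 1] iN(2)[of t "-1"]
      by (simp del: mult_1 mult_minus1 of_real_add)
  qed (auto intro: assms(1,2) ge)
  have split: "(\<integral>x. indicator A (Z x) *\<^sub>R iexp (\<zeta> x) \<partial>K)
       = complex_of_real (\<integral>x. indicator A (Z x) * (1 + cos (\<zeta> x)) \<partial>K) + \<i> * (\<integral>x. indicator A (Z x) * (1 + sin (\<zeta> x)) \<partial>K)
         - (1 + \<i>) * (\<integral>x. indicator A (Z x) * (1::real) \<partial>K)"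
    if "finite_measure K" and [measurable]: "\<zeta> \<in> borel_measurable K" "Z \<in> borel_measurable K"
    for K :: "'c measure" and \<zeta> Z :: "'c \<Rightarrow> real"
  proof -
    interpret finite_measure K by fact
    have int: "integrable K (\<lambda>x. indicator A (Z x) * (1 + cos (\<zeta> x)))" "integrable K (\<lambda>x. indicator A (Z x) * (1 + sin (\<zeta> x)))"
      "integrable K (\<lambda>x. indicator A (Z x) * (1::real))"
      by ((rule integrable_const_bound[where B = 2], simp add: indicator_def abs_of_nonneg[OF ge(1)] abs_of_nonneg[OF ge(2)], measurable)[1])+
    have comb: "(\<integral>x. complex_of_real (f x) + \<i> * complex_of_real (g x) - (1 + \<i>) * complex_of_real (h x) \<partial>K)
        = complex_of_real (\<integral>x. f x \<partial>K) + \<i> * complex_of_real (\<integral>x. g x \<partial>K) - (1 + \<i>) * complex_of_real (\<integral>x. h x \<partial>K)"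
      if "integrable K f" "integrable K g" "integrable K h" for f g h :: "'c \<Rightarrow> real"
      using that by simp
    have "(\<integral>x. indicator A (Z x) *\<^sub>R iexp (\<zeta> x) \<partial>K)
        = (\<integral>x. complex_of_real (indicator A (Z x) * (1 + cos (\<zeta> x))) + \<i> * complex_of_real (indicator A (Z x) * (1 + sin (\<zeta> x)))
          - (1 + \<i>) * complex_of_real (indicator A (Z x) * 1 :: real) \<partial>K)"
      by (intro Bochner_Integration.integral_cong refl) (simp add: iC indicator_def algebra_simps)
    also have "\<dots> = complex_of_real (\<integral>x. indicator A (Z x) * (1 + cos (\<zeta> x)) \<partial>K) + \<i> * (\<integral>x. indicator A (Z x) * (1 + sin (\<zeta> x)) \<partial>K)
         - (1 + \<i>) * (\<integral>x. indicator A (Z x) * (1::real) \<partial>K)"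
      by (rule comb) (fact int)+
    finally show ?thesis .
  qed
  show ?thesis
    using one cos' sin' by (simp only: split[OF assms(1) assms(5,3)] split[OF assms(2) assms(6,4)])
qed

text \<open>For the induction step, restrict both measures to the event that the new coordinate lies in
  its set: by the previous lemma this preserves the equality of the characteristic functions of
  the remaining coordinates.\<close>

lemma measure_box_eq_of_char_eq:
  fixes X :: "'i \<Rightarrow> 'a \<Rightarrow> real" and Y :: "'i \<Rightarrow> 'b \<Rightarrow> real"
  assumes "finite I" "finite_measure M" "finite_measure N"
    and "\<And>i. i \<in> I \<Longrightarrow> X i \<in> borel_measurable M" "\<And>i. i \<in> I \<Longrightarrow> Y i \<in> borel_measurable N"
    and "\<And>u. (\<integral>x. iexp (\<Sum>i\<in>I. u i * X i x) \<partial>M) = (\<integral>x. iexp (\<Sum>i\<in>I. u i * Y i x) \<partial>N)"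
    and "\<And>i. i \<in> I \<Longrightarrow> A i \<in> sets borel"
  shows "measure M {x \<in> space M. \<forall>i\<in>I. X i x \<in> A i} = measure N {x \<in> space N. \<forall>i\<in>I. Y i x \<in> A i}"
  using assms
proof (induction I arbitrary: M N rule: finite_induct)
  case empty
  \<comment> \<open>With no coordinates left, the characteristic functions reduce to the total
    masses.\<close>
  from empty(5)[of undefined] show ?case by simp
next
  case (insert j I)
  interpret M: finite_measure M by fact
  interpret N: finite_measure N by fact
  have [measurable]: "X j \<in> borel_measurable M" "Y j \<in> borel_measurable N" "A j \<in> sets borel"
    and [measurable]: "\<And>i. i \<in> I \<Longrightarrow> X i \<in> borel_measurable M" "\<And>i. i \<in> I \<Longrightarrow> Y i \<in> borel_measurable N"
      "\<And>i. i \<in> I \<Longrightarrow> A i \<in> sets borel"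
    using insert.prems by auto
  define M' where "M' = density M (\<lambda>x. ennreal (indicator (A j) (X j x)))"
  define N' where "N' = density N (\<lambda>x. ennreal (indicator (A j) (Y j x)))"
  have fin: "finite_measure M'" "finite_measure N'"
  proof -
    have "emeasure M' (space M) \<le> emeasure M (space M)" "emeasure N' (space N) \<le> emeasure N (space N)"
      unfolding M'_def N'_def
      by (subst emeasure_density; auto simp: nn_integral_indicator[symmetric] indicator_def intro!: nn_integral_mono simp del: nn_integral_indicator)+
    then show "finite_measure M'" "finite_measure N'"
      by (intro finite_measureI; auto simp: M'_def N'_def top_unique)+
  qed
  have "measure M' {x \<in> space M'. \<forall>i\<in>I. X i x \<in> A i} = measure N' {x \<in> space N'. \<forall>i\<in>I. Y i x \<in> A i}"
  proof (rule insert.IH[OF fin])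
    fix u :: "'i \<Rightarrow> real"
    have "(\<integral>x. indicator (A j) (X j x) *\<^sub>R iexp (\<Sum>i\<in>I. u i * X i x) \<partial>M)
        = (\<integral>x. indicator (A j) (Y j x) *\<^sub>R iexp (\<Sum>i\<in>I. u i * Y i x) \<partial>N)"
    proof (rule iexp_weighted_eq_of_char_eq[OF insert.prems(1,2)])
      fix t w :: real
      have "(\<Sum>i\<in>insert j I. (if i = j then t else w * u i) * Z i) = t * Z j + w * (\<Sum>i\<in>I. u i * Z i)" for Z
      proof -
        have "(\<Sum>i\<in>I. (if i = j then t else w * u i) * Z i) = (\<Sum>i\<in>I. w * (u i * Z i))"
          using insert.hyps by (intro sum.cong) auto
        then show ?thesis using insert.hyps by (simp add: sum_distrib_left)
      qed
      then show "(\<integral>x. iexp (t * X j x + w * (\<Sum>i\<in>I. u i * X i x)) \<partial>M) = (\<integral>x. iexp (t * Y j x + w * (\<Sum>i\<in>I. u i * Y i x)) \<partial>N)"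
        using insert.prems(5)[of "\<lambda>i. if i = j then t else w * u i"] by simp
    qed measurable
    then show "(\<integral>x. iexp (\<Sum>i\<in>I. u i * X i x) \<partial>M') = (\<integral>x. iexp (\<Sum>i\<in>I. u i * Y i x) \<partial>N')"
      by (simp add: M'_def N'_def integral_density)
  qed (auto simp: M'_def N'_def)
  moreover have "emeasure M' {x \<in> space M'. \<forall>i\<in>I. X i x \<in> A i} = emeasure M {x \<in> space M. \<forall>i\<in>insert j I. X i x \<in> A i}"
    unfolding M'_def using insert.hyps(1)
    by (subst emeasure_density)
       (auto simp: nn_integral_indicator[symmetric] indicator_def intro!: nn_integral_cong simp del: nn_integral_indicator)
  moreover have "emeasure N' {x \<in> space N'. \<forall>i\<in>I. Y i x \<in> A i} = emeasure N {x \<in> space N. \<forall>i\<in>insert j I. Y i x \<in> A i}"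
    unfolding N'_def using insert.hyps(1)
    by (subst emeasure_density)
       (auto simp: nn_integral_indicator[symmetric] indicator_def intro!: nn_integral_cong simp del: nn_integral_indicator)
  ultimately show ?case by (simp add: measure_def)
qed

section \<open>Gaussian spaces\<close>

lemma integral_normal_density_iexp:
  assumes \<sigma>: "0 < \<sigma>"
  shows "(\<integral>x. normal_density m \<sigma> x *\<^sub>R iexp (a * x) \<partial>lborel) = iexp (a * m) * exp (- (a * \<sigma>)\<^sup>2 / 2)"
proof -
  have std: "normal_density m \<sigma> (m + \<sigma> * x) = std_normal_density x / \<sigma>" for x
    using \<sigma> by (simp add: normal_density_def power_mult_distrib real_sqrt_mult field_simps)
  have "(\<integral>x. normal_density m \<sigma> x *\<^sub>R iexp (a * x) \<partial>lborel)
      = \<bar>\<sigma>\<bar> *\<^sub>R (\<integral>x. normal_density m \<sigma> (m + \<sigma> * x) *\<^sub>R iexp (a * (m + \<sigma> * x)) \<partial>lborel)"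
    using \<sigma> by (intro lborel_integral_real_affine) simp
  also have "(\<lambda>x. normal_density m \<sigma> (m + \<sigma> * x) *\<^sub>R iexp (a * (m + \<sigma> * x)))
      = (\<lambda>x. (iexp (a * m) / \<sigma>) * (std_normal_density x *\<^sub>R iexp ((a * \<sigma>) * x)))"
    unfolding std by (auto simp: fun_eq_iff scaleR_conv_of_real exp_add[symmetric] algebra_simps)
  also have "\<bar>\<sigma>\<bar> *\<^sub>R (\<integral>x. (iexp (a * m) / \<sigma>) * (std_normal_density x *\<^sub>R iexp ((a * \<sigma>) * x)) \<partial>lborel)
      = iexp (a * m) * char std_normal_distribution (a * \<sigma>)"
    unfolding char_def using \<sigma>
    by (subst integral_mult_right_zero) (simp add: integral_density scaleR_conv_of_real)
  also have "\<dots> = iexp (a * m) * exp (- (a * \<sigma>)\<^sup>2 / 2)"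
    by (simp add: char_std_normal_distribution exp_of_real)
  finally show ?thesis .
qed

text \<open>Completing the square: exponential tilting moves the mean from 0 to the variance. This
  is the Cameron--Martin shift in one dimension.\<close>

lemma normal_density_times_exp:
  assumes "0 < \<sigma>"
  shows "normal_density 0 \<sigma> x * exp x = exp (\<sigma>\<^sup>2 / 2) * normal_density (\<sigma>\<^sup>2) \<sigma> x"
proof -
  have "- x\<^sup>2 / (2 * \<sigma>\<^sup>2) + x = \<sigma>\<^sup>2 / 2 + - (x - \<sigma>\<^sup>2)\<^sup>2 / (2 * \<sigma>\<^sup>2)"
    using assms by (simp add: field_simps power2_eq_square)
  then show ?thesis
    unfolding normal_density_def by (simp add: exp_add[symmetric] mult.left_commute)
qed

text \<open>A linear space of centred Gaussian variables. Closure in L2 is not demanded, since all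
  shifts and averages below are finite linear combinations.\<close>

locale gaussian_space = prob_space M for M :: "'a measure" +
  fixes G :: "('a \<Rightarrow> real) set"
  assumes gaussian: "X \<in> G \<Longrightarrow> gaussian_rv M X"
    and centered: "X \<in> G \<Longrightarrow> expectation X = 0"
    and zero: "(\<lambda>_. 0) \<in> G"
    and add: "X \<in> G \<Longrightarrow> Y \<in> G \<Longrightarrow> (\<lambda>\<omega>. X \<omega> + Y \<omega>) \<in> G"
    and scale: "X \<in> G \<Longrightarrow> (\<lambda>\<omega>. c * X \<omega>) \<in> G"
begin

lemma diff: "X \<in> G \<Longrightarrow> Y \<in> G \<Longrightarrow> (\<lambda>\<omega>. X \<omega> - Y \<omega>) \<in> G"
  using add[of X "\<lambda>\<omega>. (-1) * Y \<omega>"] scale[of Y "-1"] by simp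

lemma sum: "finite I \<Longrightarrow> (\<And>i. i \<in> I \<Longrightarrow> X i \<in> G) \<Longrightarrow> (\<lambda>\<omega>. \<Sum>i\<in>I. c i * X i \<omega>) \<in> G"
  by (induction I rule: finite_induct) (simp_all add: zero add scale)

lemma measurable_G [measurable_dest]: "X \<in> G \<Longrightarrow> X \<in> borel_measurable M"
  using gaussian by (auto simp: gaussian_rv_def)

definition cov :: "('a \<Rightarrow> real) \<Rightarrow> ('a \<Rightarrow> real) \<Rightarrow> real" where
  "cov X Y = expectation (\<lambda>\<omega>. X \<omega> * Y \<omega>)"

text \<open>A centred constant vanishes, so the degenerate elements are exactly those of variance 0,
  and every other element has a density with positive standard deviation.\<close>

lemma cases_G:
  assumes "X \<in> G"
  obtains (degenerate) "AE \<omega> in M. X \<omega> = 0" "cov X X = 0"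
  | (normal) \<sigma> where "0 < \<sigma>" "cov X X = \<sigma>\<^sup>2" "distributed M lborel X (normal_density 0 \<sigma>)"
proof -
  have [measurable]: "X \<in> borel_measurable M" using assms by measurable
  from gaussian[OF assms] consider \<mu> where "AE \<omega> in M. X \<omega> = \<mu>"
    | \<mu> \<sigma> where "0 < \<sigma>" "distributed M lborel X (normal_density \<mu> \<sigma>)"
    by (auto simp: gaussian_rv_def)
  then show thesis
  proof cases
    case (1 \<mu>)
    then have "expectation X = expectation (\<lambda>_. \<mu>)" by (intro integral_cong_AE) auto
    then have \<mu>: "\<mu> = 0" using centered[OF assms] prob_space by simp
    with 1 have "AE \<omega> in M. X \<omega> = 0" by simp
    moreover from this have "cov X X = expectation (\<lambda>_. 0)"
      unfolding cov_def by (intro integral_cong_AE) auto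
    ultimately show thesis by (intro degenerate) auto
  next
    case (2 \<mu> \<sigma>)
    have "\<mu> = 0" using normal_distributed_expectation[OF 2] centered[OF assms] by simp
    moreover have "cov X X = \<sigma>\<^sup>2"
      using normal_distributed_variance[OF 2] centered[OF assms] by (simp add: cov_def power2_eq_square)
    ultimately show thesis using 2 by (intro normal) auto
  qed
qed

lemma integrable_square: "X \<in> G \<Longrightarrow> integrable M (\<lambda>\<omega>. X \<omega> * X \<omega>)"
proof -
  assume X: "X \<in> G"
  then have [measurable]: "X \<in> borel_measurable M" by measurable
  show ?thesis
  proof (cases rule: cases_G[OF X])
    case 1
    then have "integrable M (\<lambda>\<omega>. X \<omega> * X \<omega>) \<longleftrightarrow> integrable M (\<lambda>_. 0::real)"
      by (intro integrable_cong_AE) auto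
    then show ?thesis by simp
  next
    case (2 \<sigma>)
    have "integrable lborel (\<lambda>x. normal_density 0 \<sigma> x * (x - 0) ^ 2)"
      using 2 by (intro integrable_normal_moment)
    then show ?thesis
      using distributed_integrable[OF 2(3), of "\<lambda>x. x * x"] 2 by (simp add: power2_eq_square)
  qed
qed

lemma integrable_mult:
  assumes X: "X \<in> G" and Y: "Y \<in> G"
  shows "integrable M (\<lambda>\<omega>. X \<omega> * Y \<omega>)"
proof -
  have "integrable M (\<lambda>\<omega>. ((X \<omega> + Y \<omega>) * (X \<omega> + Y \<omega>) - X \<omega> * X \<omega> - Y \<omega> * Y \<omega>) / 2)"
    using integrable_square[OF add[OF X Y]] integrable_square[OF X] integrable_square[OF Y] by simp
  then show ?thesis by (simp add: algebra_simps)
qed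

lemma cov_commute: "cov X Y = cov Y X"
  by (simp add: cov_def mult.commute)

lemma cov_scale_left: "cov (\<lambda>\<omega>. c * X \<omega>) Y = c * cov X Y"
  by (simp add: cov_def mult.assoc)

lemma cov_scale_right: "cov X (\<lambda>\<omega>. c * Y \<omega>) = c * cov X Y"
  by (simp add: cov_def mult.left_commute)

lemma cov_add_left: "X \<in> G \<Longrightarrow> X' \<in> G \<Longrightarrow> Y \<in> G \<Longrightarrow> cov (\<lambda>\<omega>. X \<omega> + X' \<omega>) Y = cov X Y + cov X' Y"
  unfolding cov_def using integrable_mult by (simp add: distrib_right)

lemma cov_add_right: "X \<in> G \<Longrightarrow> Y \<in> G \<Longrightarrow> Y' \<in> G \<Longrightarrow> cov X (\<lambda>\<omega>. Y \<omega> + Y' \<omega>) = cov X Y + cov X Y'"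
  unfolding cov_def using integrable_mult by (simp add: distrib_left)

lemma cov_diff_left: "X \<in> G \<Longrightarrow> X' \<in> G \<Longrightarrow> Y \<in> G \<Longrightarrow> cov (\<lambda>\<omega>. X \<omega> - X' \<omega>) Y = cov X Y - cov X' Y"
  unfolding cov_def using integrable_mult by (simp add: left_diff_distrib)

lemma cov_diff_right: "X \<in> G \<Longrightarrow> Y \<in> G \<Longrightarrow> Y' \<in> G \<Longrightarrow> cov X (\<lambda>\<omega>. Y \<omega> - Y' \<omega>) = cov X Y - cov X Y'"
  unfolding cov_def using integrable_mult by (simp add: right_diff_distrib)

lemma cov_sum_left:
  "finite I \<Longrightarrow> (\<And>i. i \<in> I \<Longrightarrow> X i \<in> G) \<Longrightarrow> Y \<in> G \<Longrightarrow>
    cov (\<lambda>\<omega>. \<Sum>i\<in>I. c i * X i \<omega>) Y = (\<Sum>i\<in>I. c i * cov (X i) Y)"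
  unfolding cov_def using integrable_mult by (simp add: sum_distrib_right mult.assoc)

lemma cov_sum_right:
  "finite I \<Longrightarrow> (\<And>i. i \<in> I \<Longrightarrow> X i \<in> G) \<Longrightarrow> Y \<in> G \<Longrightarrow>
    cov Y (\<lambda>\<omega>. \<Sum>i\<in>I. c i * X i \<omega>) = (\<Sum>i\<in>I. c i * cov Y (X i))"
  using cov_sum_left[of I X Y c] by (simp add: cov_commute[of Y])

lemma cov_nonneg: "0 \<le> cov X X"
  by (simp add: cov_def)

lemma exp_moment:
  assumes X: "X \<in> G"
  shows "integrable M (\<lambda>\<omega>. exp (X \<omega>))" "expectation (\<lambda>\<omega>. exp (X \<omega>)) = exp (cov X X / 2)"
proof -
  have [measurable]: "X \<in> borel_measurable M" using X by measurable
  have "integrable M (\<lambda>\<omega>. exp (X \<omega>)) \<and> expectation (\<lambda>\<omega>. exp (X \<omega>)) = exp (cov X X / 2)"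
  proof (cases rule: cases_G[OF X])
    case 1
    then have "AE \<omega> in M. exp (X \<omega>) = 1" by auto
    then have "integrable M (\<lambda>\<omega>. exp (X \<omega>)) \<longleftrightarrow> integrable M (\<lambda>_. 1::real)"
      "expectation (\<lambda>\<omega>. exp (X \<omega>)) = expectation (\<lambda>_. 1)"
      by (intro integrable_cong_AE integral_cong_AE; simp)+
    then show ?thesis using 1 prob_space by simp
  next
    case (2 \<sigma>)
    have "integrable lborel (\<lambda>x. normal_density 0 \<sigma> x * exp x)" "(\<integral>x. normal_density 0 \<sigma> x * exp x \<partial>lborel) = exp (\<sigma>\<^sup>2 / 2)"
      using 2(1) by (simp_all add: normal_density_times_exp)
    then show ?thesis
      using distributed_integrable[OF 2(3), of exp] distributed_integral[OF 2(3), of exp] 2 by simp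
  qed
  then show "integrable M (\<lambda>\<omega>. exp (X \<omega>))" "expectation (\<lambda>\<omega>. exp (X \<omega>)) = exp (cov X X / 2)" by auto
qed

lemma exp_iexp_self:
  assumes X: "X \<in> G"
  shows "(\<integral>\<omega>. exp (X \<omega>) *\<^sub>R iexp (a * X \<omega>) \<partial>M) = exp (cov X X / 2) *\<^sub>R (iexp (a * cov X X) * exp (- a\<^sup>2 * cov X X / 2))"
proof -
  have [measurable]: "X \<in> borel_measurable M" using X by measurable
  show ?thesis
  proof (cases rule: cases_G[OF X])
    case 1
    then have "(\<integral>\<omega>. exp (X \<omega>) *\<^sub>R iexp (a * X \<omega>) \<partial>M) = (\<integral>\<omega>. (1::complex) \<partial>M)"
      by (intro integral_cong_AE) auto
    then show ?thesis using 1 prob_space by simp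
  next
    case (2 \<sigma>)
    have "(\<integral>\<omega>. exp (X \<omega>) *\<^sub>R iexp (a * X \<omega>) \<partial>M) = (\<integral>x. exp x *\<^sub>R iexp (a * x) \<partial>distr M lborel X)"
      by (subst integral_distr) auto
    also have "\<dots> = (\<integral>x. normal_density 0 \<sigma> x *\<^sub>R (exp x *\<^sub>R iexp (a * x)) \<partial>lborel)"
      unfolding distributed_distr_eq_density[OF 2(3)] by (subst integral_density) auto
    also have "\<dots> = (\<integral>x. exp (\<sigma>\<^sup>2 / 2) *\<^sub>R (normal_density (\<sigma>\<^sup>2) \<sigma> x *\<^sub>R iexp (a * x)) \<partial>lborel)"
      by (simp only: scaleR_scaleR normal_density_times_exp[OF 2(1)])
    also have "\<dots> = exp (\<sigma>\<^sup>2 / 2) *\<^sub>R (iexp (a * \<sigma>\<^sup>2) * exp (- (a * \<sigma>)\<^sup>2 / 2))"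
      by (simp only: integral_scaleR_right integral_normal_density_iexp[OF 2(1)])
    finally show ?thesis using 2 by (simp add: power_mult_distrib)
  qed
qed

lemma char_G:
  assumes X: "X \<in> G"
  shows "(\<integral>\<omega>. iexp (X \<omega>) \<partial>M) = exp (- cov X X / 2)"
proof -
  have [measurable]: "X \<in> borel_measurable M" using X by measurable
  show ?thesis
  proof (cases rule: cases_G[OF X])
    case 1
    then have "(\<integral>\<omega>. iexp (X \<omega>) \<partial>M) = (\<integral>\<omega>. (1::complex) \<partial>M)"
      by (intro integral_cong_AE) auto
    then show ?thesis using 1 prob_space by simp
  next
    case (2 \<sigma>)
    have "(\<integral>\<omega>. iexp (X \<omega>) \<partial>M) = (\<integral>x. iexp x \<partial>distr M lborel X)"
      by (subst integral_distr) auto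
    also have "\<dots> = (\<integral>x. normal_density 0 \<sigma> x *\<^sub>R iexp (1 * x) \<partial>lborel)"
      unfolding distributed_distr_eq_density[OF 2(3)] by (subst integral_density) auto
    also have "\<dots> = exp (- cov X X / 2)"
      unfolding integral_normal_density_iexp[OF 2(1)] using 2 by simp
    finally show ?thesis .
  qed
qed

lemma char_prod:
  assumes X: "X \<in> G" and Y: "Y \<in> G"
  shows "(\<integral>p. iexp (X (fst p) + Y (snd p)) \<partial>(M \<Otimes>\<^sub>M M)) = exp (- (cov X X + cov Y Y) / 2)"
proof -
  have [measurable]: "X \<in> borel_measurable M" "Y \<in> borel_measurable M" using X Y by measurable
  interpret P: pair_prob_space M M ..
  have "(\<integral>p. iexp (X (fst p) + Y (snd p)) \<partial>(M \<Otimes>\<^sub>M M)) = (\<integral>x. \<integral>y. iexp (X x + Y y) \<partial>M \<partial>M)"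
    using P.integral_fst'[of "\<lambda>p. iexp (X (fst p) + Y (snd p))"] P.P.integrable_iexp_finite[of "\<lambda>p. X (fst p) + Y (snd p)"]
    by simp
  also have "\<dots> = (\<integral>x. iexp (X x) * (\<integral>y. iexp (Y y) \<partial>M) \<partial>M)"
    by (simp add: distrib_left exp_add)
  also have "\<dots> = (\<integral>x. iexp (X x) \<partial>M) * (\<integral>y. iexp (Y y) \<partial>M)" by simp
  also have "\<dots> = exp (- (cov X X + cov Y Y) / 2)"
    unfolding char_G[OF X] char_G[OF Y] by (simp add: exp_add[symmetric] flip: of_real_mult)
  finally show ?thesis .
qed

text \<open>The pair \<open>(X, Y)\<close> is compared with independent copies on the product space.
  Without the mixed term the variance of each linear combination splits, so the characteristic
  functions agree, and with them the probabilities of rectangles.\<close>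

lemma indep_of_uncorrelated:
  assumes X: "X \<in> G" and Y: "Y \<in> G" and XY: "cov X Y = 0"
  shows "indep_var borel X borel Y"
proof -
  have [measurable]: "X \<in> borel_measurable M" "Y \<in> borel_measurable M" using X Y by measurable
  interpret P: pair_prob_space M M ..
  have prod: "prob {\<omega> \<in> space M. X \<omega> \<in> A \<and> Y \<omega> \<in> B} = prob {\<omega> \<in> space M. X \<omega> \<in> A} * prob {\<omega> \<in> space M. Y \<omega> \<in> B}"
    if [measurable]: "A \<in> sets borel" "B \<in> sets borel" for A B
  proof -
    have UB: "(\<Sum>i\<in>UNIV. f i) = f True + f False" for f :: "bool \<Rightarrow> real"
      by (simp add: UNIV_bool add.commute)
    have "prob {\<omega> \<in> space M. \<forall>i\<in>UNIV. (case i of True \<Rightarrow> X | False \<Rightarrow> Y) \<omega> \<in> (case i of True \<Rightarrow> A | False \<Rightarrow> B)}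
       = measure (M \<Otimes>\<^sub>M M) {p \<in> space (M \<Otimes>\<^sub>M M). \<forall>i\<in>UNIV. (case i of True \<Rightarrow> X \<circ> fst | False \<Rightarrow> Y \<circ> snd) p \<in> (case i of True \<Rightarrow> A | False \<Rightarrow> B)}"
    proof (rule measure_box_eq_of_char_eq)
      fix u :: "bool \<Rightarrow> real"
      have G: "(\<lambda>\<omega>. u True * X \<omega>) \<in> G" "(\<lambda>\<omega>. u False * Y \<omega>) \<in> G" using X Y scale by auto
      have "cov (\<lambda>\<omega>. u True * X \<omega> + u False * Y \<omega>) (\<lambda>\<omega>. u True * X \<omega> + u False * Y \<omega>)
          = cov (\<lambda>\<omega>. u True * X \<omega>) (\<lambda>\<omega>. u True * X \<omega>) + cov (\<lambda>\<omega>. u False * Y \<omega>) (\<lambda>\<omega>. u False * Y \<omega>)"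
        using G add[OF G] XY cov_commute[of Y X]
        by (simp add: cov_add_left cov_add_right) (simp add: cov_scale_left cov_scale_right)
      then show "(\<integral>\<omega>. iexp (\<Sum>i\<in>UNIV. u i * (case i of True \<Rightarrow> X | False \<Rightarrow> Y) \<omega>) \<partial>M)
          = (\<integral>p. iexp (\<Sum>i\<in>UNIV. u i * (case i of True \<Rightarrow> X \<circ> fst | False \<Rightarrow> Y \<circ> snd) p) \<partial>(M \<Otimes>\<^sub>M M))"
        unfolding UB using char_prod[OF G] char_G[OF add[OF G]] by simp
    qed (auto split: bool.split intro: finite_measure_axioms P.P.finite_measure_axioms)
    also have "{p \<in> space (M \<Otimes>\<^sub>M M). \<forall>i\<in>UNIV. (case i of True \<Rightarrow> X \<circ> fst | False \<Rightarrow> Y \<circ> snd) p \<in> (case i of True \<Rightarrow> A | False \<Rightarrow> B)}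
       = {\<omega> \<in> space M. X \<omega> \<in> A} \<times> {\<omega> \<in> space M. Y \<omega> \<in> B}"
      by (auto simp: space_pair_measure UNIV_bool)
    also have "measure (M \<Otimes>\<^sub>M M) \<dots> = prob {\<omega> \<in> space M. X \<omega> \<in> A} * prob {\<omega> \<in> space M. Y \<omega> \<in> B}"
      by (simp add: measure_def emeasure_pair_measure_Times enn2real_mult)
    also have "{\<omega> \<in> space M. \<forall>i\<in>UNIV. (case i of True \<Rightarrow> X | False \<Rightarrow> Y) \<omega> \<in> (case i of True \<Rightarrow> A | False \<Rightarrow> B)}
       = {\<omega> \<in> space M. X \<omega> \<in> A \<and> Y \<omega> \<in> B}"
      by (auto simp: UNIV_bool)
    finally show ?thesis .
  qed
  have "indep_set (sigma_sets (space M) {X -` A \<inter> space M |A. A \<in> sets borel}) (sigma_sets (space M) {Y -` A \<inter> space M |A. A \<in> sets borel})"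
  proof (rule indep_set_sigma_sets)
    show "indep_set {X -` A \<inter> space M |A. A \<in> sets borel} {Y -` A \<inter> space M |A. A \<in> sets borel}"
      unfolding indep_sets2_eq
    proof (intro conjI ballI)
      fix a b assume "a \<in> {X -` A \<inter> space M |A. A \<in> sets borel}" "b \<in> {Y -` A \<inter> space M |A. A \<in> sets borel}"
      then obtain A B where AB: "a = X -` A \<inter> space M" "b = Y -` B \<inter> space M" "A \<in> sets borel" "B \<in> sets borel" by auto
      have "a = {\<omega> \<in> space M. X \<omega> \<in> A}" "b = {\<omega> \<in> space M. Y \<omega> \<in> B}"
        "a \<inter> b = {\<omega> \<in> space M. X \<omega> \<in> A \<and> Y \<omega> \<in> B}" using AB by auto
      then show "prob (a \<inter> b) = prob a * prob b" using prod[OF AB(3,4)] by simp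
    qed auto
    show "Int_stable {X -` A \<inter> space M |A. A \<in> sets borel}" "Int_stable {Y -` A \<inter> space M |A. A \<in> sets borel}"
      by (auto simp: Int_stable_def intro: exI[of _ "_ \<inter> _"]; metis (no_types, lifting) Int_assoc Int_commute Int_left_absorb sets.Int vimage_Int)+
  qed
  then show ?thesis by (simp add: indep_var_eq)
qed

text \<open>Regression: \<open>Y\<close> is split into a multiple of \<open>X\<close> and a
  remainder \<open>Z\<close> uncorrelated with \<open>X\<close>, hence independent of it. The
  integral factorises into a one-dimensional tilted integral and a characteristic function.\<close>

lemma exp_iexp_moment:
  assumes X: "X \<in> G" and Y: "Y \<in> G"
  shows "(\<integral>\<omega>. exp (X \<omega>) *\<^sub>R iexp (Y \<omega>) \<partial>M) = exp (cov X X / 2) *\<^sub>R (iexp (cov X Y) * exp (- cov Y Y / 2))"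
proof (cases "cov X X = 0")
  case True
  have [measurable]: "X \<in> borel_measurable M" "Y \<in> borel_measurable M" using X Y by measurable
  have AE: "AE \<omega> in M. X \<omega> = 0" using True by (cases rule: cases_G[OF X]) auto
  then have "cov X Y = expectation (\<lambda>_. 0)" unfolding cov_def by (intro integral_cong_AE) auto
  moreover have "(\<integral>\<omega>. exp (X \<omega>) *\<^sub>R iexp (Y \<omega>) \<partial>M) = (\<integral>\<omega>. iexp (Y \<omega>) \<partial>M)"
    using AE by (intro integral_cong_AE) auto
  ultimately show ?thesis using True char_G[OF Y] by simp
next
  case False
  define v a where "v = cov X X" and "a = cov X Y / cov X X"
  define Z where "Z \<omega> = Y \<omega> - a * X \<omega>" for \<omega>
  have Z: "Z \<in> G" unfolding Z_def[abs_def] using X Y diff scale by auto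
  have [measurable]: "X \<in> borel_measurable M" "Z \<in> borel_measurable M" using X Z by measurable
  have "cov X Z = 0"
  proof -
    have "cov X Z = cov X Y - a * cov X X"
      using X Y scale by (simp add: Z_def[abs_def] cov_diff_right cov_scale_right)
    then show ?thesis using False by (simp add: a_def)
  qed
  then have ind: "indep_var borel X borel Z" using indep_of_uncorrelated X Z by blast
  have cZ: "cov Z Z = cov Y Y - a\<^sup>2 * v"
  proof -
    have "cov Z Z = cov (\<lambda>\<omega>. Y \<omega> - a * X \<omega>) Z" by (simp add: Z_def[abs_def])
    also have "\<dots> = cov Y Z" using X Y Z scale \<open>cov X Z = 0\<close> by (simp add: cov_diff_left cov_scale_left)
    also have "\<dots> = cov Y Y - a * cov Y X" using X Y scale by (simp add: Z_def[abs_def] cov_diff_right cov_scale_right)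
    also have "cov Y X = a * v" using False by (simp add: a_def v_def cov_commute)
    finally show ?thesis by (simp add: power2_eq_square)
  qed
  have int: "integrable M (\<lambda>\<omega>. exp (X \<omega>) *\<^sub>R iexp (a * X \<omega>))"
    by (rule Bochner_Integration.integrable_bound[OF exp_moment(1)[OF X]]) auto
  have "(\<integral>\<omega>. exp (X \<omega>) *\<^sub>R iexp (Y \<omega>) \<partial>M) = (\<integral>\<omega>. (exp (X \<omega>) *\<^sub>R iexp (a * X \<omega>)) * iexp (Z \<omega>) \<partial>M)"
    by (intro Bochner_Integration.integral_cong refl) (simp add: Z_def exp_add[symmetric] algebra_simps)
  also have "\<dots> = (\<integral>\<omega>. exp (X \<omega>) *\<^sub>R iexp (a * X \<omega>) \<partial>M) * (\<integral>\<omega>. iexp (Z \<omega>) \<partial>M)"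
  proof (rule indep_var_lebesgue_integral)
    have "indep_var borel ((\<lambda>x. exp x *\<^sub>R iexp (a * x)) \<circ> X) borel ((\<lambda>x. iexp x) \<circ> Z)"
      by (rule indep_var_compose[OF ind]) auto
    then show "indep_var borel (\<lambda>\<omega>. exp (X \<omega>) *\<^sub>R iexp (a * X \<omega>)) borel (\<lambda>\<omega>. iexp (Z \<omega>))"
      by (simp add: comp_def)
  qed (use int integrable_iexp_finite[of Z] in auto)
  also have "\<dots> = exp (v / 2) *\<^sub>R (iexp (a * v) * exp (- a\<^sup>2 * v / 2)) * exp (- (cov Y Y - a\<^sup>2 * v) / 2)"
    unfolding exp_iexp_self[OF X] char_G[OF Z] cZ v_def ..
  also have "\<dots> = exp (v / 2) *\<^sub>R (iexp (a * v) * complex_of_real (exp (- a\<^sup>2 * v / 2) * exp (- (cov Y Y - a\<^sup>2 * v) / 2)))"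
    by simp
  also have "exp (- a\<^sup>2 * v / 2) * exp (- (cov Y Y - a\<^sup>2 * v) / 2) = exp (- cov Y Y / 2)"
    by (simp add: mult_exp_exp field_simps)
  also have "a * v = cov X Y" using False by (simp add: a_def v_def)
  finally show ?thesis by (simp add: v_def)
qed

end

text \<open>Continuity from above passes from finite to countable index sets. Continuous paths are
  governed by rational times, so this is as far as the Gaussian estimates have to reach.\<close>

lemma (in prob_space) prob_countable_ball_ge:
  assumes I: "countable I" and meas: "\<And>i. i \<in> I \<Longrightarrow> {\<omega> \<in> space M. Q i \<omega>} \<in> events"
    and ge: "\<And>J. finite J \<Longrightarrow> J \<subseteq> I \<Longrightarrow> c \<le> prob {\<omega> \<in> space M. \<forall>i\<in>J. Q i \<omega>}"
  shows "c \<le> prob {\<omega> \<in> space M. \<forall>i\<in>I. Q i \<omega>}"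
proof (cases "I = {}")
  case True
  then show ?thesis using ge[of "{}"] by simp
next
  case False
  define J where "J n = from_nat_into I ` {..n::nat}" for n
  have J: "finite (J n)" "J n \<subseteq> I" for n
    using from_nat_into[OF False] by (auto simp: J_def)
  have I_eq: "(\<Union>n. J n) = I"
  proof
    show "I \<subseteq> (\<Union>n. J n)"
    proof
      fix i assume "i \<in> I"
      then obtain n where "i = from_nat_into I n" using range_from_nat_into[OF False I] by blast
      then show "i \<in> (\<Union>n. J n)" by (auto simp: J_def)
    qed
  qed (use J in auto)
  have "(\<lambda>n. prob {\<omega> \<in> space M. \<forall>i\<in>J n. Q i \<omega>}) \<longlonglongrightarrow> prob (\<Inter>n. {\<omega> \<in> space M. \<forall>i\<in>J n. Q i \<omega>})"
  proof (rule finite_Lim_measure_decseq)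
    show "range (\<lambda>n. {\<omega> \<in> space M. \<forall>i\<in>J n. Q i \<omega>}) \<subseteq> events"
      using J meas by (auto intro!: sets.sets_Collect_finite_All)
    show "decseq (\<lambda>n. {\<omega> \<in> space M. \<forall>i\<in>J n. Q i \<omega>})"
      by (auto simp: decseq_def J_def)
  qed
  moreover have "(\<Inter>n. {\<omega> \<in> space M. \<forall>i\<in>J n. Q i \<omega>}) = {\<omega> \<in> space M. \<forall>i\<in>I. Q i \<omega>}"
    unfolding I_eq[symmetric] by auto
  ultimately show ?thesis
    using ge[OF J] by (metis (no_types, lifting) LIMSEQ_le_const)
qed

section \<open>Cameron--Martin shifts and Fernique's tail bound\<close>

context gaussian_space
begin

text \<open>Under the measure with density \<open>exp (\<xi> - cov \<xi> \<xi> / 2)\<close> every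
  linear combination \<eta> has the characteristic function of \<eta> translated by
  \<open>cov \<xi> \<eta>\<close>. Equality on boxes follows from uniqueness.\<close>

lemma cameron_martin_box:
  assumes I: "finite I" and X: "\<And>i. i \<in> I \<Longrightarrow> X i \<in> G" and \<xi>: "\<xi> \<in> G"
    and A: "\<And>i. i \<in> I \<Longrightarrow> A i \<in> sets borel"
  shows "expectation (\<lambda>\<omega>. exp (\<xi> \<omega> - cov \<xi> \<xi> / 2) * indicator {\<omega> \<in> space M. \<forall>i\<in>I. X i \<omega> \<in> A i} \<omega>)
       = prob {\<omega> \<in> space M. \<forall>i\<in>I. X i \<omega> + cov \<xi> (X i) \<in> A i}"
proof -
  define v where "v = cov \<xi> \<xi>"
  have [measurable]: "\<xi> \<in> borel_measurable M" using \<xi> by measurable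
  have meas [measurable]: "X i \<in> borel_measurable M" "A i \<in> sets borel" if "i \<in> I" for i
    using X that A by auto
  have [measurable]: "{\<omega> \<in> space M. \<forall>i\<in>I. X i \<omega> \<in> A i} \<in> events"
    using I by measurable
  define M' where "M' = density M (\<lambda>\<omega>. ennreal (exp (\<xi> \<omega> - v / 2)))"
  have int: "integrable M (\<lambda>\<omega>. exp (\<xi> \<omega> - v / 2))"
    using exp_moment(1)[OF \<xi>] by (simp add: exp_diff)
  have em: "emeasure M' B = ennreal (expectation (\<lambda>\<omega>. exp (\<xi> \<omega> - v / 2) * indicator B \<omega>))"
    if [measurable]: "B \<in> events" for B
  proof -
    have "emeasure M' B = (\<integral>\<^sup>+\<omega>. ennreal (exp (\<xi> \<omega> - v / 2) * indicator B \<omega>) \<partial>M)"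
      unfolding M'_def by (subst emeasure_density) (auto intro!: nn_integral_cong simp: indicator_def)
    also have "\<dots> = ennreal (expectation (\<lambda>\<omega>. exp (\<xi> \<omega> - v / 2) * indicator B \<omega>))"
      by (intro nn_integral_eq_integral integrable_real_mult_indicator int) auto
    finally show ?thesis .
  qed
  have "finite_measure M'"
    by (intro finite_measureI) (use em[of "space M"] in \<open>auto simp: M'_def\<close>)
  have "measure M' {\<omega> \<in> space M'. \<forall>i\<in>I. X i \<omega> \<in> A i} = prob {\<omega> \<in> space M. \<forall>i\<in>I. X i \<omega> + cov \<xi> (X i) \<in> A i}"
  proof (rule measure_box_eq_of_char_eq[OF I])
    fix u :: "'b \<Rightarrow> real"
    define \<eta> where "\<eta> \<omega> = (\<Sum>i\<in>I. u i * X i \<omega>)" for \<omega>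
    have \<eta>: "\<eta> \<in> G" unfolding \<eta>_def[abs_def] using I X by (rule sum)
    have [measurable]: "\<eta> \<in> borel_measurable M" using \<eta> by measurable
    have c: "cov \<xi> \<eta> = (\<Sum>i\<in>I. u i * cov \<xi> (X i))"
      unfolding \<eta>_def[abs_def] using I X \<xi> by (rule cov_sum_right)
    have "(\<integral>\<omega>. iexp (\<eta> \<omega>) \<partial>M') = (\<integral>\<omega>. exp (- v / 2) *\<^sub>R (exp (\<xi> \<omega>) *\<^sub>R iexp (\<eta> \<omega>)) \<partial>M)"
    proof -
      have "exp (\<xi> \<omega> - v / 2) = exp (- v / 2) * exp (\<xi> \<omega>)" for \<omega> by (simp add: mult_exp_exp)
      then show ?thesis unfolding M'_def by (subst integral_density) simp_all
    qed
    also have "\<dots> = iexp (cov \<xi> \<eta>) * exp (- cov \<eta> \<eta> / 2)"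
      unfolding integral_scaleR_right exp_iexp_moment[OF \<xi> \<eta>]
      unfolding scaleR_scaleR by (simp add: v_def mult_exp_exp)
    also have "\<dots> = (\<integral>\<omega>. iexp (cov \<xi> \<eta>) * iexp (\<eta> \<omega>) \<partial>M)"
      using char_G[OF \<eta>] by simp
    also have "\<dots> = (\<integral>\<omega>. iexp (\<Sum>i\<in>I. u i * (X i \<omega> + cov \<xi> (X i))) \<partial>M)"
      by (simp add: c \<eta>_def exp_add[symmetric] distrib_left sum.distrib add.commute)
    finally show "(\<integral>\<omega>. iexp (\<Sum>i\<in>I. u i * X i \<omega>) \<partial>M') = (\<integral>\<omega>. iexp (\<Sum>i\<in>I. u i * (X i \<omega> + cov \<xi> (X i))) \<partial>M)"
      by (simp add: \<eta>_def)
  qed (auto simp: M'_def intro: \<open>finite_measure M'\<close>[unfolded M'_def] finite_measure_axioms)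
  then show ?thesis
    using em[of "{\<omega> \<in> space M. \<forall>i\<in>I. X i \<omega> \<in> A i}"] by (simp add: measure_def M'_def v_def)
qed

lemma symmetric_box:
  assumes I: "finite I" and X: "\<And>i. i \<in> I \<Longrightarrow> X i \<in> G" and A: "\<And>i. i \<in> I \<Longrightarrow> A i \<in> sets borel"
  shows "prob {\<omega> \<in> space M. \<forall>i\<in>I. X i \<omega> \<in> A i} = prob {\<omega> \<in> space M. \<forall>i\<in>I. - X i \<omega> \<in> A i}"
proof (rule measure_box_eq_of_char_eq[OF I])
  fix u :: "'b \<Rightarrow> real"
  define \<eta> where "\<eta> \<omega> = (\<Sum>i\<in>I. u i * X i \<omega>)" for \<omega>
  have \<eta>: "\<eta> \<in> G" unfolding \<eta>_def[abs_def] using I X by (rule sum)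
  have "(\<integral>\<omega>. iexp ((-1) * \<eta> \<omega>) \<partial>M) = (\<integral>\<omega>. iexp (\<eta> \<omega>) \<partial>M)"
    using char_G[OF \<eta>] char_G[OF scale[OF \<eta>, of "-1"]] by (simp only: cov_scale_left cov_scale_right) simp
  moreover have "(-1) * \<eta> \<omega> = (\<Sum>i\<in>I. u i * - X i \<omega>)" for \<omega>
    by (simp add: \<eta>_def sum_negf)
  ultimately show "(\<integral>\<omega>. iexp (\<Sum>i\<in>I. u i * X i \<omega>) \<partial>M) = (\<integral>\<omega>. iexp (\<Sum>i\<in>I. u i * - X i \<omega>) \<partial>M)"
    by (simp only: \<eta>_def)
qed (use X A in \<open>auto intro: finite_measure_axioms\<close>)

text \<open>By symmetry the shifts by \<open>\<xi>\<close> and \<open>- \<xi>\<close> give the same probability; averaging the two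
  densities produces \<open>cosh \<xi> \<ge> 1\<close>.\<close>

lemma shifted_box_ge_finite:
  assumes I: "finite I" and X: "\<And>i. i \<in> I \<Longrightarrow> X i \<in> G" and \<xi>: "\<xi> \<in> G"
  shows "exp (- cov \<xi> \<xi> / 2) * prob {\<omega> \<in> space M. \<forall>i\<in>I. \<bar>X i \<omega>\<bar> \<le> k i}
       \<le> prob {\<omega> \<in> space M. \<forall>i\<in>I. \<bar>X i \<omega> - cov \<xi> (X i)\<bar> \<le> k i}"
proof -
  define v where "v = cov \<xi> \<xi>"
  define c where "c i = cov \<xi> (X i)" for i
  define K where "K = {\<omega> \<in> space M. \<forall>i\<in>I. X i \<omega> \<in> {x. \<bar>x\<bar> \<le> k i}}"
  have [measurable]: "\<xi> \<in> borel_measurable M" using \<xi> by measurable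
  have meas [measurable]: "X i \<in> borel_measurable M" if "i \<in> I" for i
    using X that by auto
  have [measurable]: "K \<in> events" unfolding K_def using I by measurable
  let ?p = "prob {\<omega> \<in> space M. \<forall>i\<in>I. \<bar>X i \<omega> - c i\<bar> \<le> k i}"
  have m\<xi>: "(\<lambda>\<omega>. (-1) * \<xi> \<omega>) \<in> G" using scale[OF \<xi>] .
  have 1: "expectation (\<lambda>\<omega>. exp (\<xi> \<omega> - v / 2) * indicator K \<omega>) = ?p"
  proof -
    have "expectation (\<lambda>\<omega>. exp (\<xi> \<omega> - v / 2) * indicator K \<omega>) = prob {\<omega> \<in> space M. \<forall>i\<in>I. X i \<omega> \<in> {x. \<bar>x + c i\<bar> \<le> k i}}"
      unfolding v_def K_def c_def using I X \<xi> by (subst cameron_martin_box) auto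
    also have "\<dots> = prob {\<omega> \<in> space M. \<forall>i\<in>I. - X i \<omega> \<in> {x. \<bar>x + c i\<bar> \<le> k i}}"
      using I X by (rule symmetric_box) auto
    also have "\<dots> = ?p" by (simp add: abs_minus_commute)
    finally show ?thesis .
  qed
  have 2: "expectation (\<lambda>\<omega>. exp (- \<xi> \<omega> - v / 2) * indicator K \<omega>) = ?p"
    using cameron_martin_box[OF I X m\<xi>, where A = "\<lambda>i. {x. \<bar>x\<bar> \<le> k i}"]
    by (simp only: cov_scale_left cov_scale_right) (simp add: v_def K_def c_def)
  have i1: "integrable M (\<lambda>\<omega>. exp (\<xi> \<omega> - v / 2) * indicator K \<omega>)"
    using exp_moment(1)[OF \<xi>] by (intro integrable_real_mult_indicator) (auto simp: exp_diff)
  have i2: "integrable M (\<lambda>\<omega>. exp (- \<xi> \<omega> - v / 2) * indicator K \<omega>)"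
    using exp_moment(1)[OF m\<xi>] by (intro integrable_real_mult_indicator) (auto simp: exp_diff)
  have "2 * (exp (- v / 2) * prob K) = expectation (\<lambda>\<omega>. 2 * exp (- v / 2) * indicator K \<omega>)"
    by simp
  also have "\<dots> \<le> expectation (\<lambda>\<omega>. exp (\<xi> \<omega> - v / 2) * indicator K \<omega> + exp (- \<xi> \<omega> - v / 2) * indicator K \<omega>)"
  proof (rule integral_mono)
    fix \<omega>
    have "2 \<le> exp x + exp (- x)" for x :: real
    proof -
      have "0 \<le> (exp (x / 2) - exp (- x / 2))\<^sup>2" by simp
      also have "\<dots> = exp x + exp (- x) - 2"
        by (simp add: power2_eq_square algebra_simps mult_exp_exp)
      finally show ?thesis by simp
    qed
    from mult_right_mono[OF this[of "\<xi> \<omega>"], of "exp (- v / 2)"]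
    show "2 * exp (- v / 2) * indicator K \<omega> \<le> exp (\<xi> \<omega> - v / 2) * indicator K \<omega> + exp (- \<xi> \<omega> - v / 2) * indicator K \<omega>"
      by (auto simp: indicator_def distrib_right mult_exp_exp)
  qed (use i1 i2 in \<open>auto simp: emeasure_eq_measure\<close>)
  also have "\<dots> = ?p + ?p" using i1 i2 1 2 by (subst Bochner_Integration.integral_add) auto
  finally show ?thesis by (simp add: v_def c_def K_def)
qed

lemma shifted_box_ge:
  assumes I: "countable I" and X: "\<And>i. i \<in> I \<Longrightarrow> X i \<in> G" and \<xi>: "\<xi> \<in> G"
  shows "exp (- cov \<xi> \<xi> / 2) * prob {\<omega> \<in> space M. \<forall>i\<in>I. \<bar>X i \<omega>\<bar> \<le> k i}
       \<le> prob {\<omega> \<in> space M. \<forall>i\<in>I. \<bar>X i \<omega> - cov \<xi> (X i)\<bar> \<le> k i}"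
proof (rule prob_countable_ball_ge[OF I])
  have meas [measurable]: "X i \<in> borel_measurable M" if "i \<in> I" for i using X that by auto
  show "{\<omega> \<in> space M. \<bar>X i \<omega> - cov \<xi> (X i)\<bar> \<le> k i} \<in> events" if "i \<in> I" for i
    using that by measurable
  fix J assume J: "finite J" "J \<subseteq> I"
  have [measurable]: "{\<omega> \<in> space M. \<forall>i\<in>J. \<bar>X i \<omega>\<bar> \<le> k i} \<in> events"
    using J meas by (intro sets.sets_Collect_finite_All) auto
  have "prob {\<omega> \<in> space M. \<forall>i\<in>I. \<bar>X i \<omega>\<bar> \<le> k i} \<le> prob {\<omega> \<in> space M. \<forall>i\<in>J. \<bar>X i \<omega>\<bar> \<le> k i}"
    using J by (intro finite_measure_mono) auto
  then have "exp (- cov \<xi> \<xi> / 2) * prob {\<omega> \<in> space M. \<forall>i\<in>I. \<bar>X i \<omega>\<bar> \<le> k i}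
     \<le> exp (- cov \<xi> \<xi> / 2) * prob {\<omega> \<in> space M. \<forall>i\<in>J. \<bar>X i \<omega>\<bar> \<le> k i}"
    by (intro mult_left_mono) auto
  also have "\<dots> \<le> prob {\<omega> \<in> space M. \<forall>i\<in>J. \<bar>X i \<omega> - cov \<xi> (X i)\<bar> \<le> k i}"
    using J X \<xi> by (intro shifted_box_ge_finite) auto
  finally show "exp (- cov \<xi> \<xi> / 2) * prob {\<omega> \<in> space M. \<forall>i\<in>I. \<bar>X i \<omega>\<bar> \<le> k i}
     \<le> prob {\<omega> \<in> space M. \<forall>i\<in>J. \<bar>X i \<omega> - cov \<xi> (X i)\<bar> \<le> k i}" .
qed

text \<open>The left-hand side is a rotation of two independent copies, which preserves a centred
  Gaussian law.\<close>

lemma rotated_box: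
  assumes I: "finite I" and X: "\<And>i. i \<in> I \<Longrightarrow> X i \<in> G"
    and A: "\<And>i. i \<in> I \<Longrightarrow> A i \<in> sets borel" and B: "\<And>i. i \<in> I \<Longrightarrow> B i \<in> sets borel"
  shows "measure (M \<Otimes>\<^sub>M M) {p \<in> space (M \<Otimes>\<^sub>M M). \<forall>i\<in>I. (X i (fst p) - X i (snd p)) / sqrt 2 \<in> A i \<and> (X i (fst p) + X i (snd p)) / sqrt 2 \<in> B i}
       = prob {\<omega> \<in> space M. \<forall>i\<in>I. X i \<omega> \<in> A i} * prob {\<omega> \<in> space M. \<forall>i\<in>I. X i \<omega> \<in> B i}"
proof -
  interpret P: pair_prob_space M M ..
  have meas [measurable]: "X i \<in> borel_measurable M" "A i \<in> sets borel" "B i \<in> sets borel" if "i \<in> I" for i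
    using X A B that by auto
  define S where "S = (UNIV :: bool set) \<times> I"
  define Y where "Y = (\<lambda>(b, i) p. (if b then X i (fst p) - X i (snd p) else X i (fst p) + X i (snd p)) / sqrt 2)"
  define Z where "Z = (\<lambda>(b, i) p. if b then X i (fst p) else X i (snd p))"
  define C where "C = (\<lambda>(b, i). if b then A i else B i)"
  have sumS: "(\<Sum>q\<in>S. f q) = (\<Sum>i\<in>I. f (True, i)) + (\<Sum>i\<in>I. f (False, i))" for f :: "bool \<times> 'b \<Rightarrow> real"
    unfolding S_def by (simp add: sum.cartesian_product' UNIV_bool)
  have ballS: "(\<forall>q\<in>S. P q) \<longleftrightarrow> (\<forall>i\<in>I. P (True, i) \<and> P (False, i))" for P
    unfolding S_def UNIV_bool by blast
  have "measure (M \<Otimes>\<^sub>M M) {p \<in> space (M \<Otimes>\<^sub>M M). \<forall>q\<in>S. Y q p \<in> C q} = measure (M \<Otimes>\<^sub>M M) {p \<in> space (M \<Otimes>\<^sub>M M). \<forall>q\<in>S. Z q p \<in> C q}"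
  proof (rule measure_box_eq_of_char_eq)
    show "finite S" using I by (simp add: S_def)
    fix u :: "bool \<times> 'b \<Rightarrow> real"
    define \<alpha> \<beta> where "\<alpha> \<omega> = (\<Sum>i\<in>I. u (True, i) * X i \<omega>)" and "\<beta> \<omega> = (\<Sum>i\<in>I. u (False, i) * X i \<omega>)" for \<omega>
    have G: "\<alpha> \<in> G" "\<beta> \<in> G" unfolding \<alpha>_def[abs_def] \<beta>_def[abs_def] using I X by (auto intro!: sum)
    \<comment> \<open>Rotating the two copies amounts to the transposed rotation of the coefficient
      combinations; the sum of the two variances is unchanged.\<close>
    define \<alpha>' \<beta>' where "\<alpha>' \<omega> = (1 / sqrt 2) * (\<alpha> \<omega> + \<beta> \<omega>)" and "\<beta>' \<omega> = (1 / sqrt 2) * (\<beta> \<omega> - \<alpha> \<omega>)" for \<omega>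
    have G': "\<alpha>' \<in> G" "\<beta>' \<in> G" unfolding \<alpha>'_def[abs_def] \<beta>'_def[abs_def]
      by (rule scale[OF add[OF G]], rule scale[OF diff[OF G(2,1)]])
    have "cov \<alpha>' \<alpha>' + cov \<beta>' \<beta>' = cov \<alpha> \<alpha> + cov \<beta> \<beta>"
      unfolding \<alpha>'_def[abs_def] \<beta>'_def[abs_def] cov_scale_left cov_scale_right
      using G by (simp add: cov_add_left cov_add_right cov_diff_left cov_diff_right add diff cov_commute[of \<beta> \<alpha>])
         (simp add: field_simps)
    then have "(\<integral>p. iexp (\<alpha>' (fst p) + \<beta>' (snd p)) \<partial>(M \<Otimes>\<^sub>M M)) = (\<integral>p. iexp (\<alpha> (fst p) + \<beta> (snd p)) \<partial>(M \<Otimes>\<^sub>M M))"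
      using char_prod[OF G] char_prod[OF G'] by simp
    moreover have "(\<Sum>q\<in>S. u q * Y q p) = \<alpha>' (fst p) + \<beta>' (snd p)" for p
      unfolding sumS Y_def \<alpha>'_def \<beta>'_def \<alpha>_def \<beta>_def
      by (simp add: sum_distrib_left[symmetric] sum_divide_distrib[symmetric] right_diff_distrib distrib_left sum.distrib sum_subtractf add_divide_distrib diff_divide_distrib)
    moreover have "(\<Sum>q\<in>S. u q * Z q p) = \<alpha> (fst p) + \<beta> (snd p)" for p
      unfolding sumS Z_def \<alpha>_def \<beta>_def by simp
    ultimately show "(\<integral>p. iexp (\<Sum>q\<in>S. u q * Y q p) \<partial>(M \<Otimes>\<^sub>M M)) = (\<integral>p. iexp (\<Sum>q\<in>S. u q * Z q p) \<partial>(M \<Otimes>\<^sub>M M))"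
      by simp
  qed (auto simp: S_def Y_def Z_def C_def intro: P.P.finite_measure_axioms)
  also have "{p \<in> space (M \<Otimes>\<^sub>M M). \<forall>q\<in>S. Z q p \<in> C q} = {\<omega> \<in> space M. \<forall>i\<in>I. X i \<omega> \<in> A i} \<times> {\<omega> \<in> space M. \<forall>i\<in>I. X i \<omega> \<in> B i}"
    unfolding ballS by (auto simp: space_pair_measure Z_def C_def)
  also have "measure (M \<Otimes>\<^sub>M M) \<dots> = prob {\<omega> \<in> space M. \<forall>i\<in>I. X i \<omega> \<in> A i} * prob {\<omega> \<in> space M. \<forall>i\<in>I. X i \<omega> \<in> B i}"
  proof -
    have "{\<omega> \<in> space M. \<forall>i\<in>I. X i \<omega> \<in> A i} \<in> events" "{\<omega> \<in> space M. \<forall>i\<in>I. X i \<omega> \<in> B i} \<in> events"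
      using I by measurable
    then show ?thesis by (simp add: measure_def emeasure_pair_measure_Times enn2real_mult)
  qed
  also have "{p \<in> space (M \<Otimes>\<^sub>M M). \<forall>q\<in>S. Y q p \<in> C q} = {p \<in> space (M \<Otimes>\<^sub>M M). \<forall>i\<in>I. (X i (fst p) - X i (snd p)) / sqrt 2 \<in> A i \<and> (X i (fst p) + X i (snd p)) / sqrt 2 \<in> B i}"
    unfolding ballS by (simp add: Y_def C_def)
  finally show ?thesis .
qed

text \<open>After rotation the left side is the probability that all differences stay within
  \<open>s\<close> while some sum exceeds \<open>t\<close>, both divided by \<open>sqrt 2\<close>.
  At such an index both independent copies exceed \<open>(t - s) / sqrt 2\<close>, an event
  contained in a product, hence the square.\<close>

lemma fernique_step:
  assumes I: "finite I" and X: "\<And>i. i \<in> I \<Longrightarrow> X i \<in> G"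
  shows "prob {\<omega> \<in> space M. \<forall>i\<in>I. \<bar>X i \<omega>\<bar> \<le> s} * prob {\<omega> \<in> space M. \<exists>i\<in>I. \<bar>X i \<omega>\<bar> > t}
       \<le> (prob {\<omega> \<in> space M. \<exists>i\<in>I. \<bar>X i \<omega>\<bar> > (t - s) / sqrt 2})\<^sup>2"
proof -
  interpret P: pair_prob_space M M ..
  have meas [measurable]: "X i \<in> borel_measurable M" if "i \<in> I" for i
    using X that by auto
  define Q where "Q = {\<omega> \<in> space M. \<exists>i\<in>I. \<bar>X i \<omega>\<bar> > (t - s) / sqrt 2}"
  define E where "E B = {p \<in> space (M \<Otimes>\<^sub>M M). \<forall>i\<in>I. (X i (fst p) - X i (snd p)) / sqrt 2 \<in> {-s..s} \<and> (X i (fst p) + X i (snd p)) / sqrt 2 \<in> B}" for B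
  have [measurable]: "Q \<in> events" unfolding Q_def using I by measurable
  have E_sets [measurable]: "E B \<in> sets (M \<Otimes>\<^sub>M M)" if [measurable]: "B \<in> sets borel" for B
    unfolding E_def using I by measurable
  have all: "prob {\<omega> \<in> space M. \<exists>i\<in>I. \<bar>X i \<omega>\<bar> > t} = 1 - prob {\<omega> \<in> space M. \<forall>i\<in>I. X i \<omega> \<in> {-t..t}}"
  proof -
    have "{\<omega> \<in> space M. \<forall>i\<in>I. X i \<omega> \<in> {-t..t}} \<in> events" using I by measurable
    moreover have "{\<omega> \<in> space M. \<exists>i\<in>I. \<bar>X i \<omega>\<bar> > t} = space M - {\<omega> \<in> space M. \<forall>i\<in>I. X i \<omega> \<in> {-t..t}}"
    proof -
      have "x \<in> {-t..t} \<longleftrightarrow> \<not> t < \<bar>x\<bar>" for x by auto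
      then show ?thesis by (auto simp del: atLeastAtMost_iff)
    qed
    ultimately show ?thesis using prob_compl by simp
  qed
  have "prob {\<omega> \<in> space M. \<forall>i\<in>I. \<bar>X i \<omega>\<bar> \<le> s} * prob {\<omega> \<in> space M. \<exists>i\<in>I. \<bar>X i \<omega>\<bar> > t}
      = measure (M \<Otimes>\<^sub>M M) (E UNIV) - measure (M \<Otimes>\<^sub>M M) (E {-t..t})"
  proof -
    have eq: "{\<omega> \<in> space M. \<forall>i\<in>I. \<bar>X i \<omega>\<bar> \<le> s} = {\<omega> \<in> space M. \<forall>i\<in>I. X i \<omega> \<in> {-s..s}}"
      by (auto simp: abs_le_iff)
    have "measure (M \<Otimes>\<^sub>M M) (E B) = prob {\<omega> \<in> space M. \<forall>i\<in>I. X i \<omega> \<in> {-s..s}} * prob {\<omega> \<in> space M. \<forall>i\<in>I. X i \<omega> \<in> B}"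
      if "B \<in> sets borel" for B
      unfolding E_def by (rule rotated_box[OF I X]) (use that in auto)
    from this[of UNIV] this[of "{-t..t}"] show ?thesis
      unfolding all eq by (simp add: right_diff_distrib prob_space)
  qed
  also have "\<dots> = measure (M \<Otimes>\<^sub>M M) (E UNIV - E {-t..t})"
  proof (rule P.P.finite_measure_Diff[symmetric])
    show "E {-t..t} \<subseteq> E UNIV" by (auto simp: E_def)
  qed (auto intro: E_sets)
  also have "\<dots> \<le> measure (M \<Otimes>\<^sub>M M) (Q \<times> Q)"
  proof (rule P.P.finite_measure_mono)
    show "E UNIV - E {-t..t} \<subseteq> Q \<times> Q"
    proof
      fix p assume p: "p \<in> E UNIV - E {-t..t}"
      then obtain i where i: "i \<in> I" "(X i (fst p) + X i (snd p)) / sqrt 2 \<notin> {-t..t}"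
        by (auto simp: E_def)
      define a b where "a = X i (fst p) / sqrt 2" and "b = X i (snd p) / sqrt 2"
      \<comment> \<open>Both \<open>2 * \<bar>a\<bar>\<close> and \<open>2 * \<bar>b\<bar>\<close>
        are at least \<open>\<bar>a + b\<bar> - \<bar>a - b\<bar>\<close>, which exceeds
        \<open>t - s\<close>.\<close>
      have "a + b \<notin> {-t..t}" "a - b \<in> {-s..s}"
        using p i by (auto simp: E_def a_def b_def add_divide_distrib diff_divide_distrib)
      then have "(t - s) / 2 < \<bar>a\<bar>" "(t - s) / 2 < \<bar>b\<bar>" by (auto simp: abs_if)
      then have "(t - s) / 2 * sqrt 2 < \<bar>a\<bar> * sqrt 2" "(t - s) / 2 * sqrt 2 < \<bar>b\<bar> * sqrt 2"
        by (intro mult_strict_right_mono; simp)+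
      moreover have "(t - s) / sqrt 2 = (t - s) / 2 * sqrt 2"
        by (simp add: divide_eq_eq mult.assoc)
      moreover have "\<bar>X i (fst p)\<bar> = \<bar>a\<bar> * sqrt 2" "\<bar>X i (snd p)\<bar> = \<bar>b\<bar> * sqrt 2"
        by (simp_all add: a_def b_def abs_divide)
      ultimately have "(t - s) / sqrt 2 < \<bar>X i (fst p)\<bar>" "(t - s) / sqrt 2 < \<bar>X i (snd p)\<bar>"
        by (simp_all only:)
      then show "p \<in> Q \<times> Q" using p i by (cases p) (auto simp: Q_def E_def space_pair_measure)
    qed
  qed measurable
  also have "\<dots> = (prob Q)\<^sup>2"
    by (simp add: measure_def emeasure_pair_measure_Times enn2real_mult power2_eq_square)
  finally show ?thesis unfolding Q_def .
qed

text \<open>Dividing the exceedance probability by \<open>r\<close> turns the step into plain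
  squaring when the level is tripled, since \<open>(3 * y - s) / sqrt 2 \<ge> y\<close> for
  \<open>y \<ge> s\<close>. The start is \<open>(1 - r) / r \<le> 1/3\<close>, which explains the
  threshold \<open>3/4\<close>. At level \<open>x = 3 ^ n\<close> the exponent \<open>2 ^ n\<close>
  is \<open>x powr log 3 2\<close>: a stretched exponential tail, enough for summability.\<close>

lemma fernique_tail:
  assumes I: "countable I" and X: "\<And>i. i \<in> I \<Longrightarrow> X i \<in> G" and s: "0 \<le> s"
    and p: "3/4 \<le> prob {\<omega> \<in> space M. \<forall>i\<in>I. \<bar>X i \<omega>\<bar> \<le> s}"
  shows "1 - (1/3) ^ (2 ^ n) \<le> prob {\<omega> \<in> space M. \<forall>i\<in>I. \<bar>X i \<omega>\<bar> \<le> 3 ^ n * s}"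
proof (rule prob_countable_ball_ge[OF I])
  have meas [measurable]: "X i \<in> borel_measurable M" if "i \<in> I" for i using X that by auto
  show "{\<omega> \<in> space M. \<bar>X i \<omega>\<bar> \<le> 3 ^ n * s} \<in> events" if "i \<in> I" for i using that by measurable
  fix J assume J: "finite J" "J \<subseteq> I"
  then have measJ [measurable]: "X i \<in> borel_measurable M" if "i \<in> J" for i using that meas by auto
  define q where "q t = prob {\<omega> \<in> space M. \<exists>i\<in>J. \<bar>X i \<omega>\<bar> > t}" for t
  have ball [measurable]: "{\<omega> \<in> space M. \<forall>i\<in>J. \<bar>X i \<omega>\<bar> \<le> t} \<in> events" for t using J(1) by measurable
  have q_eq: "q t = 1 - prob {\<omega> \<in> space M. \<forall>i\<in>J. \<bar>X i \<omega>\<bar> \<le> t}" for t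
  proof -
    have "{\<omega> \<in> space M. \<exists>i\<in>J. \<bar>X i \<omega>\<bar> > t} = space M - {\<omega> \<in> space M. \<forall>i\<in>J. \<bar>X i \<omega>\<bar> \<le> t}"
      by (auto simp: not_le)
    then show ?thesis using prob_compl[OF ball[of t]] by (simp add: q_def)
  qed
  define r where "r = prob {\<omega> \<in> space M. \<forall>i\<in>J. \<bar>X i \<omega>\<bar> \<le> s}"
  have r: "3/4 \<le> r" "r \<le> 1"
  proof -
    have "prob {\<omega> \<in> space M. \<forall>i\<in>I. \<bar>X i \<omega>\<bar> \<le> s} \<le> r"
      unfolding r_def using J by (intro finite_measure_mono) auto
    then show "3/4 \<le> r" using p by simp
  qed (simp add: r_def)
  have mono: "q t \<le> q t'" if "t' \<le> t" for t t'
  proof -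
    have "{\<omega> \<in> space M. \<exists>i\<in>J. \<bar>X i \<omega>\<bar> > t'} \<in> events" using J(1) by measurable
    then show ?thesis unfolding q_def using that by (intro finite_measure_mono) force+
  qed
  have "q (3 ^ n * s) / r \<le> (1/3) ^ (2 ^ n)"
  proof (induction n)
    case 0
    have "q s = 1 - r" by (simp add: q_eq r_def)
    then show ?case using r by (simp add: field_simps)
  next
    case (Suc n)
    have "r * q (3 ^ Suc n * s) \<le> (q ((3 ^ Suc n * s - s) / sqrt 2))\<^sup>2"
      unfolding r_def q_def using J X by (intro fernique_step) auto
    also have "\<dots> \<le> (q (3 ^ n * s))\<^sup>2"
    proof (intro power_mono mono)
      have "sqrt 2 \<le> (2::real)" by (rule real_le_lsqrt) auto
      define y where "y = 3 ^ n * s"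
      have "1 * s \<le> y" unfolding y_def using s by (intro mult_right_mono) auto
      moreover have "y * sqrt 2 \<le> y * 2"
        using \<open>sqrt 2 \<le> 2\<close> s by (intro mult_left_mono) (auto simp: y_def)
      ultimately have "y * sqrt 2 \<le> 3 * y - s" by linarith
      then show "3 ^ n * s \<le> (3 ^ Suc n * s - s) / sqrt 2"
        by (simp add: y_def pos_le_divide_eq mult.assoc)
    qed (simp add: q_def)
    finally have "q (3 ^ Suc n * s) / r \<le> (q (3 ^ n * s) / r)\<^sup>2"
      using r by (simp add: field_simps power2_eq_square)
    also have "\<dots> \<le> ((1/3) ^ (2 ^ n))\<^sup>2"
      using Suc r by (intro power_mono) (auto simp: q_def)
    also have "\<dots> = (1/3) ^ (2 ^ Suc n)" by (simp add: power_mult[symmetric] mult.commute)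
    finally show ?case .
  qed
  moreover have "q (3 ^ n * s) \<le> q (3 ^ n * s) / r"
    using r by (simp add: q_def pos_le_divide_eq mult_left_le)
  ultimately show "1 - (1/3) ^ (2 ^ n) \<le> prob {\<omega> \<in> space M. \<forall>i\<in>J. \<bar>X i \<omega>\<bar> \<le> 3 ^ n * s}"
    unfolding q_eq by linarith
qed

end

section \<open>Gaussian processes with stationary increments\<close>

lemma (in gaussian_space) cov_square_le:
  assumes X: "X \<in> G" and Y: "Y \<in> G"
  shows "(cov X Y)\<^sup>2 \<le> cov X X * cov Y Y"
proof (cases "cov Y Y = 0")
  case True
  then have "AE \<omega> in M. Y \<omega> = 0" by (cases rule: cases_G[OF Y]) auto
  then have "cov X Y = expectation (\<lambda>_. 0)"
    unfolding cov_def using X Y by (intro integral_cong_AE) auto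
  then show ?thesis using True by simp
next
  case False
  then have pos: "cov Y Y > 0" using cov_nonneg[of Y] by simp
  define a where "a = cov X Y / cov Y Y"
  have aY: "(\<lambda>\<omega>. a * Y \<omega>) \<in> G" using scale[OF Y] .
  have "0 \<le> cov (\<lambda>\<omega>. X \<omega> - a * Y \<omega>) (\<lambda>\<omega>. X \<omega> - a * Y \<omega>)" by (rule cov_nonneg)
  also have "\<dots> = cov X X - 2 * a * cov X Y + a * a * cov Y Y"
    using X Y aY diff[OF X aY]
    by (simp add: cov_diff_left cov_diff_right cov_scale_left cov_scale_right cov_commute[of Y X] algebra_simps)
  also have "\<dots> = cov X X - (cov X Y)\<^sup>2 / cov Y Y"
    using pos by (simp add: a_def power2_eq_square)
  finally show ?thesis using pos by (simp add: field_simps)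
qed

lemma (in gaussian_space) sqrt_cov_triangle:
  assumes X: "X \<in> G" and Y: "Y \<in> G"
  shows "sqrt (cov (\<lambda>\<omega>. X \<omega> + Y \<omega>) (\<lambda>\<omega>. X \<omega> + Y \<omega>)) \<le> sqrt (cov X X) + sqrt (cov Y Y)"
proof (rule real_le_lsqrt)
  have "cov X Y \<le> sqrt (cov X X * cov Y Y)"
    using cov_square_le[OF X Y] by (intro real_le_rsqrt)
  moreover have "cov (\<lambda>\<omega>. X \<omega> + Y \<omega>) (\<lambda>\<omega>. X \<omega> + Y \<omega>) = cov X X + 2 * cov X Y + cov Y Y"
    using X Y add[OF X Y] by (simp add: cov_add_left cov_add_right cov_commute[of Y X])
  ultimately show "cov (\<lambda>\<omega>. X \<omega> + Y \<omega>) (\<lambda>\<omega>. X \<omega> + Y \<omega>) \<le> (sqrt (cov X X) + sqrt (cov Y Y))\<^sup>2"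
    using cov_nonneg[of X] cov_nonneg[of Y] by (simp add: power2_sum real_sqrt_mult)
qed (simp_all add: cov_nonneg)

lemma (in gaussian_space) prob_abs_gt_le:
  assumes X: "X \<in> G" and v: "cov X X \<le> v" "0 < v" and x: "0 < x"
  shows "prob {\<omega> \<in> space M. \<bar>X \<omega>\<bar> > x} \<le> 2 * exp (- x\<^sup>2 / (2 * v))"
proof -
  have one: "prob {\<omega> \<in> space M. Y \<omega> \<ge> x} \<le> exp (- x\<^sup>2 / (2 * v))" if Y: "Y \<in> G" "cov Y Y \<le> v" for Y
  proof -
    \<comment> \<open>The minimiser of the Chernoff exponent
      \<open>- l * x + l * l * v / 2\<close>.\<close>
    define l where "l = x / v"
    have l: "l > 0" using v x by (simp add: l_def)
    have lY: "(\<lambda>\<omega>. l * Y \<omega>) \<in> G" using Y scale by auto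
    have int: "integrable M (\<lambda>\<omega>. exp (l * Y \<omega>))" and E: "expectation (\<lambda>\<omega>. exp (l * Y \<omega>)) = exp (l * l * cov Y Y / 2)"
      using exp_moment[OF lY] by (simp_all add: cov_scale_left cov_scale_right mult.assoc)
    have "prob {\<omega> \<in> space M. Y \<omega> \<ge> x} \<le> exp (- l * x) * (\<integral>\<omega>\<in>space M. exp (l * Y \<omega>) \<partial>M)"
      using integrable_mult_indicator[OF sets.top int]
      by (intro Chernoff_ineq_ge[OF l]) (auto simp: set_integrable_def)
    also have "\<dots> = exp (- l * x) * exp (l * l * cov Y Y / 2)"
      using int E by (simp add: set_integral_space)
    also have "\<dots> \<le> exp (- l * x) * exp (l * l * v / 2)"
      using Y l by (intro mult_left_mono) auto
    also have "\<dots> = exp (- x\<^sup>2 / (2 * v))"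
      using v by (simp add: mult_exp_exp l_def power2_eq_square field_simps)
    finally show ?thesis .
  qed
  have [measurable]: "X \<in> borel_measurable M" using X by measurable
  have mX: "(\<lambda>\<omega>. (-1) * X \<omega>) \<in> G" using scale[OF X] .
  have "cov (\<lambda>\<omega>. (-1) * X \<omega>) (\<lambda>\<omega>. (-1) * X \<omega>) \<le> v"
    unfolding cov_scale_left cov_scale_right using v by simp
  from one[OF mX this] one[OF X v(1)]
  have "prob {\<omega> \<in> space M. X \<omega> \<ge> x} + prob {\<omega> \<in> space M. - X \<omega> \<ge> x} \<le> 2 * exp (- x\<^sup>2 / (2 * v))"
    by simp
  moreover have "prob {\<omega> \<in> space M. \<bar>X \<omega>\<bar> > x} \<le> prob ({\<omega> \<in> space M. X \<omega> \<ge> x} \<union> {\<omega> \<in> space M. - X \<omega> \<ge> x})"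
    by (intro finite_measure_mono) (auto simp: abs_if split: if_splits)
  moreover have "\<dots> \<le> prob {\<omega> \<in> space M. X \<omega> \<ge> x} + prob {\<omega> \<in> space M. - X \<omega> \<ge> x}"
    by (intro measure_Un_le) measurable
  ultimately show ?thesis by linarith
qed

lemma closure_rational_interval:
  assumes "a < (b::real)"
  shows "closure ({a<..<b} \<inter> \<rat>) = {a..b}"
  using assms closure_open_Int_superset[of "{a<..<b}" \<rat>] by (simp add: Rats_closure_real)

text \<open>Reduces the infimum over an interval to countably many times, which gives measurability
  and fits the countable Gaussian estimates.\<close>

lemma INF_rational_interval:
  fixes f :: "real \<Rightarrow> real"
  assumes T: "0 < T" and f: "continuous_on {0..T} f"
  shows "(INF t\<in>{0..T}. f t) = (INF t\<in>{0<..<T} \<inter> \<rat>. f t)"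
proof -
  define D where "D = {0<..<T} \<inter> (\<rat> :: real set)"
  have cl: "closure D = {0..T}" unfolding D_def using closure_rational_interval[OF T] .
  then have ne: "D \<noteq> {}" using T by force
  have bdd: "bdd_below (f ` {0..T})"
    using f by (intro bounded_imp_bdd_below compact_imp_bounded compact_continuous_image) auto
  have sub: "D \<subseteq> {0..T}" by (auto simp: D_def)
  have "(INF t\<in>{0..T}. f t) \<le> (INF t\<in>D. f t)"
    using ne sub bdd by (intro cINF_superset_mono) auto
  moreover have "(INF t\<in>D. f t) \<le> f t" if "t \<in> {0..T}" for t
  proof (rule continuous_ge_on_closure[where S = D and f = f and x = t])
    show "continuous_on (closure D) f" "t \<in> closure D" using f that by (auto simp: cl)
    show "(INF t\<in>D. f t) \<le> f x" if "x \<in> D" for x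
      using that bdd sub by (intro cINF_lower bdd_below_mono[OF bdd]) auto
  qed
  then have "(INF t\<in>D. f t) \<le> (INF t\<in>{0..T}. f t)" using T by (intro cINF_greatest) auto
  ultimately show ?thesis by (simp add: D_def)
qed

locale stationary_gaussian =
  fixes M :: "'a measure" and V :: "real \<Rightarrow> 'a \<Rightarrow> real"
  assumes gauss: "gaussian_process M V" and cent: "centered_process M V"
    and stat: "stationary_increments M V" and paths: "continuous_paths M V"
    and std_zero: "std_fun M V 0 = 0"
begin

sublocale prob_space M
  using gauss by (simp add: gaussian_process_def)

definition G where "G = {X. \<exists>J c. finite J \<and> X = (\<lambda>\<omega>. \<Sum>t\<in>J. c t * V t \<omega>)}"

lemma lin_comb_in_G: "finite J \<Longrightarrow> (\<lambda>\<omega>. \<Sum>t\<in>J. c t * V t \<omega>) \<in> G"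
  by (auto simp: G_def)

lemma V_gaussian_rv: "gaussian_rv M (V t)"
  using gauss[unfolded gaussian_process_def, THEN conjunct2, rule_format, of "{t}" "\<lambda>_. 1"] by simp

lemma measurable_V [measurable]: "V t \<in> borel_measurable M"
  using V_gaussian_rv by (simp add: gaussian_rv_def)

lemma integrable_V: "integrable M (V t)"
proof -
  have [measurable]: "V t \<in> borel_measurable M" by measurable
  from V_gaussian_rv[of t] consider \<mu> where "AE \<omega> in M. V t \<omega> = \<mu>"
    | \<mu> \<sigma> where "0 < \<sigma>" "distributed M lborel (V t) (normal_density \<mu> \<sigma>)"
    by (auto simp: gaussian_rv_def)
  then show ?thesis
  proof cases
    case (1 \<mu>)
    then have "integrable M (V t) \<longleftrightarrow> integrable M (\<lambda>_. \<mu>)" by (intro integrable_cong_AE) auto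
    then show ?thesis by simp
  next
    case (2 \<mu> \<sigma>)
    then show ?thesis by (intro distributed_integrable_var[OF 2(2)]) (auto intro: integrable_normal_moment_nz_1)
  qed
qed

sublocale gaussian_space M G
proof
  fix X assume X: "X \<in> G"
  then obtain J c where J: "finite J" "X = (\<lambda>\<omega>. \<Sum>t\<in>J. c t * V t \<omega>)" by (auto simp: G_def)
  show "gaussian_rv M X" using gauss J by (simp add: gaussian_process_def)
  show "expectation X = 0" unfolding J(2)
    using cent integrable_V by (simp add: centered_process_def)
  fix a
  show "(\<lambda>\<omega>. a * X \<omega>) \<in> G"
    using lin_comb_in_G[OF J(1), of "\<lambda>t. a * c t"] by (simp add: J(2) sum_distrib_left mult.assoc)
  fix Y assume "Y \<in> G"
  then obtain J' c' where J': "finite J'" "Y = (\<lambda>\<omega>. \<Sum>t\<in>J'. c' t * V t \<omega>)" by (auto simp: G_def)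
  \<comment> \<open>Coefficients are extended by 0 so that both combinations run over the same
    finite set of times.\<close>
  have pad: "(\<Sum>t\<in>K. e t * V t \<omega>) = (\<Sum>t\<in>J \<union> J'. (if t \<in> K then e t else 0) * V t \<omega>)"
    if "K \<subseteq> J \<union> J'" for K e \<omega>
    using that J(1) J'(1) by (intro sum.mono_neutral_cong_left) auto
  have "X \<omega> + Y \<omega> = (\<Sum>t\<in>J \<union> J'. ((if t \<in> J then c t else 0) + (if t \<in> J' then c' t else 0)) * V t \<omega>)" for \<omega>
  proof -
    have "X \<omega> + Y \<omega> = (\<Sum>t\<in>J \<union> J'. (if t \<in> J then c t else 0) * V t \<omega>) + (\<Sum>t\<in>J \<union> J'. (if t \<in> J' then c' t else 0) * V t \<omega>)"
      unfolding J(2) J'(2) by (intro arg_cong2[where f = "(+)"] pad) auto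
    then show ?thesis by (simp only: sum.distrib distrib_right)
  qed
  then have "(\<lambda>\<omega>. X \<omega> + Y \<omega>) = (\<lambda>\<omega>. \<Sum>t\<in>J \<union> J'. ((if t \<in> J then c t else 0) + (if t \<in> J' then c' t else 0)) * V t \<omega>)"
    by (rule ext)
  moreover have "(\<lambda>\<omega>. \<Sum>t\<in>J \<union> J'. ((if t \<in> J then c t else 0) + (if t \<in> J' then c' t else 0)) * V t \<omega>) \<in> G"
    by (rule lin_comb_in_G) (use J J' in simp)
  ultimately show "(\<lambda>\<omega>. X \<omega> + Y \<omega>) \<in> G" by (simp only:)
next
  show "(\<lambda>_. 0) \<in> G" using lin_comb_in_G[of "{}"] by simp
qed

lemma V_in_G: "V t \<in> G"
  using lin_comb_in_G[of "{t}" "\<lambda>_. 1"] by simp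

abbreviation s2 where "s2 \<equiv> var_fun M V"
abbreviation \<sigma> where "\<sigma> \<equiv> std_fun M V"

lemma s2_eq_cov: "s2 t = cov (V t) (V t)"
  using cent by (simp add: var_fun_def cov_def centered_process_def power2_eq_square)

lemma s2_nonneg: "0 \<le> s2 t" by (simp add: s2_eq_cov cov_nonneg)

lemma s2_zero: "s2 0 = 0" using std_zero by (simp add: std_fun_def)

lemma s2_eq_square: "s2 t = (\<sigma> t)\<^sup>2" by (simp add: std_fun_def s2_nonneg)

lemma V_zero: "AE \<omega> in M. V 0 \<omega> = 0"
  using s2_zero by (cases rule: cases_G[OF V_in_G[of 0]]) (auto simp: s2_eq_cov)

text \<open>Stationarity is an equality of laws of whole increment families; integrating the
  functional \<open>f\<close>, the squared coordinate at \<open>s - t\<close>, extracts the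
  variance. The remaining \<open>V 0\<close> vanishes almost everywhere.\<close>

lemma cov_increment: "cov (\<lambda>\<omega>. V s \<omega> - V t \<omega>) (\<lambda>\<omega>. V s \<omega> - V t \<omega>) = s2 (s - t)"
proof -
  define f where "f x = (x (s - t) :: real)\<^sup>2" for x :: "real \<Rightarrow> real"
  have [measurable]: "f \<in> borel_measurable (Pi\<^sub>M UNIV (\<lambda>_. borel))" unfolding f_def by measurable
  have m: "(\<lambda>\<omega> r. V (r + h) \<omega> - V h' \<omega>) \<in> M \<rightarrow>\<^sub>M Pi\<^sub>M UNIV (\<lambda>_. borel)" for h h'
    by (rule measurable_PiM_single') auto
  have "cov (\<lambda>\<omega>. V s \<omega> - V t \<omega>) (\<lambda>\<omega>. V s \<omega> - V t \<omega>) = (\<integral>x. f x \<partial>distr M (Pi\<^sub>M UNIV (\<lambda>_. borel)) (\<lambda>\<omega> r. V (r + t) \<omega> - V t \<omega>))"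
    using m[of t t] by (subst integral_distr) (auto simp: f_def cov_def power2_eq_square)
  also have "\<dots> = (\<integral>x. f x \<partial>distr M (Pi\<^sub>M UNIV (\<lambda>_. borel)) (\<lambda>\<omega> r. V r \<omega> - V 0 \<omega>))"
    using stat by (simp add: stationary_increments_def)
  also have "\<dots> = expectation (\<lambda>\<omega>. (V (s - t) \<omega> - V 0 \<omega>)\<^sup>2)"
    using m[of 0 0] by (subst integral_distr) (auto simp: f_def)
  also have "\<dots> = expectation (\<lambda>\<omega>. V (s - t) \<omega> * V (s - t) \<omega>)"
    using V_zero by (intro integral_cong_AE) (auto simp: power2_eq_square)
  finally show ?thesis by (simp add: s2_eq_cov cov_def)
qed

lemma cov_V: "cov (V s) (V t) = (s2 s + s2 t - s2 (s - t)) / 2"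
  using cov_increment[of s t, symmetric] V_in_G[of s] V_in_G[of t] diff[OF V_in_G[of s] V_in_G[of t]]
  by (simp add: cov_diff_left cov_diff_right cov_commute[of "V t" "V s"] s2_eq_cov)

lemma s2_even: "s2 (- t) = s2 t"
  using cov_V[of 0 t] cov_V[of t 0] by (simp add: cov_commute[of "V 0"] s2_zero)

lemma s2_abs: "s2 \<bar>t\<bar> = s2 t"
  using s2_even[of t] by (simp add: abs_if)

lemma variogram_eq: "variogram M V h = s2 h / 2"
proof -
  have "expectation (\<lambda>\<omega>. (V h \<omega> - V 0 \<omega>)\<^sup>2) = cov (\<lambda>\<omega>. V h \<omega> - V 0 \<omega>) (\<lambda>\<omega>. V h \<omega> - V 0 \<omega>)"
    by (simp add: cov_def power2_eq_square)
  then show ?thesis unfolding variogram_def cov_increment by simp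
qed

lemma \<sigma>_subadd: "\<sigma> (s + t) \<le> \<sigma> s + \<sigma> t"
proof -
  have "\<sigma> (s + t) = sqrt (cov (\<lambda>\<omega>. (V (s + t) \<omega> - V t \<omega>) + V t \<omega>) (\<lambda>\<omega>. (V (s + t) \<omega> - V t \<omega>) + V t \<omega>))"
    by (simp add: std_fun_def s2_eq_cov)
  also have "\<dots> \<le> sqrt (cov (\<lambda>\<omega>. V (s + t) \<omega> - V t \<omega>) (\<lambda>\<omega>. V (s + t) \<omega> - V t \<omega>)) + sqrt (cov (V t) (V t))"
    by (intro sqrt_cov_triangle diff V_in_G)
  finally show ?thesis unfolding cov_increment by (simp add: std_fun_def s2_eq_cov)
qed

lemma continuous_V: "\<omega> \<in> space M \<Longrightarrow> continuous_on A (\<lambda>t. V t \<omega>)"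
  using paths continuous_on_subset[OF _ subset_UNIV] by (auto simp: continuous_paths_def)

text \<open>Path continuity gives convergence of the bounded variables
  \<open>iexp (V (X n))\<close>, so dominated convergence applies to their means. For Gaussian
  variables these are \<open>exp (- s2 / 2)\<close>, and a logarithm recovers the variances.\<close>

lemma \<sigma>_tendsto_zero: "(\<sigma> \<longlongrightarrow> 0) (at 0)"
  unfolding tendsto_at_iff_sequentially
proof (intro allI impI)
  fix X :: "nat \<Rightarrow> real" assume X: "X \<longlonglongrightarrow> 0"
  have "(\<lambda>n. \<integral>\<omega>. iexp (V (X n) \<omega>) \<partial>M) \<longlonglongrightarrow> (\<integral>\<omega>. iexp (V 0 \<omega>) \<partial>M)"
  proof (rule integral_dominated_convergence[where w = "\<lambda>_. 1"])
    show "AE \<omega> in M. (\<lambda>n. iexp (V (X n) \<omega>)) \<longlonglongrightarrow> iexp (V 0 \<omega>)"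
    proof (rule AE_I2)
      fix \<omega> assume "\<omega> \<in> space M"
      then have "(\<lambda>n. V (X n) \<omega>) \<longlonglongrightarrow> V 0 \<omega>"
        using X continuous_on_tendsto_compose[OF continuous_V[of \<omega> UNIV] X] by simp
      then show "(\<lambda>n. iexp (V (X n) \<omega>)) \<longlonglongrightarrow> iexp (V 0 \<omega>)" by (intro tendsto_intros)
    qed
  qed auto
  then have "(\<lambda>n. complex_of_real (exp (- s2 (X n) / 2))) \<longlonglongrightarrow> complex_of_real (exp (- s2 0 / 2))"
    unfolding char_G[OF V_in_G] s2_eq_cov .
  then have "(\<lambda>n. exp (- s2 (X n) / 2)) \<longlonglongrightarrow> 1" by (simp only: tendsto_of_real_iff) (simp add: s2_zero)
  then have "(\<lambda>n. ln (exp (- s2 (X n) / 2))) \<longlonglongrightarrow> ln 1" by (rule tendsto_ln) simp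
  then have "(\<lambda>n. (-2) * (- s2 (X n) / 2)) \<longlonglongrightarrow> (-2) * 0" by (intro tendsto_mult tendsto_const) simp
  then have "(\<lambda>n. s2 (X n)) \<longlonglongrightarrow> 0" by simp
  then have "(\<lambda>n. sqrt (s2 (X n))) \<longlonglongrightarrow> sqrt 0" by (rule tendsto_real_sqrt)
  then show "(\<sigma> \<circ> X) \<longlonglongrightarrow> 0" by (simp add: std_fun_def comp_def)
qed

lemma continuous_\<sigma>: "continuous_on A \<sigma>"
proof (intro continuous_at_imp_continuous_on ballI)
  fix t
  have "((\<lambda>h. \<sigma> (t + h) - \<sigma> t) \<longlongrightarrow> 0) (at 0)"
  proof (rule Lim_null_comparison[OF _ \<sigma>_tendsto_zero])
    have "norm (\<sigma> (t + h) - \<sigma> t) \<le> \<sigma> h" for h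
      using \<sigma>_subadd[of t h] \<sigma>_subadd[of "t + h" "- h"] s2_even[of h] by (simp add: std_fun_def)
    then show "\<forall>\<^sub>F h in at 0. norm (\<sigma> (t + h) - \<sigma> t) \<le> \<sigma> h" by simp
  qed
  then have "((\<lambda>h. \<sigma> (t + h)) \<longlongrightarrow> \<sigma> t) (at 0)" by (simp add: LIM_zero_iff)
  then show "isCont \<sigma> t" by (simp add: isCont_iff)
qed

lemma continuous_s2: "continuous_on A s2"
proof -
  have "s2 = (\<lambda>t. (\<sigma> t)\<^sup>2)" by (simp add: fun_eq_iff s2_eq_square)
  then show ?thesis using continuous_\<sigma>[of A] by (auto intro: continuous_intros)
qed

definition Z where "Z t \<omega> = sqrt 2 * V t \<omega> - s2 t"

lemma continuous_Z: "\<omega> \<in> space M \<Longrightarrow> continuous_on A (\<lambda>t. Z t \<omega>)"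
  unfolding Z_def by (intro continuous_intros continuous_V continuous_s2)

lemma measurable_Z [measurable]: "Z t \<in> borel_measurable M"
  unfolding Z_def by measurable

lemma expected_infimum_eq: "expected_infimum M V T = expectation (\<lambda>\<omega>. INF t\<in>{0..T}. exp (Z t \<omega>))"
  by (simp add: expected_infimum_def Z_def)

lemma persistence_prob_eq: "persistence_prob M V T C = prob {\<omega> \<in> space M. (INF t\<in>{0..T}. Z t \<omega>) > C}"
  by (simp add: persistence_prob_def Z_def)

lemma INF_exp_bounds:
  assumes "0 \<le> t" "t \<le> T"
  shows "(INF t\<in>{0..T}. exp (Z t \<omega>)) \<le> exp (Z t \<omega>)" "0 \<le> (INF t\<in>{0..T}. exp (Z t \<omega>))"
  using assms by (auto intro!: cINF_lower cINF_greatest bdd_belowI[of _ 0])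

lemma integrable_INF_exp:
  assumes T: "0 < T"
  shows "integrable M (\<lambda>\<omega>. INF t\<in>{0..T}. exp (Z t \<omega>))"
proof (rule Bochner_Integration.integrable_bound)
  show "integrable M (\<lambda>\<omega>. exp (Z 0 \<omega>))"
    using exp_moment(1)[OF scale[OF V_in_G[of 0], of "sqrt 2"]] by (simp add: Z_def s2_zero)
  show "AE \<omega> in M. norm (INF t\<in>{0..T}. exp (Z t \<omega>)) \<le> norm (exp (Z 0 \<omega>))"
    using INF_exp_bounds[of 0 T] T by simp
  have "(\<lambda>\<omega>. INF t\<in>{0<..<T} \<inter> \<rat>. exp (Z t \<omega>)) \<in> borel_measurable M"
    by (intro borel_measurable_cINF) (auto intro!: countable_Int2 countable_rat bdd_belowI[of _ 0])
  moreover have "(INF t\<in>{0..T}. exp (Z t \<omega>)) = (INF t\<in>{0<..<T} \<inter> \<rat>. exp (Z t \<omega>))" if "\<omega> \<in> space M" for \<omega>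
    using T continuous_Z[OF that] by (intro INF_rational_interval continuous_intros)
  ultimately show "(\<lambda>\<omega>. INF t\<in>{0..T}. exp (Z t \<omega>)) \<in> borel_measurable M"
    by (simp cong: measurable_cong)
qed

lemma INF_Z_measurable:
  assumes T: "0 < T"
  shows "{\<omega> \<in> space M. (INF t\<in>{0..T}. Z t \<omega>) > C} \<in> events"
proof -
  have eq: "(INF t\<in>{0..T}. Z t \<omega>) = (INF t\<in>{0<..<T} \<inter> \<rat>. Z t \<omega>)" if "\<omega> \<in> space M" for \<omega>
    using T continuous_Z[OF that] by (intro INF_rational_interval)
  have "(\<lambda>\<omega>. INF t\<in>{0<..<T} \<inter> \<rat>. Z t \<omega>) \<in> borel_measurable M"
  proof (intro borel_measurable_cINF)
    fix \<omega> assume "\<omega> \<in> space M"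
    then have "bdd_below ((\<lambda>t. Z t \<omega>) ` {0..T})"
      by (intro bounded_imp_bdd_below compact_imp_bounded compact_continuous_image continuous_Z) auto
    then show "bdd_below ((\<lambda>t. Z t \<omega>) ` ({0<..<T} \<inter> \<rat>))"
      by (rule bdd_below_mono) auto
  qed (auto intro!: countable_Int2 countable_rat)
  then have "{\<omega> \<in> space M. (INF t\<in>{0<..<T} \<inter> \<rat>. Z t \<omega>) > C} \<in> events" by measurable
  also have "{\<omega> \<in> space M. (INF t\<in>{0<..<T} \<inter> \<rat>. Z t \<omega>) > C} = {\<omega> \<in> space M. (INF t\<in>{0..T}. Z t \<omega>) > C}"
    using eq by auto
  finally show ?thesis .
qed

text \<open>Increment variances determine all covariances. Twice the second formula minus
  \<open>s2 t\<close> is the weighted average of \<open>s2\<close> minus the potential at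
  \<open>t\<close>: the surplus of the shift over the barrier. The third formula is the cost of the
  shift.\<close>

lemma cov_weighted_V:
  fixes m x :: "nat \<Rightarrow> real"
  assumes m: "(\<Sum>j<n. m j) = 1"
  defines "\<xi> \<equiv> \<lambda>\<omega>. \<Sum>j<n. m j * V (x j) \<omega>"
  shows "\<xi> \<in> G"
    and "cov \<xi> (V t) = (s2 t + (\<Sum>j<n. m j * s2 (x j)) - (\<Sum>j<n. m j * s2 (t - x j))) / 2"
    and "cov \<xi> \<xi> = (\<Sum>j<n. m j * s2 (x j)) - (\<Sum>i<n. \<Sum>j<n. m i * m j * s2 (x i - x j)) / 2"
proof -
  define q where "q = (\<Sum>j<n. m j * s2 (x j))"
  show \<xi>: "\<xi> \<in> G" unfolding \<xi>_def by (rule sum) (auto intro: V_in_G)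
  have c: "cov \<xi> (V t) = (s2 t + q - (\<Sum>j<n. m j * s2 (t - x j))) / 2" for t
  proof -
    have "cov \<xi> (V t) = (\<Sum>j<n. m j * cov (V t) (V (x j)))"
      unfolding \<xi>_def by (subst cov_sum_left) (auto intro: V_in_G simp: cov_commute)
    also have "\<dots> = (\<Sum>j<n. (m j * s2 t + m j * s2 (x j) - m j * s2 (t - x j)) / 2)"
      by (simp add: cov_V algebra_simps add_divide_distrib diff_divide_distrib)
    also have "\<dots> = ((\<Sum>j<n. m j) * s2 t + q - (\<Sum>j<n. m j * s2 (t - x j))) / 2"
      by (simp add: sum.distrib sum_subtractf sum_divide_distrib[symmetric] sum_distrib_right q_def)
    finally show ?thesis by (simp add: m)
  qed
  then show "cov \<xi> (V t) = (s2 t + (\<Sum>j<n. m j * s2 (x j)) - (\<Sum>j<n. m j * s2 (t - x j))) / 2"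
    by (simp add: q_def)
  have "cov \<xi> \<xi> = (\<Sum>i<n. m i * cov \<xi> (V (x i)))"
    by (subst (2) \<xi>_def, rule cov_sum_right) (auto intro: V_in_G \<xi>)
  also have "\<dots> = (\<Sum>i<n. (m i * s2 (x i) + m i * q - (\<Sum>j<n. m i * m j * s2 (x i - x j))) / 2)"
    unfolding c by (simp add: distrib_left right_diff_distrib sum_distrib_left mult.assoc)
  also have "\<dots> = (q + (\<Sum>i<n. m i) * q - (\<Sum>i<n. \<Sum>j<n. m i * m j * s2 (x i - x j))) / 2"
    by (simp add: sum.distrib sum_subtractf sum_divide_distrib[symmetric] sum_distrib_right q_def)
  finally show "cov \<xi> \<xi> = (\<Sum>j<n. m j * s2 (x j)) - (\<Sum>i<n. \<Sum>j<n. m i * m j * s2 (x i - x j)) / 2"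
    by (simp add: m q_def diff_divide_distrib)
qed

text \<open>Replacing the infimum by a weighted geometric mean leaves a log-normal expectation.\<close>

lemma expected_infimum_le:
  fixes m x :: "nat \<Rightarrow> real"
  assumes T: "0 < T" and m: "\<And>j. j < n \<Longrightarrow> 0 \<le> m j" "(\<Sum>j<n. m j) = 1"
    and x: "\<And>j. j < n \<Longrightarrow> 0 \<le> x j \<and> x j \<le> T"
  shows "expected_infimum M V T \<le> exp (- (\<Sum>i<n. \<Sum>j<n. m i * m j * s2 (x i - x j)) / 2)"
proof -
  define \<xi> where "\<xi> \<omega> = (\<Sum>j<n. m j * V (x j) \<omega>)" for \<omega>
  define q where "q = (\<Sum>j<n. m j * s2 (x j))"
  have \<xi>: "\<xi> \<in> G" unfolding \<xi>_def[abs_def] by (rule sum) (auto intro: V_in_G)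
  have \<xi>2: "(\<lambda>\<omega>. sqrt 2 * \<xi> \<omega>) \<in> G" using scale[OF \<xi>] .
  have cov: "cov \<xi> \<xi> = q - (\<Sum>i<n. \<Sum>j<n. m i * m j * s2 (x i - x j)) / 2"
    unfolding \<xi>_def[abs_def] q_def by (rule cov_weighted_V(3)[OF m(2)])
  have "expected_infimum M V T \<le> expectation (\<lambda>\<omega>. exp (sqrt 2 * \<xi> \<omega>) * exp (- q))"
    unfolding expected_infimum_eq
  proof (rule integral_mono)
    show "integrable M (\<lambda>\<omega>. INF t\<in>{0..T}. exp (Z t \<omega>))" by (rule integrable_INF_exp[OF T])
    show "integrable M (\<lambda>\<omega>. exp (sqrt 2 * \<xi> \<omega>) * exp (- q))" using exp_moment(1)[OF \<xi>2] by simp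
    fix \<omega>
    define I where "I = (INF t\<in>{0..T}. exp (Z t \<omega>))"
    show "I \<le> exp (sqrt 2 * \<xi> \<omega>) * exp (- q)"
    \<comment> \<open>Only a positive infimum has a meaningful logarithm; otherwise the bound holds
      because the right side is positive.\<close>
    proof (cases "I \<le> 0")
      case True
      then show ?thesis by (meson exp_ge_zero mult_nonneg_nonneg order_trans)
    next
      case False
      have "ln I * 1 = (\<Sum>j<n. m j * ln I)" using m(2) by (simp add: sum_distrib_right[symmetric])
      also have "\<dots> \<le> (\<Sum>j<n. m j * Z (x j) \<omega>)"
      proof (intro sum_mono mult_left_mono)
        fix j assume "j \<in> {..<n}"
        then have "I \<le> exp (Z (x j) \<omega>)" unfolding I_def using x by (intro INF_exp_bounds) auto
        then have "ln I \<le> ln (exp (Z (x j) \<omega>))" using False by (subst ln_le_cancel_iff) auto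
        then show "ln I \<le> Z (x j) \<omega>" by simp
      qed (use m in auto)
      also have "\<dots> = sqrt 2 * \<xi> \<omega> - q"
        by (simp add: Z_def \<xi>_def q_def right_diff_distrib sum_subtractf sum_distrib_left mult.left_commute)
      finally have "exp (ln I) \<le> exp (sqrt 2 * \<xi> \<omega> - q)" by simp
      then show ?thesis using False by (simp add: mult_exp_exp)
    qed
  qed
  also have "\<dots> = exp (cov (\<lambda>\<omega>. sqrt 2 * \<xi> \<omega>) (\<lambda>\<omega>. sqrt 2 * \<xi> \<omega>) / 2) * exp (- q)"
    using exp_moment(2)[OF \<xi>2] by simp
  also have "\<dots> = exp (- (\<Sum>i<n. \<Sum>j<n. m i * m j * s2 (x i - x j)) / 2)"
  proof -
    \<comment> \<open>Half the variance of \<open>sqrt 2 * \<xi>\<close> is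
      \<open>cov \<xi> \<xi>\<close>; its summand \<open>q\<close> cancels against the factor
      \<open>exp (- q)\<close>, and only the double sum survives.\<close>
    have "sqrt 2 * (sqrt 2 * y) / 2 = y" for y :: real by (simp flip: mult.assoc)
    then show ?thesis unfolding cov_scale_left cov_scale_right mult_exp_exp by (simp only: cov) simp
  qed
  finally show ?thesis .
qed

lemma Z_ball_event: "countable D \<Longrightarrow> {\<omega> \<in> space M. \<forall>t\<in>D. a \<le> Z t \<omega>} \<in> events"
  by measurable

lemma expected_infimum_ge:
  assumes T: "0 < T"
  shows "exp a * prob {\<omega> \<in> space M. \<forall>t\<in>{0<..<T} \<inter> \<rat>. a \<le> Z t \<omega>} \<le> expected_infimum M V T"
proof -
  let ?E = "{\<omega> \<in> space M. \<forall>t\<in>{0<..<T} \<inter> \<rat>. a \<le> Z t \<omega>}"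
  have [measurable]: "?E \<in> events" by (intro Z_ball_event countable_Int2 countable_rat)
  have "exp a * prob ?E = expectation (\<lambda>\<omega>. exp a * indicator ?E \<omega>)" by simp
  also have "\<dots> \<le> expectation (\<lambda>\<omega>. INF t\<in>{0..T}. exp (Z t \<omega>))"
  proof (rule integral_mono[OF _ integrable_INF_exp[OF T]])
    fix \<omega> assume \<omega>: "\<omega> \<in> space M"
    show "exp a * indicator ?E \<omega> \<le> (INF t\<in>{0..T}. exp (Z t \<omega>))"
    proof (cases "\<omega> \<in> ?E")
      case True
      have "a \<le> Z t \<omega>" if "t \<in> {0..T}" for t
      proof (rule continuous_ge_on_closure[where S = "{0<..<T} \<inter> \<rat>" and f = "\<lambda>t. Z t \<omega>" and x = t])
        show "continuous_on (closure ({0<..<T} \<inter> \<rat>)) (\<lambda>t. Z t \<omega>)" by (rule continuous_Z[OF \<omega>])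
        show "t \<in> closure ({0<..<T} \<inter> \<rat>)" using closure_rational_interval[OF T] that by simp
      qed (use True in auto)
      then show ?thesis using T True by (auto intro!: cINF_greatest)
    next
      case False
      then show ?thesis using INF_exp_bounds(2)[of 0 T] T by auto
    qed
  qed (auto simp: emeasure_eq_measure)
  finally show ?thesis by (simp add: expected_infimum_eq)
qed

text \<open>Bounds at rational times pass to the infimum only as a weak inequality, hence the strict
  gap between \<open>C\<close> and \<open>a\<close>.\<close>

lemma persistence_prob_ge:
  assumes T: "0 < T" and a: "C < a"
  shows "prob {\<omega> \<in> space M. \<forall>t\<in>{0<..<T} \<inter> \<rat>. a \<le> Z t \<omega>} \<le> persistence_prob M V T C"
  unfolding persistence_prob_eq
proof (rule finite_measure_mono[OF _ INF_Z_measurable[OF T]], rule subsetI)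
  fix \<omega> assume "\<omega> \<in> {\<omega> \<in> space M. \<forall>t\<in>{0<..<T} \<inter> \<rat>. a \<le> Z t \<omega>}"
  then have \<omega>: "\<omega> \<in> space M" "\<And>t. t \<in> {0<..<T} \<inter> \<rat> \<Longrightarrow> a \<le> Z t \<omega>" by auto
  have "{0<..<T} \<inter> \<rat> \<noteq> {}" using closure_rational_interval[OF T] T by force
  then have "a \<le> (INF t\<in>{0<..<T} \<inter> \<rat>. Z t \<omega>)" using \<omega> by (intro cINF_greatest) auto
  also have "\<dots> = (INF t\<in>{0..T}. Z t \<omega>)"
    using T continuous_Z[OF \<omega>(1)] by (intro INF_rational_interval[symmetric])
  finally show "\<omega> \<in> {\<omega> \<in> space M. (INF t\<in>{0..T}. Z t \<omega>) > C}" using a \<omega> by simp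
qed

text \<open>Markov's inequality for the exponential of the infimum; it carries the upper bound over
  from the expectation to the probability.\<close>

lemma persistence_prob_le:
  assumes T: "0 < T"
  shows "persistence_prob M V T C \<le> exp (- C) * expected_infimum M V T"
proof -
  let ?E = "{\<omega> \<in> space M. (INF t\<in>{0..T}. Z t \<omega>) > C}"
  have [measurable]: "?E \<in> events" by (rule INF_Z_measurable[OF T])
  have "exp C * prob ?E = expectation (\<lambda>\<omega>. exp C * indicator ?E \<omega>)" by simp
  also have "\<dots> \<le> expectation (\<lambda>\<omega>. INF t\<in>{0..T}. exp (Z t \<omega>))"
  proof (rule integral_mono[OF _ integrable_INF_exp[OF T]])
    fix \<omega> assume \<omega>: "\<omega> \<in> space M"
    show "exp C * indicator ?E \<omega> \<le> (INF t\<in>{0..T}. exp (Z t \<omega>))"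
    proof (cases "\<omega> \<in> ?E")
      case True
      have "bdd_below ((\<lambda>t. Z t \<omega>) ` {0..T})"
        using \<omega> by (intro bounded_imp_bdd_below compact_imp_bounded compact_continuous_image continuous_Z) auto
      then have "(INF t\<in>{0..T}. Z t \<omega>) \<le> Z t \<omega>" if "t \<in> {0..T}" for t
        using that by (intro cINF_lower)
      then have "C \<le> Z t \<omega>" if "t \<in> {0..T}" for t using True that by fastforce
      then show ?thesis using T True by (auto intro!: cINF_greatest)
    next
      case False
      then show ?thesis using INF_exp_bounds(2)[of 0 T] T by auto
    qed
  qed (auto simp: emeasure_eq_measure)
  finally have "exp (- C) * (exp C * prob ?E) \<le> exp (- C) * expected_infimum M V T"
    unfolding expected_infimum_eq by (intro mult_left_mono) auto
  then show ?thesis by (simp add: persistence_prob_eq mult_exp_exp flip: mult.assoc)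
qed

end

section \<open>Size of the paths near the origin, on compact intervals and at infinity\<close>

lemma summable_exp_neg_powr:
  fixes a \<theta> :: real
  assumes "0 < a" "0 < \<theta>"
  shows "summable (\<lambda>k::nat. exp (- a * real k powr \<theta>))"
proof (rule summable_comparison_test_bigo)
  show "summable (\<lambda>k::nat. norm (1 / real k ^ 2))"
    using inverse_power_summable[of 2, where 'a = real] by (simp add: field_simps)
  show "(\<lambda>k::nat. exp (- a * real k powr \<theta>)) \<in> O(\<lambda>k. 1 / real k ^ 2)"
    using assms by real_asymp
qed

context stationary_gaussian
begin

text \<open>Each continuous path is bounded on a compact interval, so the events for growing integer
  bounds exhaust the space.\<close>

lemma bounded_paths:
  assumes "0 < d"
  obtains s where "0 < s" "1 - d \<le> prob {\<omega> \<in> space M. \<forall>t\<in>{0..T} \<inter> \<rat>. \<bar>V t \<omega>\<bar> \<le> s}"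
proof -
  define A where "A n = {\<omega> \<in> space M. \<forall>t\<in>{0..T} \<inter> \<rat>. \<bar>V t \<omega>\<bar> \<le> real (Suc n)}" for n
  have [simp]: "countable ({0..T} \<inter> \<rat>)" by (intro countable_Int2 countable_rat)
  have [measurable]: "A n \<in> events" for n unfolding A_def by measurable
  have "(\<lambda>n. prob (A n)) \<longlonglongrightarrow> prob (\<Union>n. A n)"
  proof (rule finite_Lim_measure_incseq)
    show "incseq A" by (force simp: incseq_def A_def)
  qed auto
  moreover have "(\<Union>n. A n) = space M"
  proof
    show "space M \<subseteq> (\<Union>n. A n)"
    proof
      fix \<omega> assume \<omega>: "\<omega> \<in> space M"
      have "bounded ((\<lambda>t. V t \<omega>) ` {0..T})"
        using \<omega> by (intro compact_imp_bounded compact_continuous_image continuous_V) auto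
      then obtain B where B: "\<forall>t\<in>{0..T}. \<bar>V t \<omega>\<bar> \<le> B" by (auto simp: bounded_iff)
      obtain n where "B \<le> real n" using real_arch_simple by blast
      then have "\<omega> \<in> A n" using B \<omega> by (force simp: A_def)
      then show "\<omega> \<in> (\<Union>n. A n)" by blast
    qed
  qed (auto simp: A_def)
  ultimately have "(\<lambda>n. prob (A n)) \<longlonglongrightarrow> 1" by (simp add: prob_space)
  then have "\<forall>\<^sub>F n in sequentially. 1 - d < prob (A n)" using assms by (intro order_tendstoD(1)) auto
  from eventually_happens'[OF sequentially_bot this] obtain n where "1 - d < prob (A n)" by blast
  from that[rotated, OF less_imp_le[OF this, unfolded A_def]] show ?thesis by simp
qed

lemma small_near_zero:
  assumes c: "0 < c" and d: "0 < d"
  obtains \<eta> where "0 < \<eta>" "1 - d \<le> prob {\<omega> \<in> space M. \<forall>t\<in>{0..\<eta>} \<inter> \<rat>. \<bar>V t \<omega>\<bar> \<le> c}"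
proof -
  define A where "A n = {\<omega> \<in> space M. \<forall>t\<in>{0..1 / real (Suc n)} \<inter> \<rat>. \<bar>V t \<omega>\<bar> \<le> c}" for n
  have [simp]: "countable ({0..r} \<inter> \<rat>)" for r :: real by (intro countable_Int2 countable_rat)
  have [measurable]: "A n \<in> events" for n unfolding A_def by measurable
  have "(\<lambda>n. prob (A n)) \<longlonglongrightarrow> prob (\<Union>n. A n)"
  proof (rule finite_Lim_measure_incseq)
    show "incseq A"
    proof (rule incseq_SucI)
      fix n
      have "1 / real (Suc (Suc n)) \<le> 1 / real (Suc n)" by (intro divide_left_mono) auto
      then show "A n \<subseteq> A (Suc n)" unfolding A_def by force
    qed
  qed auto
  moreover have "prob (\<Union>n. A n) = 1"
  proof (subst prob_eq_1)
    show "AE \<omega> in M. \<omega> \<in> (\<Union>n. A n)"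
      using V_zero AE_space
    proof eventually_elim
      fix \<omega> assume V0: "V 0 \<omega> = 0" and \<omega>: "\<omega> \<in> space M"
      have "isCont (\<lambda>t. V t \<omega>) 0"
        using continuous_V[OF \<omega>, of UNIV] by (simp add: continuous_on_eq_continuous_at)
      then obtain r where r: "r > 0" "\<And>t. \<bar>t\<bar> < r \<Longrightarrow> \<bar>V t \<omega>\<bar> < c"
        using c V0 by (auto simp: continuous_at_eps_delta dist_real_def)
      have "\<forall>\<^sub>F n in sequentially. 1 / real (Suc n) < r"
        using r(1) LIMSEQ_Suc[OF lim_1_over_n] by (intro order_tendstoD(2)) auto
      from eventually_happens'[OF sequentially_bot this] obtain n where "1 / real (Suc n) < r" by blast
      then have "\<omega> \<in> A n" using r(2) \<omega> by (auto simp: A_def intro!: less_imp_le)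
      then show "\<omega> \<in> (\<Union>n. A n)" by blast
    qed
  qed auto
  ultimately have "(\<lambda>n. prob (A n)) \<longlonglongrightarrow> 1" by simp
  then have "\<forall>\<^sub>F n in sequentially. 1 - d < prob (A n)" using d by (intro order_tendstoD(1)) auto
  from eventually_happens'[OF sequentially_bot this] obtain n where "1 - d < prob (A n)" by blast
  from that[rotated, OF less_imp_le[OF this, unfolded A_def]] show ?thesis by simp
qed

lemma increments_law:
  assumes I: "countable I"
  shows "prob {\<omega> \<in> space M. \<forall>t\<in>I. \<bar>V (t + h) \<omega> - V h \<omega>\<bar> \<le> x} = prob {\<omega> \<in> space M. \<forall>t\<in>I. \<bar>V t \<omega> - V 0 \<omega>\<bar> \<le> x}"
proof -
  define B where "B = {f \<in> space (Pi\<^sub>M UNIV (\<lambda>_. borel)). \<forall>t\<in>I. \<bar>f t\<bar> \<le> (x::real)}"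
  have B: "B \<in> sets (Pi\<^sub>M UNIV (\<lambda>_. borel))" unfolding B_def using I by measurable
  have m: "(\<lambda>\<omega> r. V (r + h) \<omega> - V h' \<omega>) \<in> M \<rightarrow>\<^sub>M Pi\<^sub>M UNIV (\<lambda>_. borel)" for h h'
    by (rule measurable_PiM_single') auto
  have vim: "prob {\<omega> \<in> space M. \<forall>t\<in>I. \<bar>V (t + h) \<omega> - V h \<omega>\<bar> \<le> x}
      = measure (distr M (Pi\<^sub>M UNIV (\<lambda>_. borel)) (\<lambda>\<omega> r. V (r + h) \<omega> - V h \<omega>)) B" for h
    unfolding measure_distr[OF m B] by (intro arg_cong[where f = prob]) (auto simp: B_def space_PiM)
  have "distr M (Pi\<^sub>M UNIV (\<lambda>_. borel)) (\<lambda>\<omega> r. V (r + h) \<omega> - V h \<omega>)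
      = distr M (Pi\<^sub>M UNIV (\<lambda>_. borel)) (\<lambda>\<omega> r. V (r + 0) \<omega> - V 0 \<omega>)"
    using stat by (simp add: stationary_increments_def)
  then show ?thesis using vim[of h] vim[of 0] by simp
qed

text \<open>Increments over the unit interval starting at \<open>k\<close> have the law of those
  starting at 0, so Fernique's bound for one interval serves all of them, at a level that grows with
  \<open>k\<close>.\<close>

lemma unit_increment_tail:
  assumes c: "0 < c" and H: "0 < H"
  obtains \<theta> where "0 < \<theta>" "\<forall>\<^sub>F k::nat in sequentially.
    1 - exp (- (1/2) * real k powr \<theta>) \<le> prob {\<omega> \<in> space M. \<forall>t\<in>{0..1} \<inter> \<rat>. \<bar>V (t + real k) \<omega> - V (real k) \<omega>\<bar> \<le> c * real k powr H}"
proof -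
  define I where "I = {0..1} \<inter> (\<rat> :: real set)"
  have I [simp]: "countable I" unfolding I_def by (intro countable_Int2 countable_rat)
  obtain s0 where s0: "0 < s0" "1 - 1/4 \<le> prob {\<omega> \<in> space M. \<forall>t\<in>I. \<bar>V t \<omega>\<bar> \<le> s0}"
    using bounded_paths[of "1/4" 1] unfolding I_def by auto
  \<comment> \<open>A path bounded by \<open>s0\<close> has increments from \<open>V 0\<close> of
    size at most \<open>2 * s0\<close>.\<close>
  define s where "s = 2 * s0"
  have s: "s > 0" using s0 by (simp add: s_def)
  have "prob {\<omega> \<in> space M. \<forall>t\<in>I. \<bar>V t \<omega>\<bar> \<le> s0} \<le> prob {\<omega> \<in> space M. \<forall>t\<in>I. \<bar>V t \<omega> - V 0 \<omega>\<bar> \<le> s}"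
  proof (rule finite_measure_mono)
    have "\<bar>V t \<omega> - V 0 \<omega>\<bar> \<le> s" if "\<forall>t\<in>I. \<bar>V t \<omega>\<bar> \<le> s0" "t \<in> I" for t \<omega>
    proof -
      have "\<bar>V t \<omega>\<bar> \<le> s0" "\<bar>V 0 \<omega>\<bar> \<le> s0" using that by (auto simp: I_def)
      then show ?thesis by (simp add: s_def)
    qed
    then show "{\<omega> \<in> space M. \<forall>t\<in>I. \<bar>V t \<omega>\<bar> \<le> s0} \<subseteq> {\<omega> \<in> space M. \<forall>t\<in>I. \<bar>V t \<omega> - V 0 \<omega>\<bar> \<le> s}" by blast
  qed measurable
  then have base: "3/4 \<le> prob {\<omega> \<in> space M. \<forall>t\<in>I. \<bar>V t \<omega> - V 0 \<omega>\<bar> \<le> s}" using s0 by simp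
  have tail: "1 - (1/3) ^ (2 ^ n) \<le> prob {\<omega> \<in> space M. \<forall>t\<in>I. \<bar>V t \<omega> - V 0 \<omega>\<bar> \<le> 3 ^ n * s}" for n
    using s base by (intro fernique_tail diff V_in_G) auto
  \<comment> \<open>Of the level \<open>k powr H\<close>, one factor \<open>k powr (H / 2)\<close>
    absorbs the constant \<open>s / c\<close>, the other is matched with \<open>3 ^ n\<close>. The
    exponent \<open>2 ^ n\<close> is then of order \<open>k powr (H / 2 * log 3 2)\<close>.\<close>
  define \<theta> where "\<theta> = H / 2 * log 3 2"
  have \<theta>: "\<theta> > 0" using H by (simp add: \<theta>_def)
  have lim: "filterlim (\<lambda>k::nat. real k powr (H / 2)) at_top sequentially"
    using H by real_asymp
  have "\<forall>\<^sub>F k::nat in sequentially. s / c \<le> real k powr (H / 2)"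
    using lim by (simp add: filterlim_at_top)
  then have "\<forall>\<^sub>F k::nat in sequentially.
    1 - exp (- (1/2) * real k powr \<theta>) \<le> prob {\<omega> \<in> space M. \<forall>t\<in>I. \<bar>V (t + real k) \<omega> - V (real k) \<omega>\<bar> \<le> c * real k powr H}"
    using eventually_ge_at_top[of 1]
  proof eventually_elim
    fix k :: nat assume k: "s / c \<le> real k powr (H / 2)" "1 \<le> k"
    \<comment> \<open>The real solution of \<open>3 powr L = k powr (H / 2)\<close>. Rounding it
      down to \<open>n\<close> loses at most a factor 2 in \<open>2 ^ n\<close>, hence the
      \<open>1/2\<close> in the exponent.\<close>
    define L where "L = H / 2 * log 3 (real k)"
    define n where "n = nat \<lfloor>L\<rfloor>"
    have "0 \<le> L" using k H by (auto simp: L_def)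
    then have n: "real n \<le> L" "L < real n + 1" by (auto simp: n_def)
    have kL: "3 powr L = real k powr (H / 2)"
    proof -
      have "3 powr L = (3 powr log 3 (real k)) powr (H / 2)"
        by (simp only: L_def powr_powr mult.commute)
      then show ?thesis using k by simp
    qed
    have "(3::real) ^ n = 3 powr real n" by (simp add: powr_realpow)
    also have "\<dots> \<le> 3 powr L" using n by (intro powr_mono) auto
    finally have "3 ^ n * s \<le> real k powr (H / 2) * s" using s kL by (intro mult_right_mono) auto
    also have "\<dots> \<le> real k powr (H / 2) * (c * real k powr (H / 2))"
      using k c by (intro mult_left_mono) (auto simp: field_simps)
    also have "\<dots> = c * real k powr H" by (simp add: mult.left_commute flip: powr_add)
    finally have le: "3 ^ n * s \<le> c * real k powr H" .
    have "real k powr \<theta> = (3 powr L) powr log 3 2"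
      unfolding kL by (simp add: \<theta>_def powr_powr)
    also have "\<dots> = (3 powr log 3 2) powr L" by (simp only: powr_powr mult.commute)
    also have "\<dots> = 2 powr L" by simp
    also have "\<dots> \<le> 2 powr (real n + 1)" using n by (intro powr_mono) auto
    also have "\<dots> = 2 * 2 ^ n" by (simp add: powr_add powr_realpow)
    finally have k\<theta>: "(1/2) * real k powr \<theta> \<le> 2 ^ n" by simp
    have "(1/3 :: real) ^ (2 ^ n) \<le> exp (- 1) ^ (2 ^ n)"
    proof (rule power_mono)
      show "1 / 3 \<le> exp (- 1 :: real)" using exp_le by (simp add: exp_minus field_simps)
    qed simp
    also have "\<dots> = exp (- (2 ^ n))" using exp_of_nat_mult[of "2 ^ n" "- 1 :: real"] by simp
    also have "\<dots> \<le> exp (- (1/2) * real k powr \<theta>)" using k\<theta> by simp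
    finally have "1 - exp (- (1/2) * real k powr \<theta>) \<le> prob {\<omega> \<in> space M. \<forall>t\<in>I. \<bar>V t \<omega> - V 0 \<omega>\<bar> \<le> 3 ^ n * s}"
      using tail[of n] by linarith
    also have "\<dots> \<le> prob {\<omega> \<in> space M. \<forall>t\<in>I. \<bar>V t \<omega> - V 0 \<omega>\<bar> \<le> c * real k powr H}"
      using le by (intro finite_measure_mono) (force, measurable)
    also have "\<dots> = prob {\<omega> \<in> space M. \<forall>t\<in>I. \<bar>V (t + real k) \<omega> - V (real k) \<omega>\<bar> \<le> c * real k powr H}"
      by (rule increments_law[symmetric]) simp
    finally show "1 - exp (- (1/2) * real k powr \<theta>) \<le> prob {\<omega> \<in> space M. \<forall>t\<in>I. \<bar>V (t + real k) \<omega> - V (real k) \<omega>\<bar> \<le> c * real k powr H}" .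
  qed
  with \<theta> show ?thesis unfolding I_def by (rule that)
qed

end

locale regularly_varying_gaussian = stationary_gaussian M V for M :: "'a measure" and V +
  fixes H :: real
  assumes H: "0 < H" "H < 1" and reg: "regularly_varying (std_fun M V) H"
begin

sublocale rvn: regularly_varying_norm \<sigma> H
proof
  show "\<sigma> (- t) = \<sigma> t" for t by (simp add: std_fun_def s2_even)
qed (use H reg in \<open>auto simp: s2_zero std_fun_def[of M V] s2_nonneg intro: continuous_\<sigma>[unfolded std_fun_def] \<sigma>_subadd[unfolded std_fun_def]\<close>)

lemma s2_growth:
  obtains c where "0 < c" "\<forall>\<^sub>F T in at_top. c * T powr H \<le> s2 T"
proof -
  obtain c where c: "0 < c" "\<forall>\<^sub>F T in at_top. c * T powr (H / 2) \<le> \<sigma> T" using rvn.power_growth by blast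
  from c(2) have "\<forall>\<^sub>F T in at_top. c\<^sup>2 * T powr H \<le> s2 T"
  proof eventually_elim
    case (elim T)
    then have "(c * T powr (H / 2))\<^sup>2 \<le> (\<sigma> T)\<^sup>2" using c by (intro power_mono) auto
    moreover have "(T powr (H / 2))\<^sup>2 = T powr H" by (simp add: power2_eq_square flip: powr_add)
    ultimately show ?case by (simp add: s2_eq_square power_mult_distrib)
  qed
  then show ?thesis using c by (intro that[of "c\<^sup>2"]) auto
qed

lemma s2_at_top: "filterlim s2 at_top at_top"
proof -
  obtain c where c: "0 < c" "\<forall>\<^sub>F T in at_top. c * T powr H \<le> s2 T" using s2_growth .
  have "filterlim (\<lambda>T. c * T powr H) at_top at_top" using c(1) H(1) by real_asymp
  then show ?thesis using c(2) by (rule filterlim_at_top_mono)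
qed

lemma eventually_s2_max: "\<forall>\<^sub>F T in at_top. \<forall>u\<in>{0..T}. s2 u \<le> 4 * s2 T"
  using rvn.eventually_max_le
proof eventually_elim
  case (elim T)
  have "(\<sigma> u)\<^sup>2 \<le> (2 * \<sigma> T)\<^sup>2" if "u \<in> {0..T}" for u
    using elim that by (intro power_mono) (auto simp: rvn.nonneg)
  then show ?case by (simp add: s2_eq_square power_mult_distrib)
qed

text \<open>A union bound over integers \<open>k\<close>: a Gaussian tail controls
  \<open>V k\<close>, Fernique's bound the oscillation up to \<open>k + 1\<close>. By the growth of
  \<open>s2\<close> both bounds are summable, so starting far enough out makes the total at most
  \<open>d\<close>.\<close>

lemma paths_eventually_small:
  assumes e: "0 < e" and d: "0 < d"
  obtains t0 where "0 < t0" "1 - d \<le> prob {\<omega> \<in> space M. \<forall>t\<in>{t0..} \<inter> \<rat>. \<bar>V t \<omega>\<bar> \<le> e * s2 t}"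
proof -
  define I where "I = {0..1} \<inter> (\<rat> :: real set)"
  have I [simp]: "countable I" unfolding I_def by (intro countable_Int2 countable_rat)
  obtain c where c: "0 < c" and growth: "\<forall>\<^sub>F T in at_top. c * T powr H \<le> s2 T" using s2_growth .
  have ec: "0 < e / 2 * c" using e c by simp
  obtain \<theta> where \<theta>: "0 < \<theta>" and incr: "\<forall>\<^sub>F k::nat in sequentially.
    1 - exp (- (1/2) * real k powr \<theta>) \<le> prob {\<omega> \<in> space M. \<forall>t\<in>I. \<bar>V (t + real k) \<omega> - V (real k) \<omega>\<bar> \<le> (e / 2 * c) * real k powr H}"
    by (rule unit_increment_tail[OF ec H(1), folded I_def])
  \<comment> \<open>For \<open>t\<close> between \<open>k\<close> and \<open>k + 1\<close>,
    \<open>s2 k \<le> 4 * s2 t\<close> turns \<open>e / 8\<close> into \<open>e / 2\<close>, and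
    \<open>c * k powr H \<le> s2 t\<close> turns the increment bound into another
    \<open>e / 2 * s2 t\<close>.\<close>
  define bad where "bad k = {\<omega> \<in> space M. \<bar>V (real k) \<omega>\<bar> > e / 8 * s2 (real k)}
    \<union> (space M - {\<omega> \<in> space M. \<forall>t\<in>I. \<bar>V (t + real k) \<omega> - V (real k) \<omega>\<bar> \<le> (e / 2 * c) * real k powr H})" for k :: nat
  have [measurable]: "bad k \<in> events" for k unfolding bad_def by measurable
  \<comment> \<open>The 128 is \<open>2 * 8\<^sup>2\<close>, from the Gaussian tail at level
    \<open>e / 8 * s2 k\<close> with variance \<open>s2 k\<close>.\<close>
  define h where "h k = 2 * exp (- (e\<^sup>2 * c / 128) * real k powr H) + exp (- (1/2) * real k powr \<theta>)" for k :: nat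
  have sum_h: "summable h" unfolding h_def
    using e c H \<theta> by (intro summable_add summable_mult summable_exp_neg_powr) auto
  obtain N where N: "\<And>T. N \<le> T \<Longrightarrow> c * T powr H \<le> s2 T \<and> (\<forall>u\<in>{0..T}. s2 u \<le> 4 * s2 T) \<and> 0 < s2 T"
  proof -
    have "\<forall>\<^sub>F T in at_top. c * T powr H \<le> s2 T \<and> (\<forall>u\<in>{0..T}. s2 u \<le> 4 * s2 T) \<and> 0 < s2 T"
      using growth eventually_s2_max s2_at_top[unfolded filterlim_at_top_dense, rule_format, of 0]
      by eventually_elim auto
    then show ?thesis using that by (auto simp: eventually_at_top_linorder)
  qed
  have "\<forall>\<^sub>F k::nat in sequentially. max N 1 \<le> real k"
    using filterlim_real_sequentially[unfolded filterlim_at_top] by blast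
  then have "\<forall>\<^sub>F k::nat in sequentially. prob (bad k) \<le> h k \<and> max N 1 \<le> real k"
    using incr
  proof eventually_elim
    case (elim k)
    have k: "N \<le> real k" using elim by simp
    have pos: "0 < s2 (real k)" using N[OF k] by simp
    have "prob {\<omega> \<in> space M. \<bar>V (real k) \<omega>\<bar> > e / 8 * s2 (real k)} \<le> 2 * exp (- (e / 8 * s2 (real k))\<^sup>2 / (2 * s2 (real k)))"
      using pos e by (intro prob_abs_gt_le V_in_G) (auto simp: s2_eq_cov)
    also have "- (e / 8 * s2 (real k))\<^sup>2 / (2 * s2 (real k)) = - (e\<^sup>2 / 128) * s2 (real k)"
      using pos by (simp add: power2_eq_square field_simps)
    also have "\<dots> \<le> - (e\<^sup>2 / 128) * (c * real k powr H)"
      using N[OF k] by (intro mult_left_mono_neg) auto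
    finally have 1: "prob {\<omega> \<in> space M. \<bar>V (real k) \<omega>\<bar> > e / 8 * s2 (real k)} \<le> 2 * exp (- (e\<^sup>2 * c / 128) * real k powr H)"
      by (simp add: field_simps)
    have 2: "prob (space M - {\<omega> \<in> space M. \<forall>t\<in>I. \<bar>V (t + real k) \<omega> - V (real k) \<omega>\<bar> \<le> (e / 2 * c) * real k powr H}) \<le> exp (- (1/2) * real k powr \<theta>)"
    proof -
      have "{\<omega> \<in> space M. \<forall>t\<in>I. \<bar>V (t + real k) \<omega> - V (real k) \<omega>\<bar> \<le> (e / 2 * c) * real k powr H} \<in> events"
        by measurable
      from prob_compl[OF this] show ?thesis using elim(2) by linarith
    qed
    have "prob (bad k) \<le> prob {\<omega> \<in> space M. \<bar>V (real k) \<omega>\<bar> > e / 8 * s2 (real k)}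
       + prob (space M - {\<omega> \<in> space M. \<forall>t\<in>I. \<bar>V (t + real k) \<omega> - V (real k) \<omega>\<bar> \<le> (e / 2 * c) * real k powr H})"
      unfolding bad_def by (intro measure_Un_le) measurable
    then show ?case using 1 2 elim by (simp add: h_def)
  qed
  then obtain K where K: "\<And>k. K \<le> k \<Longrightarrow> prob (bad k) \<le> h k \<and> max N 1 \<le> real k"
    by (auto simp: eventually_sequentially)
  obtain n0 where n0: "\<And>n. n0 \<le> n \<Longrightarrow> norm (\<Sum>i. h (i + n)) < d"
    using suminf_exist_split[OF d sum_h] by blast
  define k0 where "k0 = max K n0"
  have pbad: "prob (bad (i + k0)) \<le> h (i + k0)" for i using K[of "i + k0"] by (simp add: k0_def)
  have sum_h': "summable (\<lambda>i. h (i + k0))" using sum_h by (simp add: summable_iff_shift)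
  have sum_bad: "summable (\<lambda>i. prob (bad (i + k0)))"
    by (rule summable_comparison_test'[OF sum_h', of 0]) (use pbad in auto)
  have "prob (\<Union>i. bad (i + k0)) \<le> (\<Sum>i. prob (bad (i + k0)))"
    using sum_bad by (intro finite_measure_subadditive_countably) auto
  also have "\<dots> \<le> (\<Sum>i. h (i + k0))" using pbad sum_bad sum_h' by (intro suminf_le)
  also have "\<dots> \<le> d" using n0[of k0] by (simp add: k0_def)
  finally have "1 - d \<le> prob (space M - (\<Union>i. bad (i + k0)))"
    by (subst prob_compl) auto
  also have "\<dots> \<le> prob {\<omega> \<in> space M. \<forall>t\<in>{real k0..} \<inter> \<rat>. \<bar>V t \<omega>\<bar> \<le> e * s2 t}"
  proof (rule finite_measure_mono)
    have "countable ({real k0..} \<inter> \<rat>)" by (intro countable_Int2 countable_rat)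
    then show "{\<omega> \<in> space M. \<forall>t\<in>{real k0..} \<inter> \<rat>. \<bar>V t \<omega>\<bar> \<le> e * s2 t} \<in> events" by measurable
    have "\<bar>V t \<omega>\<bar> \<le> e * s2 t" if \<omega>: "\<omega> \<in> space M - (\<Union>i. bad (i + k0))" and t: "t \<in> {real k0..} \<inter> \<rat>" for \<omega> t
    proof -
      define k where "k = nat \<lfloor>t\<rfloor>"
      have "real k0 \<le> t" using t by simp
      then have "int k0 \<le> \<lfloor>t\<rfloor>" by (simp add: le_floor_iff)
      then have kk: "k0 \<le> k" "real k \<le> t" "t < real k + 1" using \<open>real k0 \<le> t\<close> by (auto simp: k_def)
      then obtain i where i: "k = i + k0" by (metis add.commute le_Suc_ex)
      have "K \<le> k" using kk by (simp add: k0_def)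
      then have Nk: "N \<le> real k" "1 \<le> real k" using K[of k] by auto
      have "\<omega> \<notin> bad k" using \<omega> i by blast
      then have b1: "\<bar>V (real k) \<omega>\<bar> \<le> e / 8 * s2 (real k)"
        and b2: "\<And>t. t \<in> I \<Longrightarrow> \<bar>V (t + real k) \<omega> - V (real k) \<omega>\<bar> \<le> (e / 2 * c) * real k powr H"
        using \<omega> by (auto simp: bad_def not_less)
      have "t - real k \<in> I" using kk t by (auto simp: I_def intro: Rats_diff)
      from b2[OF this] have b3: "\<bar>V t \<omega> - V (real k) \<omega>\<bar> \<le> (e / 2 * c) * real k powr H" by simp
      have Nt: "c * t powr H \<le> s2 t" "s2 (real k) \<le> 4 * s2 t" using N[of t] Nk kk by auto
      have "c * real k powr H \<le> c * t powr H" using kk c H by (intro mult_left_mono powr_mono2) auto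
      then have "e / 2 * (c * real k powr H) \<le> e / 2 * s2 t" using Nt e by (intro mult_left_mono) auto
      moreover have "e / 8 * s2 (real k) \<le> e / 8 * (4 * s2 t)" using Nt e by (intro mult_left_mono) auto
      moreover have "e / 8 * (4 * s2 t) + e / 2 * s2 t = e * s2 t" by simp
      moreover have "(e / 2 * c) * real k powr H = e / 2 * (c * real k powr H)" by simp
      ultimately show ?thesis using b1 b3 by linarith
    qed
    then show "space M - (\<Union>i. bad (i + k0)) \<subseteq> {\<omega> \<in> space M. \<forall>t\<in>{real k0..} \<inter> \<rat>. \<bar>V t \<omega>\<bar> \<le> e * s2 t}" by blast
  qed
  finally have "1 - d \<le> prob {\<omega> \<in> space M. \<forall>t\<in>{real k0..} \<inter> \<rat>. \<bar>V t \<omega>\<bar> \<le> e * s2 t}" .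
  moreover have "0 < real k0" using K[of k0] by (simp add: k0_def)
  ultimately show ?thesis by (rule that[rotated])
qed

end

section \<open>Asymptotics\<close>

lemma (in prob_space) prob_Int_ge:
  assumes A: "A \<in> events" "1 - a \<le> prob A" and B: "B \<in> events" "1 - b \<le> prob B"
  shows "1 - (a + b) \<le> prob (A \<inter> B)"
proof -
  have "prob A - prob (A \<inter> B) = prob (A - B)" using A B by (simp add: finite_measure_Diff')
  also have "\<dots> \<le> prob (space M - B)"
    using A B sets.sets_into_space by (intro finite_measure_mono) auto
  also have "\<dots> = 1 - prob B" using B by (simp add: prob_compl)
  finally show ?thesis using A B by linarith
qed

text \<open>Young's inequality from the nonnegative variance of \<open>e * X - Y\<close>. It is
  meant for a dominant \<open>X\<close> and a fixed correction \<open>Y\<close>: the leading cost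
  grows only by the factor \<open>1 + e\<close>.\<close>

lemma (in gaussian_space) cov_add_self_le:
  assumes X: "X \<in> G" and Y: "Y \<in> G" and e: "0 < e"
  shows "cov (\<lambda>\<omega>. X \<omega> + Y \<omega>) (\<lambda>\<omega>. X \<omega> + Y \<omega>) \<le> (1 + e) * cov X X + (1 + 1 / e) * cov Y Y"
proof -
  have eX: "(\<lambda>\<omega>. e * X \<omega>) \<in> G" using scale[OF X] .
  have eXY: "(\<lambda>\<omega>. e * X \<omega> - Y \<omega>) \<in> G" using diff[OF eX Y] .
  have "0 \<le> cov (\<lambda>\<omega>. e * X \<omega> - Y \<omega>) (\<lambda>\<omega>. e * X \<omega> - Y \<omega>)" by (rule cov_nonneg)
  also have "\<dots> = e * (e * cov X X) - 2 * (e * cov X Y) + cov Y Y"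
    using X Y eX eXY
    by (simp add: cov_diff_left cov_diff_right cov_scale_left cov_scale_right cov_commute[of Y X] algebra_simps)
  finally have "2 * (e * cov X Y) \<le> e * (e * cov X X) + cov Y Y" by simp
  then have "e * (2 * cov X Y) \<le> e * (e * cov X X + 1 / e * cov Y Y)"
    using e by (simp add: distrib_left)
  then have "2 * cov X Y \<le> e * cov X X + 1 / e * cov Y Y" using e by simp
  moreover have "cov (\<lambda>\<omega>. X \<omega> + Y \<omega>) (\<lambda>\<omega>. X \<omega> + Y \<omega>) = cov X X + 2 * cov X Y + cov Y Y"
    using X Y add[OF X Y] by (simp add: cov_add_left cov_add_right cov_commute[of Y X])
  ultimately show ?thesis by (simp add: distrib_right)
qed

lemma tendsto_of_eventually_near:
  fixes f :: "'b \<Rightarrow> real"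
  assumes "\<And>e. 0 < e \<Longrightarrow> \<forall>\<^sub>F x in F. \<bar>f x - L\<bar> \<le> e"
  shows "(f \<longlongrightarrow> L) F"
proof (rule tendstoI)
  fix e :: real assume "0 < e"
  then have "\<forall>\<^sub>F x in F. \<bar>f x - L\<bar> \<le> e / 2" by (intro assms) simp
  then show "\<forall>\<^sub>F x in F. dist (f x) L < e"
    by eventually_elim (use \<open>0 < e\<close> in \<open>simp add: dist_real_def\<close>)
qed

lemma neg_ln_ratio_near:
  fixes p v :: real
  assumes "0 < v" "exp (- (A + e) * v) \<le> p" "p \<le> exp (- (A - e) * v)"
  shows "\<bar>- ln p / v - A\<bar> \<le> e"
proof -
  have p: "0 < p" using assms(2) by (rule less_le_trans[OF exp_gt_zero])
  have "ln (exp (- (A + e) * v)) \<le> ln p" "ln p \<le> ln (exp (- (A - e) * v))"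
    using assms p by (auto simp: ln_le_cancel_iff simp del: ln_exp)
  then have "(A - e) * v \<le> - ln p" "- ln p \<le> (A + e) * v" by (simp_all only: ln_exp)
  then have "A - e \<le> - ln p / v" "- ln p / v \<le> A + e" by (simp_all only: pos_le_divide_eq[OF assms(1)] pos_divide_le_eq[OF assms(1)])
  then show ?thesis by linarith
qed

context stationary_gaussian
begin

text \<open>The common core of both lower bounds. The allowed deviation \<open>k\<close> may depend
  on \<open>t\<close>: a constant serves the expectation, the persistence estimate needs different
  sizes near 0, at moderate times and far out.\<close>

lemma prob_Z_ge:
  assumes \<xi>: "\<xi> \<in> G" and D: "countable D"
    and a: "\<And>t. t \<in> D \<Longrightarrow> a \<le> sqrt 2 * (cov \<xi> (V t) - k t) - s2 t"
  shows "exp (- cov \<xi> \<xi> / 2) * prob {\<omega> \<in> space M. \<forall>t\<in>D. \<bar>V t \<omega>\<bar> \<le> k t} \<le> prob {\<omega> \<in> space M. \<forall>t\<in>D. a \<le> Z t \<omega>}"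
proof -
  have "exp (- cov \<xi> \<xi> / 2) * prob {\<omega> \<in> space M. \<forall>t\<in>D. \<bar>V t \<omega>\<bar> \<le> k t}
     \<le> prob {\<omega> \<in> space M. \<forall>t\<in>D. \<bar>V t \<omega> - cov \<xi> (V t)\<bar> \<le> k t}"
    using D V_in_G \<xi> by (rule shifted_box_ge)
  also have "\<dots> \<le> prob {\<omega> \<in> space M. \<forall>t\<in>D. a \<le> Z t \<omega>}"
  proof (rule finite_measure_mono[OF _ Z_ball_event[OF D]])
    have "a \<le> Z t \<omega>" if "t \<in> D" "\<bar>V t \<omega> - cov \<xi> (V t)\<bar> \<le> k t" for t \<omega>
    proof -
      have "sqrt 2 * (cov \<xi> (V t) - k t) \<le> sqrt 2 * V t \<omega>" using that by (intro mult_left_mono) auto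
      then show ?thesis using a[OF that(1)] unfolding Z_def by linarith
    qed
    then show "{\<omega> \<in> space M. \<forall>t\<in>D. \<bar>V t \<omega> - cov \<xi> (V t)\<bar> \<le> k t} \<subseteq> {\<omega> \<in> space M. \<forall>t\<in>D. a \<le> Z t \<omega>}" by blast
  qed
  finally show ?thesis .
qed

end

context regularly_varying_gaussian
begin

lemma eventually_s2_pos: "\<forall>\<^sub>F T in at_top. c < s2 T"
  using s2_at_top by (simp add: filterlim_at_top_dense)

lemma eventually_s2_uniform:
  assumes "0 < e"
  shows "\<forall>\<^sub>F T in at_top. \<forall>s. \<bar>s\<bar> \<le> 1 \<longrightarrow> \<bar>s2 (T * s) - \<bar>s\<bar> powr (2 * H) * s2 T\<bar> \<le> e * s2 T"
  using rvn.eventually_uniform_square[OF assms] eventually_gt_at_top[of 0]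
proof eventually_elim
  case (elim T)
  show ?case
  proof (intro allI impI)
    fix s :: real assume "\<bar>s\<bar> \<le> 1"
    then have "\<bar>(\<sigma> (\<bar>s\<bar> * T))\<^sup>2 - \<bar>s\<bar> powr (2 * H) * (\<sigma> T)\<^sup>2\<bar> \<le> e * (\<sigma> T)\<^sup>2" using elim by simp
    moreover have "s2 (\<bar>s\<bar> * T) = s2 (T * s)"
      using s2_abs[of "T * s"] elim by (simp add: abs_mult mult.commute)
    ultimately show "\<bar>s2 (T * s) - \<bar>s\<bar> powr (2 * H) * s2 T\<bar> \<le> e * s2 T"
      by (simp add: s2_eq_square[symmetric])
  qed
qed

text \<open>Beyond \<open>t0\<close> the pathwise bound by \<open>e / 4 * s2 t\<close> suffices,
  since \<open>s2 t \<le> 4 * s2 T\<close>; before \<open>t0\<close> a fixed bound \<open>s\<close>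
  is overtaken by \<open>e * s2 T\<close>.\<close>

lemma eventually_paths_small:
  assumes e: "0 < e"
  shows "\<forall>\<^sub>F T in at_top. 1/2 \<le> prob {\<omega> \<in> space M. \<forall>t\<in>{0<..<T} \<inter> \<rat>. \<bar>V t \<omega>\<bar> \<le> e * s2 T}"
proof -
  obtain t0 where t0: "0 < t0" "1 - 1/4 \<le> prob {\<omega> \<in> space M. \<forall>t\<in>{t0..} \<inter> \<rat>. \<bar>V t \<omega>\<bar> \<le> e / 4 * s2 t}"
    using paths_eventually_small[of "e / 4" "1/4"] e by auto
  obtain s where s: "0 < s" "1 - 1/4 \<le> prob {\<omega> \<in> space M. \<forall>t\<in>{0..t0} \<inter> \<rat>. \<bar>V t \<omega>\<bar> \<le> s}"
    using bounded_paths[of "1/4" t0] by auto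
  have [simp]: "countable (A \<inter> \<rat>)" for A :: "real set" by (intro countable_Int2 countable_rat)
  let ?A = "{\<omega> \<in> space M. \<forall>t\<in>{t0..} \<inter> \<rat>. \<bar>V t \<omega>\<bar> \<le> e / 4 * s2 t}"
  let ?B = "{\<omega> \<in> space M. \<forall>t\<in>{0..t0} \<inter> \<rat>. \<bar>V t \<omega>\<bar> \<le> s}"
  have AB: "1 - (1/4 + 1/4) \<le> prob (?A \<inter> ?B)"
    using t0 s by (intro prob_Int_ge) measurable
  show ?thesis
    using eventually_s2_max eventually_s2_pos[of "s / e"]
  proof eventually_elim
    case (elim T)
    have "prob (?A \<inter> ?B) \<le> prob {\<omega> \<in> space M. \<forall>t\<in>{0<..<T} \<inter> \<rat>. \<bar>V t \<omega>\<bar> \<le> e * s2 T}"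
    proof (rule finite_measure_mono)
      show "?A \<inter> ?B \<subseteq> {\<omega> \<in> space M. \<forall>t\<in>{0<..<T} \<inter> \<rat>. \<bar>V t \<omega>\<bar> \<le> e * s2 T}"
      proof
        fix \<omega> assume \<omega>: "\<omega> \<in> ?A \<inter> ?B"
        have "\<bar>V t \<omega>\<bar> \<le> e * s2 T" if t: "t \<in> {0<..<T} \<inter> \<rat>" for t
        proof (cases "t \<le> t0")
          case True
          then have "\<bar>V t \<omega>\<bar> \<le> s" using \<omega> t by auto
          also have "s \<le> e * s2 T" using elim(2) e by (simp add: field_simps)
          finally show ?thesis .
        next
          case False
          then have "\<bar>V t \<omega>\<bar> \<le> e / 4 * s2 t" using \<omega> t by auto
          also have "\<dots> \<le> e / 4 * (4 * s2 T)" using elim(1) t e by (intro mult_left_mono) auto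
          finally show ?thesis by simp
        qed
        then show "\<omega> \<in> {\<omega> \<in> space M. \<forall>t\<in>{0<..<T} \<inter> \<rat>. \<bar>V t \<omega>\<bar> \<le> e * s2 T}" using \<omega> by blast
      qed
    qed measurable
    then show ?case using AB by simp
  qed
qed

text \<open>The uniform error enters with total weight 1, because the products
  \<open>m i * m j\<close> add up to 1.\<close>

lemma interaction_ge:
  fixes m x :: "nat \<Rightarrow> real"
  assumes unif: "\<forall>s. \<bar>s\<bar> \<le> 1 \<longrightarrow> \<bar>s2 (T * s) - \<bar>s\<bar> powr (2 * H) * s2 T\<bar> \<le> e * s2 T"
    and m: "\<And>j. j < n \<Longrightarrow> 0 \<le> m j" "(\<Sum>j<n. m j) = 1" and x: "\<And>j. j < n \<Longrightarrow> 0 \<le> x j \<and> x j \<le> 1"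
  shows "((\<Sum>i<n. \<Sum>j<n. m i * m j * \<bar>x i - x j\<bar> powr (2 * H)) - e) * s2 T
       \<le> (\<Sum>i<n. \<Sum>j<n. m i * m j * s2 (T * x i - T * x j))"
proof -
  have "((\<Sum>i<n. \<Sum>j<n. m i * m j * \<bar>x i - x j\<bar> powr (2 * H)) - e) * s2 T
     = (\<Sum>i<n. \<Sum>j<n. m i * m j * \<bar>x i - x j\<bar> powr (2 * H)) * s2 T - (\<Sum>i<n. m i) * (\<Sum>j<n. m j) * (e * s2 T)"
    by (simp add: m left_diff_distrib)
  also have "\<dots> = (\<Sum>i<n. \<Sum>j<n. m i * m j * (\<bar>x i - x j\<bar> powr (2 * H) * s2 T - e * s2 T))"
  proof -
    have "(\<Sum>i<n. m i) * (\<Sum>j<n. m j) * c = (\<Sum>i<n. \<Sum>j<n. m i * m j * c)" for c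
      by (subst sum_product) (simp only: sum_distrib_right)
    then show ?thesis by (simp only: sum_distrib_right sum_subtractf right_diff_distrib mult.assoc)
  qed
  also have "\<dots> \<le> (\<Sum>i<n. \<Sum>j<n. m i * m j * s2 (T * x i - T * x j))"
  proof (intro sum_mono mult_left_mono)
    fix i j assume "i \<in> {..<n}" "j \<in> {..<n}"
    then have "\<bar>x i - x j\<bar> \<le> 1" using x[of i] x[of j] by (auto simp: abs_le_iff)
    then have "\<bar>s2 (T * (x i - x j)) - \<bar>x i - x j\<bar> powr (2 * H) * s2 T\<bar> \<le> e * s2 T" using unif by blast
    then show "\<bar>x i - x j\<bar> powr (2 * H) * s2 T - e * s2 T \<le> s2 (T * x i - T * x j)"
      by (simp add: right_diff_distrib abs_le_iff)
  qed (use m in auto)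
  finally show ?thesis .
qed

lemma expected_infimum_upper:
  assumes e: "0 < e"
  shows "\<forall>\<^sub>F T in at_top. expected_infimum M V T \<le> exp (- (A_fbm H - e) * (s2 T / 2))"
proof -
  define e' where "e' = e / 2"
  have e': "0 < e'" using e by (simp add: e'_def)
  obtain n :: nat and m x :: "nat \<Rightarrow> real" where
    m0: "\<forall>j<n. 0 \<le> m j" and x0: "\<forall>j<n. 0 \<le> x j \<and> x j \<le> 1" and m1: "(\<Sum>j<n. m j) = 1"
    and \<phi>: "\<forall>s\<in>{0..1}. (\<Sum>j<n. m j * \<bar>s - x j\<bar> powr (2 * H))
       \<le> (\<Sum>j<n. m j * x j powr (2 * H)) + e' * s powr (2 * H)"
    and \<phi>0: "\<bar>(\<Sum>j<n. m j * x j powr (2 * H)) - A_fbm H\<bar> \<le> e'"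
    and I: "A_fbm H - e' \<le> (\<Sum>i<n. \<Sum>j<n. m i * m j * \<bar>x i - x j\<bar> powr (2 * H))"
    using ex_discrete_equilibrium[OF H e'] .
  have m: "\<And>j. j < n \<Longrightarrow> 0 \<le> m j" "(\<Sum>j<n. m j) = 1" and x: "\<And>j. j < n \<Longrightarrow> 0 \<le> x j \<and> x j \<le> 1"
    using m0 m1 x0 by auto
  show ?thesis
    using eventually_s2_uniform[OF e'] eventually_gt_at_top[of 0]
  proof eventually_elim
    case (elim T)
    have "(A_fbm H - e) * s2 T \<le> ((\<Sum>i<n. \<Sum>j<n. m i * m j * \<bar>x i - x j\<bar> powr (2 * H)) - e') * s2 T"
      using I s2_nonneg[of T] by (intro mult_right_mono) (auto simp: e'_def)
    also have "\<dots> \<le> (\<Sum>i<n. \<Sum>j<n. m i * m j * s2 (T * x i - T * x j))"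
      using elim(1) m x by (rule interaction_ge)
    finally have le: "(A_fbm H - e) * s2 T \<le> (\<Sum>i<n. \<Sum>j<n. m i * m j * s2 (T * x i - T * x j))" .
    have "expected_infimum M V T \<le> exp (- (\<Sum>i<n. \<Sum>j<n. m i * m j * s2 (T * x i - T * x j)) / 2)"
      using elim m x by (intro expected_infimum_le) auto
    also have "\<dots> \<le> exp (- (A_fbm H - e) * (s2 T / 2))" using le by (simp add: algebra_simps)
    finally show ?case .
  qed
qed

lemma expected_infimum_lower:
  assumes e: "0 < e"
  shows "\<forall>\<^sub>F T in at_top. exp (- (A_fbm H + e) * (s2 T / 2)) \<le> expected_infimum M V T"
proof -
  \<comment> \<open>\<open>10 e'\<close> for the slack in the paths, \<open>6 e'\<close> for the variance, \<open>e'\<close> for the factor \<open>1/2\<close>\<close>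
  define e' where "e' = e / 17"
  have e': "0 < e'" using e by (simp add: e'_def)
  obtain n :: nat and m x :: "nat \<Rightarrow> real" where
    m0: "\<forall>j<n. 0 \<le> m j" and x0: "\<forall>j<n. 0 \<le> x j \<and> x j \<le> 1" and m1: "(\<Sum>j<n. m j) = 1"
    and \<phi>: "\<forall>s\<in>{0..1}. (\<Sum>j<n. m j * \<bar>s - x j\<bar> powr (2 * H))
       \<le> (\<Sum>j<n. m j * x j powr (2 * H)) + e' * s powr (2 * H)"
    and \<phi>0: "\<bar>(\<Sum>j<n. m j * x j powr (2 * H)) - A_fbm H\<bar> \<le> e'"
    and I: "A_fbm H - e' \<le> (\<Sum>i<n. \<Sum>j<n. m i * m j * \<bar>x i - x j\<bar> powr (2 * H))"
    using ex_discrete_equilibrium[OF H e'] .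
  have m: "\<And>j. j < n \<Longrightarrow> 0 \<le> m j" "(\<Sum>j<n. m j) = 1" and x: "\<And>j. j < n \<Longrightarrow> 0 \<le> x j \<and> x j \<le> 1"
    using m0 m1 x0 by auto
  show ?thesis
    using eventually_s2_uniform[OF e'] eventually_gt_at_top[of 0] eventually_paths_small[OF e']
      eventually_s2_pos[of "2 * ln 2 / e'"]
  proof eventually_elim
    case (elim T)
    let ?D = "{0<..<T} \<inter> (\<rat> :: real set)"
    define \<phi>0 where "\<phi>0 = (\<Sum>j<n. m j * x j powr (2 * H))"
    define \<xi>1 where "\<xi>1 \<omega> = (\<Sum>j<n. m j * V (T * x j) \<omega>)" for \<omega>
    \<comment> \<open>With this factor the shift of \<open>sqrt 2 * V t\<close> is
      \<open>2 * cov \<xi>1 (V t)\<close>, the quantity that matches \<open>s2 t\<close>.\<close>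
    define \<xi> where "\<xi> \<omega> = sqrt 2 * \<xi>1 \<omega>" for \<omega>
    note \<xi>1 = cov_weighted_V[OF m(2), of "\<lambda>j. T * x j", folded \<xi>1_def]
    have \<xi>: "\<xi> \<in> G" unfolding \<xi>_def[abs_def] using scale[OF \<xi>1(1)] .
    have unif: "\<bar>s2 (T * s) - \<bar>s\<bar> powr (2 * H) * s2 T\<bar> \<le> e' * s2 T" if "\<bar>s\<bar> \<le> 1" for s
      using elim(1) that by blast
    have sum_const: "(\<Sum>j<n. m j * (y j * s2 T + d * (e' * s2 T))) = (\<Sum>j<n. m j * y j) * s2 T + d * (e' * s2 T)" for y d
      by (simp add: distrib_left sum.distrib sum_distrib_right[symmetric] m mult.assoc[symmetric])
    have q_lower: "\<phi>0 * s2 T - e' * s2 T \<le> (\<Sum>j<n. m j * s2 (T * x j))"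
    proof -
      have "\<phi>0 * s2 T - e' * s2 T = (\<Sum>j<n. m j * (x j powr (2 * H) * s2 T + (-1) * (e' * s2 T)))"
        unfolding sum_const \<phi>0_def by simp
      also have "\<dots> \<le> (\<Sum>j<n. m j * s2 (T * x j))"
        using x m unif by (intro sum_mono mult_left_mono) (fastforce simp: abs_le_iff)+
      finally show ?thesis .
    qed
    have q_upper: "(\<Sum>j<n. m j * s2 (T * x j)) \<le> \<phi>0 * s2 T + e' * s2 T"
    proof -
      have "(\<Sum>j<n. m j * s2 (T * x j)) \<le> (\<Sum>j<n. m j * (x j powr (2 * H) * s2 T + 1 * (e' * s2 T)))"
        using x m unif by (intro sum_mono mult_left_mono) (fastforce simp: abs_le_iff)+
      also have "\<dots> = \<phi>0 * s2 T + e' * s2 T" unfolding sum_const \<phi>0_def by simp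
      finally show ?thesis .
    qed
    \<comment> \<open>The variance is twice the weighted average minus the double sum, at most
      \<open>2 * (A + 2 * e') - (A - 2 * e')\<close> in units of \<open>s2 T\<close>, where
      \<open>A\<close> is \<open>A_fbm H\<close>.\<close>
    have cov_\<xi>: "cov \<xi> \<xi> \<le> (A_fbm H + 6 * e') * s2 T"
    proof -
      have "(A_fbm H - 2 * e') * s2 T \<le> ((\<Sum>i<n. \<Sum>j<n. m i * m j * \<bar>x i - x j\<bar> powr (2 * H)) - e') * s2 T"
        using I s2_nonneg[of T] by (intro mult_right_mono) auto
      also have "\<dots> \<le> (\<Sum>i<n. \<Sum>j<n. m i * m j * s2 (T * x i - T * x j))"
        using elim(1) m x by (rule interaction_ge)
      finally have D: "(A_fbm H - 2 * e') * s2 T \<le> (\<Sum>i<n. \<Sum>j<n. m i * m j * s2 (T * x i - T * x j))" .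
      have "\<phi>0 * s2 T \<le> (A_fbm H + e') * s2 T"
        using \<phi>0 s2_nonneg[of T] by (intro mult_right_mono) (auto simp: \<phi>0_def abs_le_iff)
      then have "(\<Sum>j<n. m j * s2 (T * x j)) \<le> (A_fbm H + 2 * e') * s2 T"
        using q_upper by (simp add: distrib_right)
      moreover have "cov \<xi> \<xi> = 2 * cov \<xi>1 \<xi>1"
        unfolding \<xi>_def[abs_def] cov_scale_left cov_scale_right by (simp flip: mult.assoc)
      ultimately show ?thesis using D unfolding \<xi>1(3) by (simp add: distrib_right left_diff_distrib)
    qed
    \<comment> \<open>Of the slack 5, three units are the excess of the potential and the two
      uniform errors, in the potential and in the average. The other two bound the path deviation
      after multiplication by \<open>sqrt 2\<close>.\<close>
    have "exp (- cov \<xi> \<xi> / 2) * prob {\<omega> \<in> space M. \<forall>t\<in>?D. \<bar>V t \<omega>\<bar> \<le> e' * s2 T}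
        \<le> prob {\<omega> \<in> space M. \<forall>t\<in>?D. - 5 * e' * s2 T \<le> Z t \<omega>}"
    proof (rule prob_Z_ge[OF \<xi>])
      fix t assume t: "t \<in> ?D"
      define s where "s = t / T"
      have s: "0 \<le> s" "s \<le> 1" "t = T * s" using t elim by (auto simp: s_def)
      have "(\<Sum>j<n. m j * s2 (t - T * x j)) \<le> (\<Sum>j<n. m j * (\<bar>s - x j\<bar> powr (2 * H) * s2 T + 1 * (e' * s2 T)))"
      proof (intro sum_mono mult_left_mono)
        fix j assume "j \<in> {..<n}"
        then have "\<bar>s - x j\<bar> \<le> 1" using x[of j] s by (auto simp: abs_le_iff)
        from unif[OF this] show "s2 (t - T * x j) \<le> \<bar>s - x j\<bar> powr (2 * H) * s2 T + 1 * (e' * s2 T)"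
          by (simp add: s(3) right_diff_distrib abs_le_iff)
      qed (use m in auto)
      also have "\<dots> = (\<Sum>j<n. m j * \<bar>s - x j\<bar> powr (2 * H)) * s2 T + e' * s2 T" unfolding sum_const by simp
      also have "\<dots> \<le> (\<phi>0 + e') * s2 T + e' * s2 T"
      proof -
        have "e' * s powr (2 * H) \<le> e' * 1" using s e' H by (intro mult_left_mono powr_le1) auto
        then have "(\<Sum>j<n. m j * \<bar>s - x j\<bar> powr (2 * H)) \<le> \<phi>0 + e'" using \<phi>[rule_format, of s] s(1,2) by (simp add: \<phi>0_def)
        then show ?thesis using s2_nonneg[of T] by (intro add_right_mono mult_right_mono)
      qed
      finally have "s2 t - 3 * (e' * s2 T) \<le> 2 * cov \<xi>1 (V t)"
        using q_lower unfolding \<xi>1(2) by (simp add: distrib_right)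
      moreover have "sqrt 2 * cov \<xi> (V t) = 2 * cov \<xi>1 (V t)"
        unfolding \<xi>_def[abs_def] cov_scale_left by (simp flip: mult.assoc)
      moreover have "sqrt 2 * (e' * s2 T) \<le> 2 * (e' * s2 T)"
        using e' s2_nonneg[of T] by (intro mult_right_mono real_le_lsqrt) auto
      ultimately show "- 5 * e' * s2 T \<le> sqrt 2 * (cov \<xi> (V t) - e' * s2 T) - s2 t"
        by (simp add: right_diff_distrib)
    qed (intro countable_Int2 countable_rat)
    moreover have "exp (- cov \<xi> \<xi> / 2) * (1/2) \<le> exp (- cov \<xi> \<xi> / 2) * prob {\<omega> \<in> space M. \<forall>t\<in>?D. \<bar>V t \<omega>\<bar> \<le> e' * s2 T}"
      using elim(3) by (intro mult_left_mono) auto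
    ultimately have "exp (- cov \<xi> \<xi> / 2) * (1/2) \<le> prob {\<omega> \<in> space M. \<forall>t\<in>?D. - 5 * e' * s2 T \<le> Z t \<omega>}" by linarith
    then have "exp (- 5 * e' * s2 T) * (exp (- cov \<xi> \<xi> / 2) * (1/2)) \<le> exp (- 5 * e' * s2 T) * prob {\<omega> \<in> space M. \<forall>t\<in>?D. - 5 * e' * s2 T \<le> Z t \<omega>}"
      by (intro mult_left_mono) auto
    also have "\<dots> \<le> expected_infimum M V T" using elim(2) by (rule expected_infimum_ge)
    finally have G: "exp (- 5 * e' * s2 T) * (exp (- cov \<xi> \<xi> / 2) * (1/2)) \<le> expected_infimum M V T" .
    have "ln 2 \<le> e' * s2 T / 2" using elim(4) e' by (simp add: field_simps)
    then have "- (A_fbm H + e) * (s2 T / 2) \<le> - 5 * e' * s2 T + (- cov \<xi> \<xi> / 2 + - ln 2)"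
      using cov_\<xi> by (simp add: e'_def field_simps)
    then have "exp (- (A_fbm H + e) * (s2 T / 2)) \<le> exp (- 5 * e' * s2 T + (- cov \<xi> \<xi> / 2 + - ln 2))" by simp
    also have "\<dots> = exp (- 5 * e' * s2 T) * (exp (- cov \<xi> \<xi> / 2) * (1/2))"
      by (simp only: exp_add exp_minus[of "ln 2"]) simp
    finally show ?case using G by linarith
  qed
qed

theorem expected_infimum_decay:
  "((\<lambda>T. - ln (expected_infimum M V T) / variogram M V T) \<longlongrightarrow> A_fbm H) at_top"
proof (rule tendsto_of_eventually_near)
  fix e :: real assume e: "0 < e"
  show "\<forall>\<^sub>F T in at_top. \<bar>- ln (expected_infimum M V T) / variogram M V T - A_fbm H\<bar> \<le> e"
    using expected_infimum_upper[OF e] expected_infimum_lower[OF e] eventually_s2_pos[of 0]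
    by eventually_elim (simp only: variogram_eq, rule neg_ln_ratio_near, auto)
qed

end

section \<open>Persistence of fractional Brownian motion\<close>

locale fractional_brownian = stationary_gaussian M V for M :: "'a measure" and V +
  fixes H :: real
  assumes fbm_H: "0 < H" "H < 1" and s2_fbm: "var_fun M V t = \<bar>t\<bar> powr (2 * H)"
begin

sublocale regularly_varying_gaussian M V H
proof
  have s: "std_fun M V t = t powr H" if "0 < t" for t
    using that by (simp add: std_fun_def s2_fbm powr_half_sqrt[symmetric] powr_powr)
  show "regularly_varying (std_fun M V) H"
    unfolding regularly_varying_def
  proof (intro conjI allI impI)
    show "\<forall>\<^sub>F t in at_top. 0 < std_fun M V t"
      using eventually_gt_at_top[of 0] by eventually_elim (simp add: s)
    fix l :: real assume l: "0 < l"
    have "\<forall>\<^sub>F t in at_top. l powr H = std_fun M V (l * t) / std_fun M V t"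
      using eventually_gt_at_top[of 0] by eventually_elim (use l in \<open>simp add: s powr_mult\<close>)
    then show "((\<lambda>t. std_fun M V (l * t) / std_fun M V t) \<longlongrightarrow> l powr H) at_top"
      by (rule Lim_transform_eventually[OF tendsto_const])
  qed
qed (use fbm_H in auto)

text \<open>Exact scaling turns the excess \<open>\<epsilon> * s powr (2 * H)\<close> of the
  potential into \<open>\<epsilon> * s2 t\<close>, so \<open>2 * cov \<xi>1 (V t)\<close> reaches
  \<open>(1 - \<epsilon>) * s2 t\<close> at every time. Amplifying by \<kappa> lifts this to
  \<open>(1 + \<epsilon>) * s2 t\<close>, a surplus available down to the origin.\<close>

lemma persistence_prob_lower:
  assumes C: "C < 0" and e: "0 < e"
  shows "\<forall>\<^sub>F T in at_top. exp (- (A_fbm H + e) * (s2 T / 2)) \<le> persistence_prob M V T C"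
proof -
  \<comment> \<open>The three factors are the price of adding the fixed correction, the square of
    the amplification \<kappa>, and the cost of the unamplified shift,
    \<open>2 * (A + \<epsilon>) - (A - \<epsilon>)\<close> with \<open>A = A_fbm H\<close>. At
    \<epsilon> = 0 their product is \<open>A_fbm H\<close>.\<close>
  obtain \<epsilon> where \<epsilon>: "0 < \<epsilon>" "\<epsilon> < 1/2" "(1 + \<epsilon>) * ((1 + \<epsilon>) / (1 - \<epsilon>))\<^sup>2 * (A_fbm H + 3 * \<epsilon>) < A_fbm H + e / 2"
  proof -
    have "((\<lambda>\<epsilon>. (1 + \<epsilon>) * ((1 + \<epsilon>) / (1 - \<epsilon>))\<^sup>2 * (A_fbm H + 3 * \<epsilon>)) \<longlongrightarrow> (1 + 0) * ((1 + 0) / (1 - 0))\<^sup>2 * (A_fbm H + 3 * 0)) (at_right 0)"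
      by (intro tendsto_intros) auto
    then have "\<forall>\<^sub>F \<epsilon> in at_right 0. (1 + \<epsilon>) * ((1 + \<epsilon>) / (1 - \<epsilon>))\<^sup>2 * (A_fbm H + 3 * \<epsilon>) < A_fbm H + e / 2"
      using e by (intro order_tendstoD(2)) auto
    moreover have "\<forall>\<^sub>F \<epsilon>::real in at_right 0. \<epsilon> < 1/2" "\<forall>\<^sub>F \<epsilon>::real in at_right 0. 0 < \<epsilon>"
      by (auto simp: eventually_at_right_less intro!: eventually_at_right_real[of 0 "1/2", THEN eventually_mono])
    ultimately have "\<forall>\<^sub>F \<epsilon> in at_right 0. 0 < \<epsilon> \<and> \<epsilon> < 1/2 \<and> (1 + \<epsilon>) * ((1 + \<epsilon>) / (1 - \<epsilon>))\<^sup>2 * (A_fbm H + 3 * \<epsilon>) < A_fbm H + e / 2"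
      by eventually_elim auto
    from eventually_happens'[OF _ this] show ?thesis using that by (auto simp: trivial_limit_at_right_real)
  qed
  define \<kappa> where "\<kappa> = (1 + \<epsilon>) / (1 - \<epsilon>)"
  have \<kappa>: "\<kappa> * (1 - \<epsilon>) = 1 + \<epsilon>" "\<kappa> > 0" using \<epsilon> by (auto simp: \<kappa>_def)
  obtain n :: nat and m x :: "nat \<Rightarrow> real" where
    m0: "\<forall>j<n. 0 \<le> m j" and x0: "\<forall>j<n. 0 \<le> x j \<and> x j \<le> 1" and m1: "(\<Sum>j<n. m j) = 1"
    and \<phi>: "\<forall>s\<in>{0..1}. (\<Sum>j<n. m j * \<bar>s - x j\<bar> powr (2 * H))
       \<le> (\<Sum>j<n. m j * x j powr (2 * H)) + \<epsilon> * s powr (2 * H)"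
    and \<phi>0: "\<bar>(\<Sum>j<n. m j * x j powr (2 * H)) - A_fbm H\<bar> \<le> \<epsilon>"
    and I: "A_fbm H - \<epsilon> \<le> (\<Sum>i<n. \<Sum>j<n. m i * m j * \<bar>x i - x j\<bar> powr (2 * H))"
    using ex_discrete_equilibrium[OF H \<epsilon>(1)] .
  have m: "\<And>j. j < n \<Longrightarrow> 0 \<le> m j" "(\<Sum>j<n. m j) = 1" and x: "\<And>j. j < n \<Longrightarrow> 0 \<le> x j \<and> x j \<le> 1"
    using m0 m1 x0 by auto
  obtain t0 where t0: "0 < t0" "1 - 1/8 \<le> prob {\<omega> \<in> space M. \<forall>t\<in>{t0..} \<inter> \<rat>. \<bar>V t \<omega>\<bar> \<le> \<epsilon> / 2 * s2 t}"
    using paths_eventually_small[of "\<epsilon> / 2" "1/8"] \<epsilon> by auto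
  obtain R where R: "0 < R" "1 - 1/8 \<le> prob {\<omega> \<in> space M. \<forall>t\<in>{0..t0} \<inter> \<rat>. \<bar>V t \<omega>\<bar> \<le> R}"
    using bounded_paths[of "1/8" t0] by auto
  obtain \<eta> where \<eta>: "0 < \<eta>" "1 - 1/8 \<le> prob {\<omega> \<in> space M. \<forall>t\<in>{0..\<eta>} \<inter> \<rat>. \<bar>V t \<omega>\<bar> \<le> - C / 4}"
    using small_near_zero[of "- C / 4" "1/8"] C by auto
  \<comment> \<open>The shift \<open>\<xi>2\<close> exceeds the barrier by \<open>\<epsilon> s2 t\<close>, enough beyond \<open>t0\<close>; on \<open>[\<eta>, t0]\<close> the multiple
    \<open>L\<close> of \<open>V t0\<close> absorbs paths of size \<open>R\<close>; on \<open>[0, \<eta>]\<close> the level \<open>C < 0\<close> leaves room.\<close>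
  define k where "k t = (if t \<le> \<eta> then - C / 4 else if t \<le> t0 then R else \<epsilon> / 2 * s2 t)" for t
  \<comment> \<open>For \<open>t\<close> between \<eta> and \<open>t0\<close> the covariance with
    \<open>V t0\<close> is at least \<open>s2 \<eta> / 2\<close>, so this multiple lifts the path by
    at least \<open>R\<close>.\<close>
  define L where "L = 2 * R / s2 \<eta>"
  have s2\<eta>: "0 < s2 \<eta>" using \<eta> by (simp add: s2_fbm)
  have L: "0 < L" using R s2\<eta> by (simp add: L_def)
  \<comment> \<open>Cost of the correction by \<open>V t0\<close>. It does not depend on
    \<open>T\<close>, so it is negligible against \<open>s2 T\<close>.\<close>
  define K where "K = (1 + 1 / \<epsilon>) * (L\<^sup>2 * s2 t0)"
  have [simp]: "countable (A \<inter> \<rat>)" for A :: "real set" by (intro countable_Int2 countable_rat)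
  have prob_k: "1/2 \<le> prob {\<omega> \<in> space M. \<forall>t\<in>{0<..<T} \<inter> \<rat>. \<bar>V t \<omega>\<bar> \<le> k t}" for T
  proof -
    let ?A = "{\<omega> \<in> space M. \<forall>t\<in>{t0..} \<inter> \<rat>. \<bar>V t \<omega>\<bar> \<le> \<epsilon> / 2 * s2 t}"
    let ?B = "{\<omega> \<in> space M. \<forall>t\<in>{0..t0} \<inter> \<rat>. \<bar>V t \<omega>\<bar> \<le> R}"
    let ?C = "{\<omega> \<in> space M. \<forall>t\<in>{0..\<eta>} \<inter> \<rat>. \<bar>V t \<omega>\<bar> \<le> - C / 4}"
    have ev: "?A \<in> events" "?B \<in> events" "?C \<in> events" by measurable
    have "1 - ((1/8 + 1/8) + 1/8) \<le> prob (?A \<inter> ?B \<inter> ?C)"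
      using t0 R \<eta> ev by (intro prob_Int_ge sets.Int) auto
    also have "\<dots> \<le> prob {\<omega> \<in> space M. \<forall>t\<in>{0<..<T} \<inter> \<rat>. \<bar>V t \<omega>\<bar> \<le> k t}"
    proof (rule finite_measure_mono)
      show "?A \<inter> ?B \<inter> ?C \<subseteq> {\<omega> \<in> space M. \<forall>t\<in>{0<..<T} \<inter> \<rat>. \<bar>V t \<omega>\<bar> \<le> k t}"
        by (auto simp: k_def)
    qed measurable
    finally show ?thesis by simp
  qed
  show ?thesis
    using eventually_gt_at_top[of 0] eventually_s2_pos[of "(K + 2 * ln 2) / (e / 2)"]
  proof eventually_elim
    case (elim T)
    let ?D = "{0<..<T} \<inter> (\<rat> :: real set)"
    define \<xi>1 where "\<xi>1 \<omega> = (\<Sum>j<n. m j * V (T * x j) \<omega>)" for \<omega>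
    define \<xi>2 where "\<xi>2 \<omega> = (sqrt 2 * \<kappa>) * \<xi>1 \<omega>" for \<omega>
    define \<xi>3 where "\<xi>3 \<omega> = L * V t0 \<omega>" for \<omega>
    define \<xi> where "\<xi> \<omega> = \<xi>2 \<omega> + \<xi>3 \<omega>" for \<omega>
    note \<xi>1 = cov_weighted_V[OF m(2), of "\<lambda>j. T * x j", folded \<xi>1_def]
    have \<xi>23: "\<xi>2 \<in> G" "\<xi>3 \<in> G" unfolding \<xi>2_def[abs_def] \<xi>3_def[abs_def] using scale \<xi>1(1) V_in_G by auto
    have \<xi>: "\<xi> \<in> G" unfolding \<xi>_def[abs_def] using add[OF \<xi>23] .
    have s2T: "s2 (T * s) = \<bar>s\<bar> powr (2 * H) * s2 T" for s
      using elim by (simp add: s2_fbm abs_mult powr_mult mult.commute)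
    have q: "(\<Sum>j<n. m j * s2 (T * x j)) = (\<Sum>j<n. m j * x j powr (2 * H)) * s2 T"
      unfolding s2T sum_distrib_right using x by (intro sum.cong) auto
    have cov_\<xi>: "cov \<xi> \<xi> \<le> (A_fbm H + e / 2) * s2 T + K"
    proof -
      have dd: "(\<Sum>i<n. \<Sum>j<n. m i * m j * s2 (T * x i - T * x j)) = (\<Sum>i<n. \<Sum>j<n. m i * m j * \<bar>x i - x j\<bar> powr (2 * H)) * s2 T"
        by (simp only: right_diff_distrib[symmetric] s2T sum_distrib_right mult.assoc)
      have "cov \<xi>1 \<xi>1 = ((\<Sum>j<n. m j * x j powr (2 * H)) - (\<Sum>i<n. \<Sum>j<n. m i * m j * \<bar>x i - x j\<bar> powr (2 * H)) / 2) * s2 T"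
        unfolding \<xi>1(3) q dd by (simp add: left_diff_distrib)
      also have "\<dots> \<le> ((A_fbm H + 3 * \<epsilon>) / 2) * s2 T"
        using I \<phi>0 s2_nonneg[of T] by (intro mult_right_mono) (auto simp: abs_le_iff)
      finally have "2 * \<kappa>\<^sup>2 * cov \<xi>1 \<xi>1 \<le> 2 * \<kappa>\<^sup>2 * (((A_fbm H + 3 * \<epsilon>) / 2) * s2 T)"
        by (intro mult_left_mono) auto
      moreover have "cov \<xi>2 \<xi>2 = 2 * \<kappa>\<^sup>2 * cov \<xi>1 \<xi>1"
        unfolding \<xi>2_def[abs_def] cov_scale_left cov_scale_right by (simp add: power2_eq_square flip: mult.assoc)
      ultimately have "cov \<xi>2 \<xi>2 \<le> \<kappa>\<^sup>2 * (A_fbm H + 3 * \<epsilon>) * s2 T" by simp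
      then have "(1 + \<epsilon>) * cov \<xi>2 \<xi>2 \<le> (1 + \<epsilon>) * (\<kappa>\<^sup>2 * (A_fbm H + 3 * \<epsilon>) * s2 T)"
        using \<epsilon> by (intro mult_left_mono) auto
      also have "\<dots> = ((1 + \<epsilon>) * \<kappa>\<^sup>2 * (A_fbm H + 3 * \<epsilon>)) * s2 T" by simp
      also have "\<dots> \<le> (A_fbm H + e / 2) * s2 T"
        using \<epsilon>(3) s2_nonneg[of T] by (intro mult_right_mono) (auto simp: \<kappa>_def)
      finally have "(1 + \<epsilon>) * cov \<xi>2 \<xi>2 \<le> (A_fbm H + e / 2) * s2 T" .
      moreover have "(1 + 1 / \<epsilon>) * cov \<xi>3 \<xi>3 = K"
        unfolding \<xi>3_def[abs_def] cov_scale_left cov_scale_right by (simp add: K_def s2_eq_cov power2_eq_square)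
      ultimately show ?thesis
        using cov_add_self_le[OF \<xi>23 \<epsilon>(1)] unfolding \<xi>_def[abs_def] by linarith
    qed
    have "exp (- cov \<xi> \<xi> / 2) * prob {\<omega> \<in> space M. \<forall>t\<in>?D. \<bar>V t \<omega>\<bar> \<le> k t}
        \<le> prob {\<omega> \<in> space M. \<forall>t\<in>?D. C / 2 \<le> Z t \<omega>}"
    proof (rule prob_Z_ge[OF \<xi>])
      fix t assume t: "t \<in> ?D"
      define s where "s = t / T"
      have s: "0 \<le> s" "s \<le> 1" "t = T * s" "0 < t" using t elim by (auto simp: s_def)
      have "(\<Sum>j<n. m j * s2 (t - T * x j)) = (\<Sum>j<n. m j * \<bar>s - x j\<bar> powr (2 * H)) * s2 T"
        by (simp only: s(3) right_diff_distrib[symmetric] s2T sum_distrib_right mult.assoc)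
      also have "\<dots> \<le> ((\<Sum>j<n. m j * x j powr (2 * H)) + \<epsilon> * s powr (2 * H)) * s2 T"
        using \<phi> s(1,2) s2_nonneg[of T] by (intro mult_right_mono) auto
      also have "\<dots> = (\<Sum>j<n. m j * s2 (T * x j)) + \<epsilon> * s2 t"
        unfolding q using s2T[of s] s by (simp add: distrib_right)
      finally have "(1 - \<epsilon>) * s2 t \<le> 2 * cov \<xi>1 (V t)"
        unfolding \<xi>1(2) by (simp add: left_diff_distrib)
      then have "\<kappa> * ((1 - \<epsilon>) * s2 t) \<le> \<kappa> * (2 * cov \<xi>1 (V t))" using \<kappa> by (intro mult_left_mono) auto
      moreover have "\<kappa> * ((1 - \<epsilon>) * s2 t) = (1 + \<epsilon>) * s2 t" using \<kappa>(1) by (simp flip: mult.assoc)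
      moreover have "sqrt 2 * cov \<xi>2 (V t) = \<kappa> * (2 * cov \<xi>1 (V t))"
        unfolding \<xi>2_def[abs_def] cov_scale_left by (simp flip: mult.assoc)
      ultimately have c2: "s2 t + \<epsilon> * s2 t \<le> sqrt 2 * cov \<xi>2 (V t)" by (simp add: distrib_right)
      \<comment> \<open>Up to \<open>t0\<close> the distance to \<open>t0\<close> is at most
        \<open>t0\<close>, so the covariance keeps half of \<open>s2 t\<close>. Later the distance
        is at most \<open>t\<close>, which still gives a nonnegative covariance: the correction
        never pushes the path down.\<close>
      have c3: "0 \<le> cov (V t0) (V t)" "t \<le> t0 \<Longrightarrow> s2 t / 2 \<le> cov (V t0) (V t)"
      proof -
        have le: "\<bar>t0 - t\<bar> powr (2 * H) \<le> t0 powr (2 * H)" if "t \<le> t0"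
          using that s(4) fbm_H by (intro powr_mono2) auto
        have le': "\<bar>t0 - t\<bar> powr (2 * H) \<le> t powr (2 * H)" if "\<not> t \<le> t0"
          using that t0(1) fbm_H by (intro powr_mono2) auto
        have "\<bar>t0 - t\<bar> powr (2 * H) \<le> t0 powr (2 * H) + t powr (2 * H)"
          using le le' powr_ge_zero[of t0 "2 * H"] powr_ge_zero[of t "2 * H"] by linarith
        then show "0 \<le> cov (V t0) (V t)" using t0(1) s(4) by (simp add: cov_V s2_fbm)
        show "s2 t / 2 \<le> cov (V t0) (V t)" if "t \<le> t0"
          using le[OF that] t0(1) s(4) by (simp add: cov_V s2_fbm)
      qed
      have cov_eq: "sqrt 2 * (cov \<xi> (V t) - k t) = sqrt 2 * cov \<xi>2 (V t) + sqrt 2 * (L * cov (V t0) (V t) - k t)"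
        unfolding \<xi>_def[abs_def] using \<xi>23 V_in_G
        by (simp add: cov_add_left right_diff_distrib distrib_left) (simp add: \<xi>3_def[abs_def] cov_scale_left)
      have sqrt2: "0 \<le> sqrt 2" "sqrt 2 \<le> (2::real)" by (auto intro: real_le_lsqrt)
      have "C / 2 - \<epsilon> * s2 t \<le> sqrt 2 * (L * cov (V t0) (V t) - k t)"
      proof -
        consider "t \<le> \<eta>" | "\<eta> < t" "t \<le> t0" | "\<eta> < t" "t0 < t" by linarith
        then show ?thesis
        proof cases
          case 1
          \<comment> \<open>The deviation \<open>- C / 4\<close> becomes at most
            \<open>- C / 2\<close> after multiplication by \<open>sqrt 2\<close>; the process stays
            above \<open>C / 2\<close>, strictly above \<open>C\<close>.\<close>
          have "sqrt 2 * (- C / 4) \<le> 2 * (- C / 4)" using sqrt2 C by (intro mult_right_mono) auto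
          moreover have "0 \<le> sqrt 2 * (L * cov (V t0) (V t))" using L c3(1) by simp
          moreover have "0 \<le> \<epsilon> * s2 t" using \<epsilon> s2_nonneg[of t] by simp
          ultimately show ?thesis using 1 by (simp add: k_def algebra_simps)
        next
          case 2
          have "s2 \<eta> \<le> s2 t" using 2 \<eta> fbm_H unfolding s2_fbm by (intro powr_mono2) auto
          then have "L * (s2 \<eta> / 2) \<le> L * cov (V t0) (V t)" using c3(2) 2 L by (intro mult_left_mono) auto
          moreover have "L * (s2 \<eta> / 2) = R" using s2\<eta> by (simp add: L_def)
          ultimately have "0 \<le> sqrt 2 * (L * cov (V t0) (V t) - k t)" using 2 by (simp add: k_def)
          moreover have "0 \<le> \<epsilon> * s2 t" using \<epsilon> s2_nonneg[of t] by simp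
          ultimately show ?thesis using C by linarith
        next
          case 3
          have "sqrt 2 * (\<epsilon> / 2 * s2 t) \<le> 2 * (\<epsilon> / 2 * s2 t)"
            using sqrt2 \<epsilon> s2_nonneg[of t] by (intro mult_right_mono) auto
          moreover have "0 \<le> sqrt 2 * (L * cov (V t0) (V t))" using L c3(1) by simp
          ultimately show ?thesis using 3 C by (simp add: k_def right_diff_distrib)
        qed
      qed
      then show "C / 2 \<le> sqrt 2 * (cov \<xi> (V t) - k t) - s2 t" unfolding cov_eq using c2 by linarith
    qed simp
    also have "\<dots> \<le> persistence_prob M V T C" using elim C by (intro persistence_prob_ge) auto
    finally have "exp (- cov \<xi> \<xi> / 2) * prob {\<omega> \<in> space M. \<forall>t\<in>?D. \<bar>V t \<omega>\<bar> \<le> k t} \<le> persistence_prob M V T C" .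
    moreover have "exp (- cov \<xi> \<xi> / 2) * (1/2) \<le> exp (- cov \<xi> \<xi> / 2) * prob {\<omega> \<in> space M. \<forall>t\<in>?D. \<bar>V t \<omega>\<bar> \<le> k t}"
      using prob_k[of T] by (intro mult_left_mono) auto
    moreover have "exp (- (A_fbm H + e) * (s2 T / 2)) \<le> exp (- cov \<xi> \<xi> / 2) * (1/2)"
    proof -
      have "K + 2 * ln 2 \<le> e / 2 * s2 T" using elim(2) e by (simp add: field_simps)
      then have "- (A_fbm H + e) * (s2 T / 2) \<le> - cov \<xi> \<xi> / 2 + - ln 2"
        using cov_\<xi> by (simp add: field_simps)
      then have "exp (- (A_fbm H + e) * (s2 T / 2)) \<le> exp (- cov \<xi> \<xi> / 2 + - ln 2)" by simp
      also have "\<dots> = exp (- cov \<xi> \<xi> / 2) * (1/2)" by (simp only: exp_add exp_minus[of "ln 2"]) simp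
      finally show ?thesis .
    qed
    ultimately show ?case by linarith
  qed
qed

text \<open>The upper half is inherited from the expected infimum by Markov's inequality; the
  constant factor \<open>exp (- C)\<close> is absorbed by half of the error \<open>e\<close> once
  \<open>s2 T\<close> is large.\<close>

theorem persistence_prob_decay:
  assumes C: "C < 0"
  shows "((\<lambda>T. - ln (persistence_prob M V T C) / variogram M V T) \<longlongrightarrow> A_fbm H) at_top"
proof (rule tendsto_of_eventually_near)
  fix e :: real assume e: "0 < e"
  have "\<forall>\<^sub>F T in at_top. persistence_prob M V T C \<le> exp (- (A_fbm H - e) * (s2 T / 2))"
    using expected_infimum_upper[OF half_gt_zero[OF e]] eventually_s2_pos[of "- C / (e / 4)"] eventually_gt_at_top[of 0]
  proof eventually_elim
    case (elim T)
    have "persistence_prob M V T C \<le> exp (- C) * expected_infimum M V T"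
      using elim by (intro persistence_prob_le)
    also have "\<dots> \<le> exp (- C) * exp (- (A_fbm H - e / 2) * (s2 T / 2))"
      using elim e by (intro mult_left_mono) auto
    also have "\<dots> \<le> exp (- (A_fbm H - e) * (s2 T / 2))"
      using elim(2) e by (simp add: mult_exp_exp field_simps)
    finally show ?case .
  qed
  then show "\<forall>\<^sub>F T in at_top. \<bar>- ln (persistence_prob M V T C) / variogram M V T - A_fbm H\<bar> \<le> e"
    using persistence_prob_lower[OF C e] eventually_s2_pos[of 0]
    by eventually_elim (simp only: variogram_eq, rule neg_ln_ratio_near, auto)
qed

end

theorem theorem2p6:
  fixes H :: real
    and M :: "'a measure" and V :: "real \<Rightarrow> 'a \<Rightarrow> real"
    and N :: "'b measure" and B :: "real \<Rightarrow> 'b \<Rightarrow> real"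
  assumes "0 < H" and "H < 1"
  shows "(gaussian_process M V \<and> centered_process M V \<and> stationary_increments M V \<and>
            continuous_paths M V \<and> std_fun M V 0 = 0 \<and> regularly_varying (std_fun M V) H
          \<longrightarrow> ((\<lambda>T. - ln (expected_infimum M V T) / variogram M V T) \<longlongrightarrow> A_fbm H) at_top)
       \<and> (H < 1/2 \<longrightarrow> A_fbm H \<in> {1/2<..<1})
       \<and> (standard_fbm N H B
          \<longrightarrow> (\<forall>C<0. ((\<lambda>T. - ln (persistence_prob N B T C) / variogram N B T) \<longlongrightarrow> A_fbm H) at_top))"
proof (intro conjI impI allI)
  assume V: "gaussian_process M V \<and> centered_process M V \<and> stationary_increments M V \<and>
            continuous_paths M V \<and> std_fun M V 0 = 0 \<and> regularly_varying (std_fun M V) H"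
  interpret regularly_varying_gaussian M V H
    by unfold_locales (use V assms in auto)
  show "((\<lambda>T. - ln (expected_infimum M V T) / variogram M V T) \<longlongrightarrow> A_fbm H) at_top"
    by (rule expected_infimum_decay)
next
  assume "H < 1/2"
  then show "A_fbm H \<in> {1/2<..<1}" using A_fbm_bounds[of H] assms by simp
next
  fix C :: real assume B: "standard_fbm N H B" and C: "C < 0"
  interpret fractional_brownian N B H
    by unfold_locales (use B assms in \<open>auto simp: standard_fbm_def std_fun_def\<close>)
  show "((\<lambda>T. - ln (persistence_prob N B T C) / variogram N B T) \<longlongrightarrow> A_fbm H) at_top"
    using C by (rule persistence_prob_decay)
qed

end
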